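(* The algebra $Y(\mathfrak g,\mathcal G)^{tw}$ is a left coideal subalgebra of $Y(\mathfrak g)$: $$\Delta\big(Y(\mathfrak g,\mathcal G)^{tw}\big)\subset Y(\mathfrak g)\otimes Y(\mathfrak g,\mathcal G)^{tw}.$$
   Context: Notation. Tensor products are over $\mathbb C$. $\mathfrak g$ is $\mathfrak{so}_N$ ($N=2n$ or $N=2n+1$) or $\mathfrak{sp}_N$ ($N=2n$), $n\ge1$. Rows and columns of $N\times N$ matrices are indexed by $-n,\dots,-1,1,\dots,n$ if $N=2n$ and by $-n,\dots,n$ (including $0$) if $N=2n+1$. $\theta_{ij}=1$ in the orthogonal case and $\theta_{ij}=\mathrm{sign}(i)\,\mathrm{sign}(j)$ in the symplectic case. The transposition $t$ is $(E_{ij})^t=\theta_{ij}E_{-j,-i}$. In $\mp$ the upper sign is for the orthogonal case, the lower for the symplectic case. $\kappa=N/2\mp1$. $P=\sum_{i,j}E_{ij}\otimes E_{ji}$, $Q=\sum_{i,j}\theta_{ij}E_{ij}\otimes E_{-i,-j}$, $R(u)=I-\frac{P}{u}+\frac{Q}{u-\kappa}$. Extended Yangian. $X(\mathfrak g)$ is the associative unital $\mathbb C$-algebra with generators $t_{ij}^{(r)}$, $r\ge 0$, $t_{ij}^{(0)}=\delta_{ij}$, and relations $R(u-v)T_1(u)T_2(v)=T_2(v)T_1(u)R(u-v)$, where $T(u)=\sum_{i,j}E_{ij}\otimes t_{ij}(u)$, $t_{ij}(u)=\sum_{r\ge0}t_{ij}^{(r)}u^{-r}$; it is a Hopf algebra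 with coproduct $\Delta(t_{ij}(u))=\sum_kt_{ik}(u)\otimes t_{kj}(u)$. One has $T^t(u+\kappa)T(u)=T(u)T^t(u+\kappa)=z(u)I$ with $z(u)\in1+u^{-1}X(\mathfrak g)[[u^{-1}]]$ having central coefficients, $\Delta(z(u))=z(u)\otimes z(u)$. Let $y(u)$ be the unique series with constant term $1$ such that $z(u)=y(u)y(u+\kappa)$, and $\mathcal T(u)=y(u)^{-1}T(u)$. The Yangian $Y(\mathfrak g)=X(\mathfrak g)/(z(u)-1)$ is identified (as a Hopf algebra, via the quotient map) with the subalgebra $\widetilde Y(\mathfrak g)$ of $X(\mathfrak g)$ generated by the coefficients of the entries of $\mathcal T(u)$. The matrix $\mathcal G$ is one of the following. BCD0: $\mathcal G=I$. CI ($\mathfrak g=\mathfrak{sp}_N$) and DIII ($\mathfrak g=\mathfrak{so}_N$, $N$ even): $\mathcal G=\sum_{i=1}^{N/2}(E_{ii}-E_{-i,-i})$. CII ($\mathfrak g=\mathfrak{sp}_N$, $N=p+q$, $p,q$ even, $p\ge q>0$): $\mathcal G=-\sum_{i=1}^{q/2}(E_{ii}+E_{-i,-i})+\sum_{i=q/2+1}^{N/2}(E_{ii}+E_{-i,-i})$. BDI ($\mathfrak g=\mathfrak{so}_N$, $N=p+q$, with $p>q>0$ if $N$ is odd, $p\ge q>0$ if $N$ is even): $\mathcal G=\sum_{i=1}^{(p-q)/2}(E_{ii}+E_{-i,-i})+\sum_{i=(p-q)/2+1}^{N/2}(E_{-i,i}+E_{i,-i})$ for $N$ even, and $\mathcal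 G=\sum_{i=-(p-q-1)/2}^{(p-q-1)/2}E_{ii}+\sum_{i=(p-q+1)/2}^{(N-1)/2}(E_{-i,i}+E_{i,-i})$ for $N$ odd. Set $\mathcal G(u)=\mathcal G$ in types BCD0, CI, DIII and in types BDI, CII with $p=q$; set $\mathcal G(u)=(I-cu\,\mathcal G)(1-cu)^{-1}$, $c=\frac{4}{p-q}$, in types BDI, CII with $p>q$ (expanded in $u^{-1}$). $X(\mathfrak g,\mathcal G)^{tw}$ is the subalgebra of $X(\mathfrak g)$ generated by the coefficients of the entries of $S(u)=T(u-\kappa/2)\,\mathcal G(u)\,T^t(-u+\kappa/2)$, and $Y(\mathfrak g,\mathcal G)^{tw}=X(\mathfrak g,\mathcal G)^{tw}/(S(u)S(-u)-I)$. The latter is identified, via the quotient homomorphism, with the subalgebra $\widetilde Y(\mathfrak g,\mathcal G)^{tw}\subset\widetilde Y(\mathfrak g)$ generated by the coefficients of the entries of $\Sigma(u)=\mathcal T(u-\kappa/2)\,\mathcal G(u)\,\mathcal T^t(-u+\kappa/2)$; this is the sense in which $Y(\mathfrak g,\mathcal G)^{tw}$ is a subalgebra of $Y(\mathfrak g)$. *)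

theory Defs
  imports
    "HOL-Library.Poly_Mapping"
    "HOL-Computational_Algebra.Formal_Laurent_Series"
    "HOL-Computational_Algebra.Polynomial"
    "HOL-Algebra.QuotRing"
    "HOL-Algebra.Subrings"
    "HOL-Algebra.Module"
    "HOL-Algebra.Algebraic_Closure_Type"
begin

section \<open>Associative unital complex algebras\<close>

type_synonym 'a complex_algebra = "(complex, 'a) module"

definition monoid_algebra :: "('m, 'b) monoid_scheme \<Rightarrow> ('m \<Rightarrow>\<^sub>0 complex) complex_algebra" where
  "monoid_algebra M =
     \<lparr>carrier = {p. Poly_Mapping.keys p \<subseteq> carrier M},
      monoid.mult = (\<lambda>p q. \<Sum>x\<in>Poly_Mapping.keys p. \<Sum>y\<in>Poly_Mapping.keys q.
        Poly_Mapping.single (x \<otimes>\<^bsub>M\<^esub> y) (Poly_Mapping.lookup p x * Poly_Mapping.lookup q y)),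
      one = Poly_Mapping.single \<one>\<^bsub>M\<^esub> 1,
      ring.zero = 0,
      add = (+),
      module.smult = (\<lambda>c p. Poly_Mapping.map ((*) c) p)\<rparr>"

definition free_algebra :: "'g set \<Rightarrow> ('g list \<Rightarrow>\<^sub>0 complex) complex_algebra" where
  "free_algebra G = monoid_algebra \<lparr>carrier = lists G, monoid.mult = (@), one = []\<rparr>"

text \<open>A two-sided ideal of a unital algebra is stable under scalars, so the scalar
  multiplication descends to cosets.\<close>

definition quotient_algebra :: "'a complex_algebra \<Rightarrow> 'a set \<Rightarrow> 'a set complex_algebra" where
  "quotient_algebra A I =
     \<lparr>carrier = carrier (A Quot I),
      monoid.mult = monoid.mult (A Quot I),
      one = one (A Quot I),
      ring.zero = ring.zero (A Quot I),
      add = add (A Quot I),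
      module.smult = (\<lambda>c C. \<Union>a\<in>C. I +>\<^bsub>A\<^esub> (c \<odot>\<^bsub>A\<^esub> a))\<rparr>"

definition is_subspace :: "'a set \<Rightarrow> 'a complex_algebra \<Rightarrow> bool" where
  "is_subspace U A \<longleftrightarrow> submodule U (ring_of_type_algebra :: complex ring) A"

definition is_subalgebra :: "'a set \<Rightarrow> 'a complex_algebra \<Rightarrow> bool" where
  "is_subalgebra B A \<longleftrightarrow> is_subspace B A \<and> subring B A"

definition generated_subalgebra :: "'a complex_algebra \<Rightarrow> 'a set \<Rightarrow> 'a set" where
  "generated_subalgebra A S = \<Inter>{B. is_subalgebra B A \<and> S \<subseteq> B}"

definition spanned_subspace :: "'a complex_algebra \<Rightarrow> 'a set \<Rightarrow> 'a set" where
  "spanned_subspace A S = \<Inter>{U. is_subspace U A \<and> S \<subseteq> U}"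

text \<open>The value of a noncommutative polynomial at \<open>\<phi>\<close>, i.e. the extension of \<open>\<phi>\<close> to an
  algebra homomorphism from the free algebra to \<open>A\<close>.\<close>

definition free_eval :: "'a complex_algebra \<Rightarrow> ('g \<Rightarrow> 'a) \<Rightarrow> ('g list \<Rightarrow>\<^sub>0 complex) \<Rightarrow> 'a" where
  "free_eval A \<phi> p =
     (\<Oplus>\<^bsub>A\<^esub>w\<in>Poly_Mapping.keys p. Poly_Mapping.lookup p w \<odot>\<^bsub>A\<^esub> foldr (\<lambda>g x. \<phi> g \<otimes>\<^bsub>A\<^esub> x) w \<one>\<^bsub>A\<^esub>)"

section \<open>Tensor products over the complex numbers\<close>

text \<open>The tensor product is the vector space freely spanned by \<open>carrier A \<times> carrier B\<close> modulo the
  bilinearity relations.  The free space carries the componentwise product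
  \<open>(a, b)(a', b') = (aa', bb')\<close>; the linear span of the bilinearity relations is already a
  two-sided ideal for it, so it makes no difference that the ideal they generate is used.\<close>

definition pair_algebra ::
  "'a complex_algebra \<Rightarrow> 'b complex_algebra \<Rightarrow> ('a \<times> 'b \<Rightarrow>\<^sub>0 complex) complex_algebra" where
  "pair_algebra A B = monoid_algebra (A \<times>\<times> B)"

definition bilinearity_relations ::
  "'a complex_algebra \<Rightarrow> 'b complex_algebra \<Rightarrow> ('a \<times> 'b \<Rightarrow>\<^sub>0 complex) set" where
  "bilinearity_relations A B =
     {Poly_Mapping.single (a \<oplus>\<^bsub>A\<^esub> a', b) 1 - Poly_Mapping.single (a, b) 1
        - Poly_Mapping.single (a', b) 1 | a a' b.
        a \<in> carrier A \<and> a' \<in> carrier A \<and> b \<in> carrier B} \<union>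
     {Poly_Mapping.single (a, b \<oplus>\<^bsub>B\<^esub> b') 1 - Poly_Mapping.single (a, b) 1
        - Poly_Mapping.single (a, b') 1 | a b b'.
        a \<in> carrier A \<and> b \<in> carrier B \<and> b' \<in> carrier B} \<union>
     {Poly_Mapping.single (c \<odot>\<^bsub>A\<^esub> a, b) 1 - Poly_Mapping.single (a, b) c | a b c.
        a \<in> carrier A \<and> b \<in> carrier B} \<union>
     {Poly_Mapping.single (a, c \<odot>\<^bsub>B\<^esub> b) 1 - Poly_Mapping.single (a, b) c | a b c.
        a \<in> carrier A \<and> b \<in> carrier B}"

definition bilinearity_ideal ::
  "'a complex_algebra \<Rightarrow> 'b complex_algebra \<Rightarrow> ('a \<times> 'b \<Rightarrow>\<^sub>0 complex) set" where
  "bilinearity_ideal A B = Idl\<^bsub>pair_algebra A B\<^esub> (bilinearity_relations A B)"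

definition tensor_algebra ::
  "'a complex_algebra \<Rightarrow> 'b complex_algebra \<Rightarrow> ('a \<times> 'b \<Rightarrow>\<^sub>0 complex) set complex_algebra" where
  "tensor_algebra A B = quotient_algebra (pair_algebra A B) (bilinearity_ideal A B)"

definition pure_tensor ::
  "'a complex_algebra \<Rightarrow> 'b complex_algebra \<Rightarrow> 'a \<Rightarrow> 'b \<Rightarrow> ('a \<times> 'b \<Rightarrow>\<^sub>0 complex) set" where
  "pure_tensor A B a b =
     bilinearity_ideal A B +>\<^bsub>pair_algebra A B\<^esub> Poly_Mapping.single (a, b) 1"

text \<open>For subspaces \<open>U\<close> of \<open>A\<close> and \<open>V\<close> of \<open>B\<close>: the tensor product of \<open>U\<close> and \<open>V\<close>, regarded as a
  subspace of the tensor product of \<open>A\<close> and \<open>B\<close>.\<close>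

definition tensor_subspace ::
  "'a complex_algebra \<Rightarrow> 'b complex_algebra \<Rightarrow> 'a set \<Rightarrow> 'b set
    \<Rightarrow> ('a \<times> 'b \<Rightarrow>\<^sub>0 complex) set set" where
  "tensor_subspace A B U V =
     spanned_subspace (tensor_algebra A B) {pure_tensor A B a b | a b. a \<in> U \<and> b \<in> V}"

section \<open>Formal series in the inverse of u and matrices\<close>

text \<open>A function \<open>f :: nat \<Rightarrow> 'a\<close> stands for the series \<open>\<Sum>r. f r u^(-r)\<close>.\<close>

definition series_algebra :: "'a complex_algebra \<Rightarrow> (nat \<Rightarrow> 'a) complex_algebra" where
  "series_algebra A =
     \<lparr>carrier = {f. \<forall>r. f r \<in> carrier A},
      monoid.mult = (\<lambda>f g r. \<Oplus>\<^bsub>A\<^esub>s\<in>{..r}. f s \<otimes>\<^bsub>A\<^esub> g (r - s)),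
      one = (\<lambda>r. if r = 0 then \<one>\<^bsub>A\<^esub> else \<zero>\<^bsub>A\<^esub>),
      ring.zero = (\<lambda>r. \<zero>\<^bsub>A\<^esub>),
      add = (\<lambda>f g r. f r \<oplus>\<^bsub>A\<^esub> g r),
      module.smult = (\<lambda>c f r. c \<odot>\<^bsub>A\<^esub> f r)\<rparr>"

text \<open>Complex rational functions of \<open>u\<close> are expanded at infinity as Laurent series in the
  variable \<open>fls_X\<close>, which plays the role of the inverse of \<open>u\<close>.\<close>

definition u_fls :: "complex fls" where
  "u_fls = inverse fls_X"

text \<open>The series \<open>f(\<epsilon>u + a)\<close>, for nonzero \<open>\<epsilon>\<close>.  As \<open>(\<epsilon>u + a)^(-s)\<close> is of order at least \<open>s\<close> in the
  inverse of \<open>u\<close>, only the \<open>f s\<close> with \<open>s \<le> r\<close> contribute to the coefficient of \<open>u^(-r)\<close>.\<close>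

definition series_subst ::
  "'a complex_algebra \<Rightarrow> complex \<Rightarrow> complex \<Rightarrow> (nat \<Rightarrow> 'a) \<Rightarrow> (nat \<Rightarrow> 'a)" where
  "series_subst A \<epsilon> a f =
     (\<lambda>r. \<Oplus>\<^bsub>A\<^esub>s\<in>{..r}.
        fls_nth (inverse (fls_const \<epsilon> * u_fls + fls_const a) ^ s) (int r) \<odot>\<^bsub>A\<^esub> f s)"

type_synonym 'a matrix_series = "int \<Rightarrow> int \<Rightarrow> nat \<Rightarrow> 'a"

definition matrix_mult ::
  "'a complex_algebra \<Rightarrow> int set \<Rightarrow> 'a matrix_series \<Rightarrow> 'a matrix_series \<Rightarrow> 'a matrix_series" where
  "matrix_mult A J M M' =
     (\<lambda>i j. \<Oplus>\<^bsub>series_algebra A\<^esub>k\<in>J. M i k \<otimes>\<^bsub>series_algebra A\<^esub> M' k j)"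

definition scalar_matrix :: "'a complex_algebra \<Rightarrow> (nat \<Rightarrow> 'a) \<Rightarrow> 'a matrix_series" where
  "scalar_matrix A f = (\<lambda>i j. if i = j then f else \<zero>\<^bsub>series_algebra A\<^esub>)"

definition matrix_subst ::
  "'a complex_algebra \<Rightarrow> complex \<Rightarrow> complex \<Rightarrow> 'a matrix_series \<Rightarrow> 'a matrix_series" where
  "matrix_subst A \<epsilon> a M = (\<lambda>i j. series_subst A \<epsilon> a (M i j))"

section \<open>The orthogonal and symplectic data\<close>

datatype lie_type = Orthogonal | Symplectic

definition valid_lie_type :: "lie_type \<Rightarrow> nat \<Rightarrow> bool" where
  "valid_lie_type g N \<longleftrightarrow> N \<ge> 2 \<and> (g = Symplectic \<longrightarrow> even N)"

definition indices :: "nat \<Rightarrow> int set" where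
  "indices N = (if even N then {- int (N div 2)..int (N div 2)} - {0}
                else {- int (N div 2)..int (N div 2)})"

definition theta :: "lie_type \<Rightarrow> int \<Rightarrow> int \<Rightarrow> complex" where
  "theta g i j = (case g of Orthogonal \<Rightarrow> 1 | Symplectic \<Rightarrow> of_int (sgn i * sgn j))"

definition kappa :: "lie_type \<Rightarrow> nat \<Rightarrow> complex" where
  "kappa g N = (case g of Orthogonal \<Rightarrow> of_nat N / 2 - 1 | Symplectic \<Rightarrow> of_nat N / 2 + 1)"

text \<open>The linear map with \<open>E i j \<mapsto> theta i j E (-j) (-i)\<close>, on entries.\<close>

definition transposition ::
  "'a complex_algebra \<Rightarrow> lie_type \<Rightarrow> 'a matrix_series \<Rightarrow> 'a matrix_series" where
  "transposition A g M = (\<lambda>i j. theta g (- j) (- i) \<odot>\<^bsub>series_algebra A\<^esub> M (- j) (- i))"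

text \<open>The coefficients of \<open>E i j \<otimes> E k l\<close> in \<open>P\<close> and \<open>Q\<close>.\<close>

definition P_entry :: "int \<Rightarrow> int \<Rightarrow> int \<Rightarrow> int \<Rightarrow> complex" where
  "P_entry i j k l = (if k = j \<and> l = i then 1 else 0)"

definition Q_entry :: "lie_type \<Rightarrow> int \<Rightarrow> int \<Rightarrow> int \<Rightarrow> int \<Rightarrow> complex" where
  "Q_entry g i j k l = (if k = - i \<and> l = - j then theta g i j else 0)"

text \<open>The coefficient of \<open>u^(-d)\<close> in the expansion of \<open>1 / (u - w)\<close>, where \<open>w\<close> is a polynomial in \<open>v\<close>.\<close>

definition resolvent_coeff :: "complex poly \<Rightarrow> nat \<Rightarrow> complex poly" where
  "resolvent_coeff w d = (case d of 0 \<Rightarrow> 0 | Suc k \<Rightarrow> w ^ k)"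

text \<open>The coefficient of \<open>E i j \<otimes> E k l\<close> and \<open>u^(-d)\<close> in \<open>R(u - v)\<close>, a polynomial in \<open>v\<close> of degree at
  most \<open>d\<close>.\<close>

definition R_entry :: "lie_type \<Rightarrow> nat \<Rightarrow> int \<Rightarrow> int \<Rightarrow> int \<Rightarrow> int \<Rightarrow> nat \<Rightarrow> complex poly" where
  "R_entry g N i j k l d =
     (if d = 0 \<and> i = j \<and> k = l then 1 else 0)
     - Polynomial.smult (P_entry i j k l) (resolvent_coeff [:0, 1:] d)
     + Polynomial.smult (Q_entry g i j k l) (resolvent_coeff [:kappa g N, 1:] d)"

section \<open>The extended Yangian\<close>

text \<open>The triple \<open>(i, j, r)\<close> is the generator \<open>t i j (r)\<close>.\<close>

type_synonym generator = "int \<times> int \<times> nat"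

definition generators :: "nat \<Rightarrow> generator set" where
  "generators N = indices N \<times> indices N \<times> UNIV"

definition unit_relation :: "int \<Rightarrow> int \<Rightarrow> (generator list \<Rightarrow>\<^sub>0 complex)" where
  "unit_relation i j =
     Poly_Mapping.single [(i, j, 0)] 1 - Poly_Mapping.single [] (if i = j then 1 else 0)"

text \<open>The coefficient of \<open>E i j \<otimes> E k l\<close> and \<open>u^(-m) v^(-s)\<close> in
  \<open>R(u-v) T1(u) T2(v) - T2(v) T1(u) R(u-v)\<close>, with \<open>R(u-v)\<close> expanded in powers of the inverse of \<open>u\<close>.
  Nonnegative powers of \<open>v\<close> occur as well, so \<open>s\<close> is an integer.  This is equivalent to the relation
  obtained after multiplication by the denominator \<open>(u - v)(u - v - \<kappa>)\<close>.\<close>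

definition RTT_relation ::
  "lie_type \<Rightarrow> nat \<Rightarrow> int \<Rightarrow> int \<Rightarrow> int \<Rightarrow> int \<Rightarrow> nat \<Rightarrow> int \<Rightarrow> (generator list \<Rightarrow>\<^sub>0 complex)" where
  "RTT_relation g N i j k l m s =
     (\<Sum>a\<in>indices N. \<Sum>b\<in>indices N. \<Sum>d\<in>{..m}. \<Sum>e\<in>{e. e \<le> d \<and> 0 \<le> s + int e}.
        Poly_Mapping.single [(a, j, m - d), (b, l, nat (s + int e))]
          (Polynomial.coeff (R_entry g N i a k b d) e)
        - Poly_Mapping.single [(k, b, nat (s + int e)), (i, a, m - d)]
          (Polynomial.coeff (R_entry g N a j b l d) e))"

definition defining_relations :: "lie_type \<Rightarrow> nat \<Rightarrow> (generator list \<Rightarrow>\<^sub>0 complex) set" where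
  "defining_relations g N =
     {unit_relation i j | i j. i \<in> indices N \<and> j \<in> indices N} \<union>
     {RTT_relation g N i j k l m s | i j k l m s.
        i \<in> indices N \<and> j \<in> indices N \<and> k \<in> indices N \<and> l \<in> indices N}"

definition yangian_ideal :: "lie_type \<Rightarrow> nat \<Rightarrow> (generator list \<Rightarrow>\<^sub>0 complex) set" where
  "yangian_ideal g N = Idl\<^bsub>free_algebra (generators N)\<^esub> (defining_relations g N)"

type_synonym yangian_elem = "(generator list \<Rightarrow>\<^sub>0 complex) set"

definition extended_yangian :: "lie_type \<Rightarrow> nat \<Rightarrow> yangian_elem complex_algebra" where
  "extended_yangian g N = quotient_algebra (free_algebra (generators N)) (yangian_ideal g N)"

definition T_matrix :: "lie_type \<Rightarrow> nat \<Rightarrow> yangian_elem matrix_series" where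
  "T_matrix g N i j r =
     yangian_ideal g N +>\<^bsub>free_algebra (generators N)\<^esub> Poly_Mapping.single [(i, j, r)] 1"

abbreviation XX :: "lie_type \<Rightarrow> nat \<Rightarrow> (yangian_elem \<times> yangian_elem \<Rightarrow>\<^sub>0 complex) set complex_algebra" where
  "XX g N \<equiv> tensor_algebra (extended_yangian g N) (extended_yangian g N)"

definition coproduct_generator ::
  "lie_type \<Rightarrow> nat \<Rightarrow> generator \<Rightarrow> (yangian_elem \<times> yangian_elem \<Rightarrow>\<^sub>0 complex) set" where
  "coproduct_generator g N = (\<lambda>(i, j, r).
     \<Oplus>\<^bsub>XX g N\<^esub>k\<in>indices N. \<Oplus>\<^bsub>XX g N\<^esub>s\<in>{..r}.
       pure_tensor (extended_yangian g N) (extended_yangian g N) (T_matrix g N i k s) (T_matrix g N k j (r - s)))"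

text \<open>The algebra homomorphism induced on the quotient: all representatives of the coset \<open>x\<close> have the
  same image.\<close>

definition coproduct ::
  "lie_type \<Rightarrow> nat \<Rightarrow> yangian_elem \<Rightarrow> (yangian_elem \<times> yangian_elem \<Rightarrow>\<^sub>0 complex) set" where
  "coproduct g N x = the_elem (free_eval (XX g N) (coproduct_generator g N) ` x)"

definition is_z_series :: "lie_type \<Rightarrow> nat \<Rightarrow> (nat \<Rightarrow> yangian_elem) \<Rightarrow> bool" where
  "is_z_series g N f \<longleftrightarrow>
     (let A = extended_yangian g N;
          Tt = matrix_subst A 1 (kappa g N) (transposition A g (T_matrix g N))
      in f \<in> carrier (series_algebra A) \<and>
         (\<forall>i\<in>indices N. \<forall>j\<in>indices N.
            matrix_mult A (indices N) Tt (T_matrix g N) i j = scalar_matrix A f i j \<and>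
            matrix_mult A (indices N) (T_matrix g N) Tt i j = scalar_matrix A f i j))"

definition z_series :: "lie_type \<Rightarrow> nat \<Rightarrow> nat \<Rightarrow> yangian_elem" where
  "z_series g N = (THE f. is_z_series g N f)"

definition y_series :: "lie_type \<Rightarrow> nat \<Rightarrow> nat \<Rightarrow> yangian_elem" where
  "y_series g N =
     (let A = extended_yangian g N
      in THE f. f \<in> carrier (series_algebra A) \<and> f 0 = \<one>\<^bsub>A\<^esub> \<and>
           z_series g N = f \<otimes>\<^bsub>series_algebra A\<^esub> series_subst A 1 (kappa g N) f)"

definition calT :: "lie_type \<Rightarrow> nat \<Rightarrow> yangian_elem matrix_series" where
  "calT g N =
     (\<lambda>i j. m_inv (series_algebra (extended_yangian g N)) (y_series g N)
        \<otimes>\<^bsub>series_algebra (extended_yangian g N)\<^esub> T_matrix g N i j)"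

text \<open>The Yangian, i.e. the quotient of the extended Yangian by the relations \<open>z(u) = 1\<close>, realised as
  the subalgebra of the extended Yangian to which it is isomorphic under the quotient map.\<close>

definition yangian :: "lie_type \<Rightarrow> nat \<Rightarrow> yangian_elem set" where
  "yangian g N = generated_subalgebra (extended_yangian g N)
     {calT g N i j r | i j r. i \<in> indices N \<and> j \<in> indices N}"

section \<open>Symmetric pairs and twisted Yangians\<close>

text \<open>The natural number arguments are \<open>p\<close> and \<open>q\<close>.\<close>

datatype pair_type = BCD0 | CI | DIII | CII nat nat | BDI nat nat

definition valid_pair_type :: "lie_type \<Rightarrow> nat \<Rightarrow> pair_type \<Rightarrow> bool" where
  "valid_pair_type g N \<tau> \<longleftrightarrow> valid_lie_type g N \<and>
     (case \<tau> of
        BCD0 \<Rightarrow> True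
      | CI \<Rightarrow> g = Symplectic
      | DIII \<Rightarrow> g = Orthogonal \<and> even N
      | CII p q \<Rightarrow> g = Symplectic \<and> N = p + q \<and> even p \<and> even q \<and> p \<ge> q \<and> q > 0
      | BDI p q \<Rightarrow> g = Orthogonal \<and> N = p + q \<and> q > 0 \<and> (if odd N then p > q else p \<ge> q))"

definition matrix_unit :: "int \<Rightarrow> int \<Rightarrow> int \<Rightarrow> int \<Rightarrow> complex" where
  "matrix_unit a b i j = (if i = a \<and> j = b then 1 else 0)"

definition G_entry :: "nat \<Rightarrow> pair_type \<Rightarrow> int \<Rightarrow> int \<Rightarrow> complex" where
  "G_entry N \<tau> i j = (let n = int (N div 2) in
     case \<tau> of
       BCD0 \<Rightarrow> (if i = j then 1 else 0)
     | CI \<Rightarrow> (\<Sum>a\<in>{1..n}. matrix_unit a a i j - matrix_unit (- a) (- a) i j)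
     | DIII \<Rightarrow> (\<Sum>a\<in>{1..n}. matrix_unit a a i j - matrix_unit (- a) (- a) i j)
     | CII p q \<Rightarrow>
         - (\<Sum>a\<in>{1..int q div 2}. matrix_unit a a i j + matrix_unit (- a) (- a) i j)
         + (\<Sum>a\<in>{int q div 2 + 1..n}. matrix_unit a a i j + matrix_unit (- a) (- a) i j)
     | BDI p q \<Rightarrow>
         if even N then
           (\<Sum>a\<in>{1..(int p - int q) div 2}. matrix_unit a a i j + matrix_unit (- a) (- a) i j)
           + (\<Sum>a\<in>{(int p - int q) div 2 + 1..n}. matrix_unit (- a) a i j + matrix_unit a (- a) i j)
         else
           (\<Sum>a\<in>{- ((int p - int q - 1) div 2)..(int p - int q - 1) div 2}. matrix_unit a a i j)
           + (\<Sum>a\<in>{(int p - int q + 1) div 2..n}. matrix_unit (- a) a i j + matrix_unit a (- a) i j))"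

text \<open>The entries of \<open>(I - c u G) / (1 - c u)\<close>, respectively of the constant matrix \<open>G\<close>.\<close>

definition G_series :: "nat \<Rightarrow> pair_type \<Rightarrow> int \<Rightarrow> int \<Rightarrow> complex fls" where
  "G_series N \<tau> i j =
     (let const = fls_const (G_entry N \<tau> i j);
          twisted = (\<lambda>p q. let c = fls_const (4 / (of_nat p - of_nat q)) in
             ((if i = j then 1 else 0) - c * u_fls * const) / (1 - c * u_fls))
      in case \<tau> of
           CII p q \<Rightarrow> if p > q then twisted p q else const
         | BDI p q \<Rightarrow> if p > q then twisted p q else const
         | _ \<Rightarrow> const)"

definition G_matrix :: "'a complex_algebra \<Rightarrow> nat \<Rightarrow> pair_type \<Rightarrow> 'a matrix_series" where
  "G_matrix A N \<tau> i j r = fls_nth (G_series N \<tau> i j) (int r) \<odot>\<^bsub>A\<^esub> \<one>\<^bsub>A\<^esub>"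

definition Sigma_matrix :: "lie_type \<Rightarrow> nat \<Rightarrow> pair_type \<Rightarrow> yangian_elem matrix_series" where
  "Sigma_matrix g N \<tau> =
     (let A = extended_yangian g N
      in matrix_mult A (indices N)
           (matrix_mult A (indices N)
              (matrix_subst A 1 (- kappa g N / 2) (calT g N))
              (G_matrix A N \<tau>))
           (matrix_subst A (- 1) (kappa g N / 2) (transposition A g (calT g N))))"

text \<open>The twisted Yangian is the quotient by \<open>S(u) S(-u) = I\<close> of the subalgebra of the extended
  Yangian generated by the coefficients of \<open>S(u) = T(u - \<kappa>/2) G(u) T^t(-u + \<kappa>/2)\<close>.  Here it is
  realised as the subalgebra of \<open>yangian g N\<close> to which it is isomorphic under the quotient map.\<close>

definition twisted_yangian :: "lie_type \<Rightarrow> nat \<Rightarrow> pair_type \<Rightarrow> yangian_elem set" where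
  "twisted_yangian g N \<tau> = generated_subalgebra (extended_yangian g N)
     {Sigma_matrix g N \<tau> i j r | i j r. i \<in> indices N \<and> j \<in> indices N}"

text \<open>A left coideal subalgebra \<open>B\<close> of the Hopf algebra \<open>H\<close>, where \<open>H\<close> is a subalgebra of the Hopf
  algebra \<open>A\<close> with coproduct \<open>\<Delta>\<close>, and the coproduct of \<open>H\<close> is the restriction of \<open>\<Delta>\<close>.\<close>

definition left_coideal_subalgebra ::
  "'a complex_algebra \<Rightarrow> ('a \<Rightarrow> ('a \<times> 'a \<Rightarrow>\<^sub>0 complex) set) \<Rightarrow> 'a set \<Rightarrow> 'a set \<Rightarrow> bool" where
  "left_coideal_subalgebra A \<Delta> H B \<longleftrightarrow>
     is_subalgebra H A \<and> is_subalgebra B A \<and> B \<subseteq> H \<and> \<Delta> ` B \<subseteq> tensor_subspace A A H B"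

end

theory Submission
  imports Defs
begin

text \<open>The matrix of generators is group-like, and the coideal property comes from the identity

  \<open>\<Delta>(\<Sigma>_ij(u)) = \<Sum>k l. calT_ik(u - \<kappa>/2) calT^t_lj(-u + \<kappa>/2) \<otimes> \<Sigma>_kl(u)\<close>,

  where \<open>calT\<close> is the normalised matrix of generators (lemmas \<open>twisted_coproduct\<close>, \<open>coproduct_Sigma\<close>).  It results from
  \<open>\<Delta>(calT_ij(u)) = \<Sum>k. calT_ik(u) \<otimes> calT_kj(u)\<close>, applied to both outer factors of \<open>\<Sigma> = calT G calT^t\<close>: as
  transposition swaps the tensor factors, the indices \<open>i\<close> and \<open>j\<close> go to the first tensor factor, while
  the sums around the scalar matrix \<open>G\<close> stay together in the second one and rebuild \<open>\<Sigma>\<close>.  The elements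
  whose coproduct lies in the tensor product of the Yangian and the twisted Yangian form a subalgebra,
  and by the identity it contains the generators of the twisted Yangian.

  Three facts about the extended Yangian make this meaningful.

  The coproduct respects the defining relations.  Two families of series that satisfy the RTT relation
  and commute with each other have a matrix product that satisfies it too (\<open>RTT_family_product\<close>); the
  coproduct is the case of \<open>T(u) \<otimes> 1\<close> and \<open>1 \<otimes> T(u)\<close>.

  The series \<open>z(u)\<close> exists.  The coefficients of \<open>v^0\<close> in the RTT relation amount to
  \<open>Q T1(u + \<kappa>) T2(u) = T2(u) T1(u + \<kappa>) Q\<close> (\<open>Q_relation\<close>), and since \<open>Q\<close> has rank one, this says that
  \<open>T^t(u + \<kappa>) T(u)\<close> and \<open>T(u) T^t(u + \<kappa>)\<close> are the same scalar matrix (\<open>transpose_times_family\<close>).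

  The series \<open>z(u)\<close>, \<open>y(u)\<close> and the inverse of \<open>y(u)\<close> are group-like, hence normalising \<open>T(u)\<close> does not
  change the shape of its coproduct.  For \<open>z(u)\<close> one multiplies out; \<open>y(u)\<close> is determined by
  \<open>z(u) = y(u) y(u + \<kappa>)\<close> and its constant term, and \<open>\<Delta>(y(u))\<close> and \<open>y(u) \<otimes> y(u)\<close> solve the same equation.

  The calculations are carried out in a type class of rings.  An algebra with a carrier set is
  embedded into the product of all algebras on its type (\<open>ambient\<close>), which is such a ring, and its
  tensor square is represented there by the two commuting homomorphisms \<open>a \<otimes> 1\<close> and \<open>1 \<otimes> a\<close>.  The
  embedding sends the unit to an idempotent \<open>e\<close>, so the calculations concern rings without a
  distinguished unit and elements of the corner defined by \<open>e\<close>.\<close>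

section \<open>Rings with complex scalars and power series over them\<close>

text \<open>A complex algebra without the demand for a unit.  The image of an algebra in the ambient ring
  constructed below is not a unital subring: its unit becomes an idempotent.\<close>
class complex_ring = ring +
  fixes scaleC :: "complex \<Rightarrow> 'a \<Rightarrow> 'a" (infixr \<open>*\<^sub>C\<close> 74)
  assumes scaleC_add_right: "c *\<^sub>C (x + y) = c *\<^sub>C x + c *\<^sub>C y"
    and scaleC_add_left: "(c + d) *\<^sub>C x = c *\<^sub>C x + d *\<^sub>C x"
    and scaleC_scaleC: "c *\<^sub>C d *\<^sub>C x = (c * d) *\<^sub>C x"
    and scaleC_one [simp]: "1 *\<^sub>C x = x"
    and scaleC_mult_left: "(c *\<^sub>C x) * y = c *\<^sub>C (x * y)"
    and scaleC_mult_right: "x * (c *\<^sub>C y) = c *\<^sub>C (x * y)"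
begin

lemma scaleC_zero_right [simp]: "c *\<^sub>C 0 = 0"
  using scaleC_add_right[of c 0 0] by simp

lemma scaleC_zero_left [simp]: "0 *\<^sub>C x = 0"
  using scaleC_add_left[of 0 0 x] by simp

lemma scaleC_minus_right: "c *\<^sub>C (- x) = - (c *\<^sub>C x)"
  using scaleC_add_right[of c x "- x"] by (simp add: eq_neg_iff_add_eq_0 add.commute)

lemma scaleC_minus_left: "(- c) *\<^sub>C x = - (c *\<^sub>C x)"
  using scaleC_add_left[of c "- c" x] by (simp add: eq_neg_iff_add_eq_0 add.commute)

lemma scaleC_diff_right: "c *\<^sub>C (x - y) = c *\<^sub>C x - c *\<^sub>C y"
  using scaleC_add_right[of c x "- y"] by (simp add: scaleC_minus_right)

lemma scaleC_diff_left: "(c - d) *\<^sub>C x = c *\<^sub>C x - d *\<^sub>C x"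
  using scaleC_add_left[of c "- d" x] by (simp add: scaleC_minus_left)

lemma scaleC_sum_right: "c *\<^sub>C (\<Sum>i\<in>I. f i) = (\<Sum>i\<in>I. c *\<^sub>C f i)"
  by (induction I rule: infinite_finite_induct) (auto simp: scaleC_add_right)

lemma scaleC_sum_left: "(\<Sum>i\<in>I. c i) *\<^sub>C x = (\<Sum>i\<in>I. c i *\<^sub>C x)"
  by (induction I rule: infinite_finite_induct) (auto simp: scaleC_add_left)

end

instantiation fps :: (complex_ring) complex_ring
begin

definition scaleC_fps :: "complex \<Rightarrow> 'a fps \<Rightarrow> 'a fps" where
  "scaleC_fps c f = Abs_fps (\<lambda>n. c *\<^sub>C f $ n)"

instance
  by intro_classes
    (auto simp: scaleC_fps_def fps_eq_iff fps_mult_nth scaleC_add_right scaleC_add_left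
      scaleC_scaleC scaleC_mult_left scaleC_mult_right scaleC_sum_right)

end

lemma fps_scaleC_nth [simp]: "(c *\<^sub>C f) $ n = c *\<^sub>C f $ n"
  by (simp add: scaleC_fps_def)

locale complex_ring_hom =
  fixes h :: "'a::complex_ring \<Rightarrow> 'b::complex_ring"
  assumes add: "h (x + y) = h x + h y"
    and mult: "h (x * y) = h x * h y"
    and scaleC: "h (c *\<^sub>C x) = c *\<^sub>C h x"
begin

lemma zero: "h 0 = 0"
  using add[of 0 0] by simp

lemma sum: "h (\<Sum>i\<in>I. f i) = (\<Sum>i\<in>I. h (f i))"
  by (induction I rule: infinite_finite_induct) (auto simp: zero add)

lemma minus: "h (- x) = - h x"
  using add[of x "- x"] zero by (simp add: eq_neg_iff_add_eq_0 add.commute)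

lemma diff: "h (x - y) = h x - h y"
  using add[of x "- y"] by (simp add: minus)

end

definition map_series :: "('a \<Rightarrow> 'b) \<Rightarrow> 'a fps \<Rightarrow> 'b fps" where
  "map_series h f = Abs_fps (\<lambda>n. h (f $ n))"

lemma map_series_nth [simp]: "map_series h f $ n = h (f $ n)"
  by (simp add: map_series_def)

lemma (in complex_ring_hom) map_series_hom: "complex_ring_hom (map_series h)"
  by unfold_locales (auto simp: fps_eq_iff fps_mult_nth add mult scaleC sum)

lemma fps_mult_commute_coeffs:
  fixes f g :: "'a::ring fps"
  assumes "\<And>i j. f $ i * g $ j = g $ j * f $ i"
  shows "f * g = g * f"
proof (rule fps_ext)
  fix n
  have "(f * g) $ n = (\<Sum>i\<in>{0..n}. g $ (n - i) * f $ i)"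
    by (simp add: fps_mult_nth assms)
  also have "\<dots> = (\<Sum>i\<in>{0..n}. g $ i * f $ (n - i))"
    by (rule sum.reindex_bij_witness[of _ "\<lambda>i. n - i" "\<lambda>i. n - i"]) auto
  finally show "(f * g) $ n = (g * f) $ n"
    by (simp add: fps_mult_nth)
qed

section \<open>Substituting a scalar series\<close>

text \<open>The composition \<open>f(\<phi>(x))\<close>, for \<open>\<phi>\<close> without constant term.  With \<open>x\<close> standing for the inverse of
  \<open>u\<close>, every affine change of the variable \<open>u\<close> is of this kind.\<close>
definition substitute :: "complex fps \<Rightarrow> 'a::complex_ring fps \<Rightarrow> 'a fps" where
  "substitute \<phi> f = Abs_fps (\<lambda>r. \<Sum>s\<le>r. (\<phi> ^ s) $ r *\<^sub>C f $ s)"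

lemma substitute_nth: "substitute \<phi> f $ r = (\<Sum>s\<le>r. (\<phi> ^ s) $ r *\<^sub>C f $ s)"
  by (simp add: substitute_def)

lemma substitute_nth_0 [simp]: "substitute \<phi> f $ 0 = f $ 0"
  by (simp add: substitute_nth)

lemma substitute_add: "substitute \<phi> (f + g) = substitute \<phi> f + substitute \<phi> g"
  by (auto simp: fps_eq_iff substitute_nth scaleC_add_right sum.distrib)

lemma substitute_scaleC: "substitute \<phi> (c *\<^sub>C f) = c *\<^sub>C substitute \<phi> f"
  by (auto simp: fps_eq_iff substitute_nth scaleC_sum_right scaleC_scaleC mult.commute)

lemma substitute_zero [simp]: "substitute \<phi> 0 = 0"
  by (auto simp: fps_eq_iff substitute_nth)

lemma substitute_nth_extend:
  assumes "\<phi> $ 0 = 0" "r \<le> n"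
  shows "substitute \<phi> f $ r = (\<Sum>s\<le>n. (\<phi> ^ s) $ r *\<^sub>C f $ s)"
  unfolding substitute_nth
  by (rule sum.mono_neutral_left) (use assms in \<open>auto simp: startsby_zero_power_prefix\<close>)

lemma substitute_mult:
  assumes \<phi>: "\<phi> $ 0 = 0"
  shows "substitute \<phi> (f * g) = substitute \<phi> f * substitute \<phi> g"
proof (rule fps_ext)
  fix r
  have pow0: "(\<phi> ^ s) $ k = 0" if "k < s" for s k
    using that \<phi> by (simp add: startsby_zero_power_prefix)
  have vanish: "(\<phi> ^ (i + j)) $ r *\<^sub>C x = 0" if "\<not> i + j \<le> r" for i j and x :: 'a
    using that by (simp add: pow0)
  have "(substitute \<phi> f * substitute \<phi> g) $ r
      = (\<Sum>k\<le>r. (\<Sum>i\<le>r. (\<phi> ^ i) $ k *\<^sub>C f $ i) * (\<Sum>j\<le>r. (\<phi> ^ j) $ (r - k) *\<^sub>C g $ j))"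
    unfolding fps_mult_nth atLeast0AtMost
    by (intro sum.cong refl arg_cong2[where f="(*)"] substitute_nth_extend \<phi>) auto
  also have "\<dots> = (\<Sum>k\<le>r. \<Sum>i\<le>r. \<Sum>j\<le>r. ((\<phi> ^ i) $ k * (\<phi> ^ j) $ (r - k)) *\<^sub>C (f $ i * g $ j))"
    by (simp add: sum_product scaleC_mult_left scaleC_mult_right scaleC_scaleC)
      (simp add: mult.commute)
  also have "\<dots> = (\<Sum>i\<le>r. \<Sum>k\<le>r. \<Sum>j\<le>r. ((\<phi> ^ i) $ k * (\<phi> ^ j) $ (r - k)) *\<^sub>C (f $ i * g $ j))"
    by (rule sum.swap)
  also have "\<dots> = (\<Sum>i\<le>r. \<Sum>j\<le>r. \<Sum>k\<le>r. ((\<phi> ^ i) $ k * (\<phi> ^ j) $ (r - k)) *\<^sub>C (f $ i * g $ j))"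
    by (intro sum.cong refl sum.swap)
  also have "\<dots> = (\<Sum>i\<le>r. \<Sum>j\<le>r. (\<phi> ^ (i + j)) $ r *\<^sub>C (f $ i * g $ j))"
    by (simp add: power_add fps_mult_nth scaleC_sum_left atLeast0AtMost)
  also have "\<dots> = (\<Sum>i\<le>r. \<Sum>j\<in>{j. j \<le> r \<and> i + j \<le> r}. (\<phi> ^ (i + j)) $ r *\<^sub>C (f $ i * g $ j))"
    by (rule sum.cong[OF refl], rule sum.mono_neutral_right)
      (auto simp: vanish)
  also have "\<dots> = (\<Sum>(i, j)\<in>(SIGMA i:{..r}. {j. j \<le> r \<and> i + j \<le> r}). (\<phi> ^ (i + j)) $ r *\<^sub>C (f $ i * g $ j))"
    by (subst sum.Sigma) auto
  also have "\<dots> = (\<Sum>(s, i)\<in>(SIGMA s:{..r}. {..s}). (\<phi> ^ s) $ r *\<^sub>C (f $ i * g $ (s - i)))"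
    by (rule sum.reindex_bij_witness[of _ "\<lambda>(s, i). (i, s - i)" "\<lambda>(i, j). (i + j, i)"]) auto
  also have "\<dots> = (\<Sum>s\<le>r. \<Sum>i\<le>s. (\<phi> ^ s) $ r *\<^sub>C (f $ i * g $ (s - i)))"
    by (subst sum.Sigma) auto
  also have "\<dots> = substitute \<phi> (f * g) $ r"
    by (simp add: substitute_nth fps_mult_nth scaleC_sum_right atLeast0AtMost)
  finally show "substitute \<phi> (f * g) $ r = (substitute \<phi> f * substitute \<phi> g) $ r" ..
qed

lemma substitute_hom:
  "\<phi> $ 0 = 0 \<Longrightarrow> complex_ring_hom (substitute \<phi> :: 'a::complex_ring fps \<Rightarrow> _)"
  by unfold_locales (auto simp: substitute_add substitute_mult substitute_scaleC)

lemma substitute_fps_X: "substitute fps_X f = f"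
proof (rule fps_ext)
  fix r
  have "substitute fps_X f $ r = (\<Sum>s\<le>r. if s = r then f $ s else 0)"
    unfolding substitute_nth by (intro sum.cong refl) (auto simp: fps_X_power_nth)
  then show "substitute fps_X f $ r = f $ r"
    by simp
qed

lemma substitute_substitute:
  assumes "\<phi> $ 0 = 0" "\<psi> $ 0 = 0"
  shows "substitute \<psi> (substitute \<phi> f) = substitute (\<phi> oo \<psi>) f"
proof (rule fps_ext)
  fix r
  have "substitute \<psi> (substitute \<phi> f) $ r
      = (\<Sum>t\<le>r. (\<psi> ^ t) $ r *\<^sub>C (\<Sum>s\<le>r. (\<phi> ^ s) $ t *\<^sub>C f $ s))"
    unfolding substitute_nth[of \<psi>]
    by (intro sum.cong refl arg_cong2[where f=scaleC] substitute_nth_extend) (auto simp: assms)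
  also have "\<dots> = (\<Sum>t\<le>r. \<Sum>s\<le>r. ((\<phi> ^ s) $ t * (\<psi> ^ t) $ r) *\<^sub>C f $ s)"
    by (simp add: scaleC_sum_right scaleC_scaleC mult.commute)
  also have "\<dots> = (\<Sum>s\<le>r. \<Sum>t\<le>r. ((\<phi> ^ s) $ t * (\<psi> ^ t) $ r) *\<^sub>C f $ s)"
    by (rule sum.swap)
  also have "\<dots> = (\<Sum>s\<le>r. ((\<phi> oo \<psi>) ^ s) $ r *\<^sub>C f $ s)"
    by (subst fps_compose_power[OF assms(2)])
      (simp only: fps_compose_nth scaleC_sum_left atLeast0AtMost)
  finally show "substitute \<psi> (substitute \<phi> f) $ r = substitute (\<phi> oo \<psi>) f $ r"
    by (simp add: substitute_nth)
qed

lemma (in complex_ring_hom) map_series_substitute: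
  "map_series h (substitute \<phi> f) = substitute \<phi> (map_series h f)"
  by (auto simp: fps_eq_iff substitute_nth sum scaleC)

text \<open>The expansion of \<open>1 / (\<epsilon>u + a)\<close>, where \<open>fps_X\<close> is the inverse of \<open>u\<close>.\<close>

definition inverse_linear :: "complex \<Rightarrow> complex \<Rightarrow> complex fps" where
  "inverse_linear \<epsilon> a = fps_X * inverse (fps_const \<epsilon> + fps_const a * fps_X)"

lemma inverse_linear_nth_0 [simp]: "inverse_linear \<epsilon> a $ 0 = 0"
  by (simp add: inverse_linear_def)

lemma inverse_linear_mult:
  "\<epsilon> \<noteq> 0 \<Longrightarrow> inverse_linear \<epsilon> a * (fps_const \<epsilon> + fps_const a * fps_X) = fps_X"
  by (simp add: inverse_linear_def mult.assoc inverse_mult_eq_1)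

lemma fps_to_fls_inverse_linear:
  assumes "\<epsilon> \<noteq> 0"
  shows "fps_to_fls (inverse_linear \<epsilon> a) = inverse (fls_const \<epsilon> * u_fls + fls_const a)"
proof -
  have u: "fls_X * u_fls = 1"
    by (simp add: u_fls_def)
  have "fls_const \<epsilon> * u_fls + fls_const a = (fls_const \<epsilon> + fls_const a * fls_X) * u_fls"
    by (simp only: distrib_right mult.assoc u mult_1_right)
  moreover have "(fls_const \<epsilon> + fls_const a * fls_X) * fps_to_fls (inverse_linear \<epsilon> a) = fls_X"
    using arg_cong[OF inverse_linear_mult[OF assms, of a], of fps_to_fls]
    by (simp only: fls_times_fps_to_fls fps_to_fls_plus fps_const_to_fls fps_X_to_fls mult.commute)
  ultimately have "(fls_const \<epsilon> * u_fls + fls_const a) * fps_to_fls (inverse_linear \<epsilon> a) = 1"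
    by (simp only: mult.assoc mult.commute[of u_fls]) (simp only: mult.assoc[symmetric] u)
  then show ?thesis
    by (rule inverse_unique[symmetric])
qed

lemma fls_nth_inverse_linear_power:
  assumes "\<epsilon> \<noteq> 0"
  shows "fls_nth (inverse (fls_const \<epsilon> * u_fls + fls_const a) ^ s) (int r) = (inverse_linear \<epsilon> a ^ s) $ r"
  unfolding fps_to_fls_inverse_linear[OF assms, symmetric] fps_to_fls_power[symmetric]
  by simp

lemma inverse_linear_power_nth_diag: "(inverse_linear 1 a ^ r) $ r = 1"
proof -
  have "inverse_linear 1 a ^ r = inverse (1 + fps_const a * fps_X) ^ r * fps_X ^ r"
    by (simp add: inverse_linear_def power_mult_distrib mult.commute)
  then show ?thesis by (simp add: fps_X_power_mult_right_nth fps_power_zeroth)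
qed

text \<open>Substituting \<open>u - a\<close> and then \<open>u + a\<close> for \<open>u\<close> changes nothing; here both substitutions act on the
  inverse of \<open>u\<close>.\<close>
lemma inverse_linear_opposite_shifts: "inverse_linear 1 (- a) oo inverse_linear 1 a = fps_X"
proof -
  let ?\<phi> = "inverse_linear 1 a" and ?\<psi> = "inverse_linear 1 (- a)"
  have \<phi>: "?\<phi> * (1 + fps_const a * fps_X) = fps_X"
    using inverse_linear_mult[of 1 a] by (simp only: fps_const_1_eq_1) simp
  have "?\<psi> * (1 - fps_const a * fps_X) = fps_X"
    using inverse_linear_mult[of 1 "- a"]
    by (simp only: fps_const_1_eq_1 fps_const_neg[symmetric] mult_minus_left add_uminus_conv_diff) simp
  then have "(?\<psi> oo ?\<phi>) * (1 - fps_const a * ?\<phi>) = ?\<phi>"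
    by (metis fps_compose_mult_distrib fps_compose_sub_distrib fps_X_fps_compose_startby0 fps_const_compose fps_compose_1 inverse_linear_nth_0)
  then have "(?\<psi> oo ?\<phi>) * ((1 - fps_const a * ?\<phi>) * (1 + fps_const a * fps_X)) = fps_X"
    by (metis \<phi> mult.assoc)
  moreover have "(1 - fps_const a * ?\<phi>) * (1 + fps_const a * fps_X) = 1"
    using \<phi> by (simp add: algebra_simps)
  ultimately show ?thesis by simp
qed

lemma substitute_opposite_shifts:
  "substitute (inverse_linear 1 a) (substitute (inverse_linear 1 (- a)) f) = f"
  by (simp add: substitute_substitute inverse_linear_opposite_shifts substitute_fps_X)

section \<open>Series with given constant term\<close>

text \<open>The corner \<open>e x e\<close> of the ring, for an idempotent \<open>e\<close>: in it \<open>e\<close> is the unit.  It takes the place of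
  the algebra under consideration inside the ambient ring.\<close>
definition corner :: "'a::complex_ring \<Rightarrow> 'a set" where
  "corner e = {x. e * x = x \<and> x * e = x}"

lemma corner_unit: "x \<in> corner e \<Longrightarrow> e * x = x" "x \<in> corner e \<Longrightarrow> x * e = x"
  by (auto simp: corner_def)

lemma corner_closed:
  shows "0 \<in> corner e"
    and "x \<in> corner e \<Longrightarrow> y \<in> corner e \<Longrightarrow> x + y \<in> corner e"
    and "x \<in> corner e \<Longrightarrow> y \<in> corner e \<Longrightarrow> x - y \<in> corner e"
    and "x \<in> corner e \<Longrightarrow> - x \<in> corner e"
    and "x \<in> corner e \<Longrightarrow> y \<in> corner e \<Longrightarrow> x * y \<in> corner e"
    and "x \<in> corner e \<Longrightarrow> c *\<^sub>C x \<in> corner e"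
  by (auto simp: corner_def algebra_simps scaleC_mult_left scaleC_mult_right)
    (simp_all flip: mult.assoc)

lemma corner_sum: "(\<And>i. i \<in> I \<Longrightarrow> f i \<in> corner e) \<Longrightarrow> (\<Sum>i\<in>I. f i) \<in> corner e"
  by (induction I rule: infinite_finite_induct) (auto simp: corner_closed)

lemma corner_fps_const_mult:
  assumes "\<And>n. f $ n \<in> corner e"
  shows "fps_const e * f = f" "f * fps_const e = f"
  using assms by (simp_all add: fps_eq_iff corner_unit)

lemma corner_fps_mult:
  "(\<And>n. f $ n \<in> corner e) \<Longrightarrow> (\<And>n. h $ n \<in> corner e) \<Longrightarrow> (f * h) $ n \<in> corner e"
  by (auto simp: fps_mult_nth intro!: corner_sum corner_closed)

lemma corner_substitute:
  "(\<And>n. f $ n \<in> corner e) \<Longrightarrow> substitute \<phi> f $ n \<in> corner e"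
  by (auto simp: substitute_nth intro!: corner_sum corner_closed)

text \<open>Inverses and the series \<open>y(u)\<close> are determined coefficient by coefficient, each from all the
  preceding ones.\<close>
lemma course_of_values_recursion:
  fixes H :: "(nat \<Rightarrow> 'a) \<Rightarrow> nat \<Rightarrow> 'a"
  assumes "\<And>f f' r. (\<And>s. s < r \<Longrightarrow> f s = f' s) \<Longrightarrow> H f r = H f' r"
  obtains f where "\<And>r. f r = H f r"
proof
  fix r
  show "wfrec less_than H r = H (wfrec less_than H) r"
    by (subst wfrec, simp, rule assms) (simp add: cut_apply)
qed

lemma corner_right_inverse:
  fixes e :: "'a::complex_ring" and y :: "'a fps"
  assumes e: "e \<in> corner e" and y: "\<And>n. y $ n \<in> corner e" and y0: "y $ 0 = e"
  obtains v where "\<And>n. v $ n \<in> corner e" "v $ 0 = e" "y * v = fps_const e"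
proof -
  let ?H = "\<lambda>f r. if r = 0 then e else - (\<Sum>s\<in>{1..r}. y $ s * f (r - s))"
  obtain f where f: "\<And>r. f r = ?H f r"
  proof (rule course_of_values_recursion)
    show "?H f r = ?H f' r"
      if "\<And>s. s < r \<Longrightarrow> f s = f' s" for f f' :: "nat \<Rightarrow> 'a" and r
      using that by (auto intro!: sum.cong)
  qed blast
  have fc: "f r \<in> corner e" for r
  proof (induction r rule: less_induct)
    case (less r)
    then show ?case
      by (subst f) (auto intro!: corner_closed corner_sum e y)
  qed
  have "y * Abs_fps f = fps_const e"
  proof (rule fps_ext)
    fix r
    show "(y * Abs_fps f) $ r = fps_const e $ r"
    proof (cases "r = 0")
      case True
      then show ?thesis using e by (simp add: fps_mult_nth y0 f[of 0] corner_unit)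
    next
      case False
      have "(y * Abs_fps f) $ r = f r + (\<Sum>s\<in>{1..r}. y $ s * f (r - s))"
        by (simp add: fps_mult_nth y0 sum.atLeast_Suc_atMost corner_unit[OF fc])
      then show ?thesis using False by (simp add: f[of r])
    qed
  qed
  then show thesis
    using fc f[of 0] by (intro that[of "Abs_fps f"]) auto
qed

text \<open>A right inverse \<open>v\<close> again has constant term \<open>e\<close>, so it has a right inverse itself, which must be \<open>y\<close>.\<close>
lemma corner_inverse:
  fixes e :: "'a::complex_ring" and y :: "'a fps"
  assumes e: "e \<in> corner e" and y: "\<And>n. y $ n \<in> corner e" and y0: "y $ 0 = e"
  obtains v where "\<And>n. v $ n \<in> corner e" "y * v = fps_const e" "v * y = fps_const e"
proof -
  obtain v where v: "\<And>n. v $ n \<in> corner e" "v $ 0 = e" "y * v = fps_const e"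
    using corner_right_inverse assms by blast
  obtain w where w: "\<And>n. w $ n \<in> corner e" "v * w = fps_const e"
    using corner_right_inverse[OF e v(1,2)] by blast
  have "y = y * (v * w)"
    using corner_fps_const_mult(2)[of y e] y by (simp add: w)
  also have "\<dots> = w"
    using corner_fps_const_mult(1)[of w e] w(1) by (simp add: v(3) flip: mult.assoc)
  finally show thesis
    using that[of v] v w by simp
qed

text \<open>In the coefficient of \<open>x^r\<close> in \<open>y(x) y(\<phi>(x))\<close> the unknown \<open>y $ r\<close> occurs twice, once from either
  factor; the remaining terms only involve earlier coefficients.  As 2 is invertible, the equation
  \<open>z = y(x) y(\<phi>(x))\<close> can be solved for \<open>y\<close> recursively, in one way only, even though the
  coefficients need not commute.\<close>
lemma mult_substitute_nth:
  fixes e :: "'a::complex_ring" and y :: "'a fps"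
  assumes e: "e \<in> corner e" and y: "\<And>n. y $ n \<in> corner e" and y0: "y $ 0 = e"
    and \<phi>: "(\<phi> ^ r) $ r = 1" and r: "r \<noteq> 0"
  shows "(y * substitute \<phi> y) $ r = 2 *\<^sub>C y $ r
    + ((\<Sum>s<r. (\<phi> ^ s) $ r *\<^sub>C y $ s)
      + (\<Sum>s\<in>{0<..<r}. y $ s * (\<Sum>k\<le>r - s. (\<phi> ^ k) $ (r - s) *\<^sub>C y $ k)))"
proof -
  have "{0..r} = insert 0 (insert r {0<..<r})"
    using r by auto
  then have "(y * substitute \<phi> y) $ r = e * substitute \<phi> y $ r
      + (y $ r * e + (\<Sum>s\<in>{0<..<r}. y $ s * substitute \<phi> y $ (r - s)))"
    using r by (simp add: fps_mult_nth y0)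
  moreover have "substitute \<phi> y $ r = (\<Sum>s<r. (\<phi> ^ s) $ r *\<^sub>C y $ s) + y $ r"
    using \<phi> by (simp add: substitute_nth lessThan_Suc_atMost[symmetric])
  moreover have "e * substitute \<phi> y $ r = substitute \<phi> y $ r"
    by (rule corner_unit(1)[OF corner_substitute[OF y]])
  moreover have "(2::complex) *\<^sub>C y $ r = y $ r + y $ r"
    using scaleC_add_left[of 1 1 "y $ r"] by simp
  ultimately show ?thesis
    by (simp add: corner_unit[OF y] substitute_nth add_ac)
qed

lemma substitute_square_root:
  fixes e :: "'a::complex_ring" and z :: "'a fps"
  assumes e: "e \<in> corner e" and z: "\<And>n. z $ n \<in> corner e" and z0: "z $ 0 = e"
    and \<phi>: "\<And>r. (\<phi> ^ r) $ r = 1"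
  obtains y where "\<And>n. y $ n \<in> corner e" "y $ 0 = e" "z = y * substitute \<phi> y"
proof -
  define A where "A f r = (\<Sum>s<r. (\<phi> ^ s) $ r *\<^sub>C f s)
      + (\<Sum>s\<in>{0<..<r}. f s * (\<Sum>k\<le>r - s. (\<phi> ^ k) $ (r - s) *\<^sub>C f k))" for f :: "nat \<Rightarrow> 'a" and r
  have A_cong: "A f r = A f' r" if "\<And>s. s < r \<Longrightarrow> f s = f' s" for f f' r
    unfolding A_def using that by (intro arg_cong2[where f="(+)"] sum.cong refl arg_cong2[where f="(*)"]
        arg_cong2[where f=scaleC]) auto
  let ?H = "\<lambda>f r. if r = 0 then e else (1 / 2) *\<^sub>C (z $ r - A f r)"
  obtain f where f: "\<And>r. f r = ?H f r"
  proof (rule course_of_values_recursion)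
    show "?H f r = ?H f' r"
      if "\<And>s. s < r \<Longrightarrow> f s = f' s" for f f' :: "nat \<Rightarrow> 'a" and r
      using A_cong[OF that] by simp
  qed blast
  have fc: "f r \<in> corner e" for r
  proof (induction r rule: less_induct)
    case (less r)
    then show ?case
      by (subst f) (auto intro!: corner_closed corner_sum e z simp: A_def)
  qed
  have "z = Abs_fps f * substitute \<phi> (Abs_fps f)"
  proof (rule fps_ext)
    fix r
    show "z $ r = (Abs_fps f * substitute \<phi> (Abs_fps f)) $ r"
    proof (cases "r = 0")
      case True
      then show ?thesis using e by (simp add: fps_mult_nth f[of 0] z0 corner_unit)
    next
      case False
      have "(Abs_fps f * substitute \<phi> (Abs_fps f)) $ r = 2 *\<^sub>C f r + A f r"
        using mult_substitute_nth[of e "Abs_fps f" \<phi> r] e fc f[of 0] \<phi> False by (simp add: A_def)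
      then show ?thesis
        using False f[of r] by (simp add: scaleC_scaleC)
    qed
  qed
  then show thesis
    using fc f[of 0] by (intro that[of "Abs_fps f"]) auto
qed

lemma substitute_square_root_unique:
  fixes e :: "'a::complex_ring" and y y' :: "'a fps"
  assumes e: "e \<in> corner e" and y: "\<And>n. y $ n \<in> corner e" "y $ 0 = e"
    and y': "\<And>n. y' $ n \<in> corner e" "y' $ 0 = e"
    and \<phi>: "\<And>r. (\<phi> ^ r) $ r = 1"
    and eq: "y * substitute \<phi> y = y' * substitute \<phi> y'"
  shows "y = y'"
proof (rule fps_ext)
  fix r
  show "y $ r = y' $ r"
  proof (induction r rule: less_induct)
    case (less r)
    show ?case
    proof (cases "r = 0")
      case False
      have "(\<Sum>s<r. (\<phi> ^ s) $ r *\<^sub>C y $ s)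
          + (\<Sum>s\<in>{0<..<r}. y $ s * (\<Sum>k\<le>r - s. (\<phi> ^ k) $ (r - s) *\<^sub>C y $ k))
        = (\<Sum>s<r. (\<phi> ^ s) $ r *\<^sub>C y' $ s)
          + (\<Sum>s\<in>{0<..<r}. y' $ s * (\<Sum>k\<le>r - s. (\<phi> ^ k) $ (r - s) *\<^sub>C y' $ k))"
        using less by (intro arg_cong2[where f="(+)"] sum.cong refl arg_cong2[where f="(*)"]
            arg_cong2[where f=scaleC]) auto
      then have "2 *\<^sub>C y $ r = 2 *\<^sub>C y' $ r"
        using mult_substitute_nth[OF e y \<phi> False] mult_substitute_nth[OF e y' \<phi> False] eq by simp
      then have "(1 / 2) *\<^sub>C 2 *\<^sub>C y $ r = (1 / 2) *\<^sub>C 2 *\<^sub>C y' $ r"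
        by simp
      then show ?thesis by (simp add: scaleC_scaleC)
    qed (simp add: y y')
  qed
qed

section \<open>The RTT relation\<close>

text \<open>The relation \<open>RTT_relation\<close> evaluated at a family of series in place of the generators.\<close>
definition RTT_expr ::
  "lie_type \<Rightarrow> nat \<Rightarrow> (int \<Rightarrow> int \<Rightarrow> 'a::complex_ring fps)
    \<Rightarrow> int \<Rightarrow> int \<Rightarrow> int \<Rightarrow> int \<Rightarrow> nat \<Rightarrow> int \<Rightarrow> 'a" where
  "RTT_expr g N t i j k l m s =
     (\<Sum>a\<in>indices N. \<Sum>b\<in>indices N. \<Sum>d\<in>{..m}. \<Sum>e\<in>{e. e \<le> d \<and> 0 \<le> s + int e}.
        Polynomial.coeff (R_entry g N i a k b d) e *\<^sub>C (t a j $ (m - d) * t b l $ nat (s + int e))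
        - Polynomial.coeff (R_entry g N a j b l d) e *\<^sub>C (t k b $ nat (s + int e) * t i a $ (m - d)))"

lemma finite_indices [simp]: "finite (indices N)"
  by (simp add: indices_def)

lemma uminus_indices [simp]: "- i \<in> indices N \<longleftrightarrow> i \<in> indices N"
  by (auto simp: indices_def)

lemma sum_indices_uminus: "(\<Sum>a\<in>indices N. f (- a)) = (\<Sum>a\<in>indices N. f a)"
  by (rule sum.reindex_bij_witness[of _ uminus uminus]) auto

locale RTT_family =
  fixes g :: lie_type and N :: nat and e :: "'a::complex_ring" and t :: "int \<Rightarrow> int \<Rightarrow> 'a fps"
  assumes valid: "valid_lie_type g N"
    and unit: "e \<in> corner e"
    and entries: "i \<in> indices N \<Longrightarrow> j \<in> indices N \<Longrightarrow> t i j $ r \<in> corner e"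
    and constant_term: "i \<in> indices N \<Longrightarrow> j \<in> indices N \<Longrightarrow> t i j $ 0 = (if i = j then e else 0)"
    and RTT: "i \<in> indices N \<Longrightarrow> j \<in> indices N \<Longrightarrow> k \<in> indices N \<Longrightarrow> l \<in> indices N
      \<Longrightarrow> RTT_expr g N t i j k l m s = 0"

lemma R_entry_coeff_0:
  "Polynomial.coeff (R_entry g N i j k l 0) n = (if n = 0 \<and> i = j \<and> k = l then 1 else 0)"
  by (simp add: R_entry_def resolvent_coeff_def)

lemma R_entry_coeff_Suc:
  assumes "n \<le> Suc d"
  shows "Polynomial.coeff (R_entry g N i j k l (Suc d)) n
    = Q_entry g i j k l * (of_nat (d choose n) * kappa g N ^ (d - n))
      - P_entry i j k l * (if n = d then 1 else 0)"
proof -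
  have 1: "Polynomial.coeff ([:0, 1:] ^ d) n = (if n = d then 1 else (0::complex))"
    by (metis monom_altdef coeff_monom smult_1_left)
  have 2: "Polynomial.coeff ([:kappa g N, 1:] ^ d) n = of_nat (d choose n) * kappa g N ^ (d - n)"
  proof (cases "n \<le> d")
    case False
    then show ?thesis
      using assms by (simp add: coeff_eq_0 degree_linear_power)
  qed (simp add: coeff_linear_poly_power)
  show ?thesis
    by (simp add: R_entry_def resolvent_coeff_def 1 2)
qed

text \<open>The series \<open>f(u - c) u / (u - c)\<close>.  In this form the shifted argument occurs in the RTT relation.\<close>
definition pascal_shift :: "complex \<Rightarrow> 'a::complex_ring fps \<Rightarrow> 'a fps" where
  "pascal_shift c f = Abs_fps (\<lambda>k. \<Sum>n\<le>k. (of_nat (k choose n) * c ^ (k - n)) *\<^sub>C f $ n)"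

text \<open>Multiplication by the inverse of \<open>u\<close>, which is not an element of a series ring without unit.\<close>
definition monomial_shift :: "'a::complex_ring fps \<Rightarrow> 'a fps" where
  "monomial_shift f = Abs_fps (\<lambda>n. if n = 0 then 0 else f $ (n - 1))"

lemma monomial_shift_mult:
  "monomial_shift (f * h) = f * monomial_shift h" "monomial_shift (f * h) = monomial_shift f * h"
proof -
  show "monomial_shift (f * h) = f * monomial_shift h"
  proof (rule fps_ext)
    fix n
    show "monomial_shift (f * h) $ n = (f * monomial_shift h) $ n"
      by (cases n) (auto simp: monomial_shift_def fps_mult_nth Suc_diff_le intro!: sum.cong)
  qed
  show "monomial_shift (f * h) = monomial_shift f * h"
  proof (rule fps_ext)
    fix n
    show "monomial_shift (f * h) $ n = (monomial_shift f * h) $ n"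
      by (cases n; simp only: fps_mult_nth sum.atLeast0_atMost_Suc_shift)
        (simp_all add: monomial_shift_def fps_mult_nth)
  qed
qed

text \<open>Pascal's rule for the binomial coefficients in \<open>pascal_shift\<close> says that multiplication by \<open>1 - c / u\<close>
  takes the expansion of \<open>u / (u - c)^(n + 1)\<close> to that of \<open>1 / (u - c)^n\<close>.\<close>
lemma pascal_shift_eq_substitute:
  "pascal_shift c f - c *\<^sub>C monomial_shift (pascal_shift c f) = substitute (inverse_linear 1 (- c)) f"
proof -
  define B where "B n = Abs_fps (\<lambda>k. of_nat (k choose n) * c ^ (k - n))" for n
  have B0: "(1 - fps_const c * fps_X) * B 0 = 1"
  proof (rule fps_ext)
    fix k show "((1 - fps_const c * fps_X) * B 0) $ k = 1 $ k"
      by (cases k) (auto simp: B_def algebra_simps)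
  qed
  have BS: "(1 - fps_const c * fps_X) * B (Suc n) = fps_X * B n" for n
  proof (rule fps_ext)
    fix k show "((1 - fps_const c * fps_X) * B (Suc n)) $ k = (fps_X * B n) $ k"
    proof (cases k)
      case (Suc k')
      have "c * (of_nat (k' choose Suc n) * c ^ (k' - Suc n)) = of_nat (k' choose Suc n) * c ^ (k' - n)"
      proof (cases "Suc n \<le> k'")
        case True
        then have "k' - n = Suc (k' - Suc n)" by simp
        then show ?thesis by (simp add: mult_ac)
      qed (simp add: binomial_eq_0)
      then show ?thesis
        by (auto simp: Suc B_def algebra_simps)
    qed (auto simp: B_def algebra_simps)
  qed
  have inv: "inverse_linear 1 (- c) * (1 - fps_const c * fps_X) = fps_X"
    using inverse_linear_mult[of 1 "- c"] by (simp add: fps_const_neg[symmetric] del: fps_const_neg)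
  have pow: "(1 - fps_const c * fps_X) * B n = inverse_linear 1 (- c) ^ n" for n
  proof (induction n)
    case (Suc n)
    have "(1 - fps_const c * fps_X) * B (Suc n) = inverse_linear 1 (- c) * ((1 - fps_const c * fps_X) * B n)"
      unfolding BS by (metis inv mult.assoc)
    then show ?case using Suc by simp
  qed (simp add: B0)
  have B_nth: "(inverse_linear 1 (- c) ^ n) $ k = B n $ k - (if k = 0 then 0 else c * B n $ (k - 1))" for n k
    unfolding pow[symmetric] by (simp add: algebra_simps)
  show ?thesis
  proof (rule fps_ext)
    fix k
    have pk: "pascal_shift c f $ k' = (\<Sum>n\<le>k. B n $ k' *\<^sub>C f $ n)" if "k' \<le> k" for k'
      unfolding pascal_shift_def fps_nth_Abs_fps B_def
      by (rule sum.mono_neutral_left) (use that in \<open>auto simp: binomial_eq_0\<close>)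
    show "(pascal_shift c f - c *\<^sub>C monomial_shift (pascal_shift c f)) $ k
        = substitute (inverse_linear 1 (- c)) f $ k"
      by (simp add: substitute_nth B_nth monomial_shift_def pk scaleC_diff_left sum_subtractf
          scaleC_sum_right scaleC_scaleC)
  qed
qed


definition transpose_family :: "lie_type \<Rightarrow> (int \<Rightarrow> int \<Rightarrow> 'a::complex_ring fps) \<Rightarrow> int \<Rightarrow> int \<Rightarrow> 'a fps" where
  "transpose_family g t i j = theta g (- j) (- i) *\<^sub>C t (- j) (- i)"

abbreviation shift_series :: "complex \<Rightarrow> 'a::complex_ring fps \<Rightarrow> 'a fps" where
  "shift_series c \<equiv> substitute (inverse_linear 1 c)"

lemma sum_P_entry:
  assumes "i \<in> indices N" "k \<in> indices N"
  shows "(\<Sum>a\<in>indices N. \<Sum>b\<in>indices N. P_entry i a k b *\<^sub>C F a b) = F k i"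
proof -
  have "(\<Sum>a\<in>indices N. \<Sum>b\<in>indices N. P_entry i a k b *\<^sub>C F a b)
      = (\<Sum>a\<in>indices N. \<Sum>b\<in>indices N. if b = i then (if a = k then F a b else 0) else 0)"
    by (intro sum.cong refl) (auto simp: P_entry_def)
  then show ?thesis using assms by simp
qed

lemma sum_P_entry':
  assumes "j \<in> indices N" "l \<in> indices N"
  shows "(\<Sum>a\<in>indices N. \<Sum>b\<in>indices N. P_entry a j b l *\<^sub>C F a b) = F l j"
proof -
  have "(\<Sum>a\<in>indices N. \<Sum>b\<in>indices N. P_entry a j b l *\<^sub>C F a b)
      = (\<Sum>a\<in>indices N. \<Sum>b\<in>indices N. if b = j then (if a = l then F a b else 0) else 0)"
    by (intro sum.cong refl) (auto simp: P_entry_def)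
  then show ?thesis using assms by simp
qed

lemma sum_Q_entry:
  shows "(\<Sum>a\<in>indices N. \<Sum>b\<in>indices N. Q_entry g i a k b *\<^sub>C F a b)
    = (if k = - i then \<Sum>a\<in>indices N. theta g i a *\<^sub>C F a (- a) else 0)"
proof -
  have "(\<Sum>a\<in>indices N. \<Sum>b\<in>indices N. Q_entry g i a k b *\<^sub>C F a b)
      = (\<Sum>a\<in>indices N. \<Sum>b\<in>indices N. if b = - a then (if k = - i then theta g i a *\<^sub>C F a b else 0) else 0)"
    by (intro sum.cong refl) (auto simp: Q_entry_def)
  then show ?thesis by simp
qed

lemma sum_Q_entry':
  shows "(\<Sum>a\<in>indices N. \<Sum>b\<in>indices N. Q_entry g a j b l *\<^sub>C F a b)
    = (if l = - j then \<Sum>a\<in>indices N. theta g a j *\<^sub>C F a (- a) else 0)"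
proof -
  have "(\<Sum>a\<in>indices N. \<Sum>b\<in>indices N. Q_entry g a j b l *\<^sub>C F a b)
      = (\<Sum>a\<in>indices N. \<Sum>b\<in>indices N. if b = - a then (if l = - j then theta g a j *\<^sub>C F a b else 0) else 0)"
    by (intro sum.cong refl) (auto simp: Q_entry_def)
  then show ?thesis by simp
qed

lemma fps_mult_nth_rev: "(f * h) $ r = (\<Sum>k\<le>r. f $ (r - k) * h $ k)"
  for f h :: "'a::ring fps"
  unfolding fps_mult_nth
  by (rule sum.reindex_bij_witness[of _ "\<lambda>k. r - k" "\<lambda>k. r - k"]) auto

context RTT_family
begin

abbreviation "\<K> \<equiv> shift_series (kappa g N)"

text \<open>This is the coefficient of \<open>u^(-r-1) v^0\<close> in the RTT relation.  The identity term contributes a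
  commutator with \<open>t k l $ 0\<close>, which is 0 or the unit \<open>e\<close>.  The two terms with \<open>P\<close> are equal after
  reversing the order of summation, because \<open>P T1(v) T2(v)\<close> and \<open>T2(v) T1(v) P\<close> agree.  What is left
  is the term with \<open>Q\<close>, where \<open>1 / (u - v - \<kappa>)\<close> is expanded in powers of \<open>v + \<kappa>\<close>.\<close>
lemma Q_relation_pascal:
  assumes ijkl: "i \<in> indices N" "j \<in> indices N" "k \<in> indices N" "l \<in> indices N"
  shows "(if k = - i then \<Sum>a\<in>indices N. theta g i a *\<^sub>C (t a j * pascal_shift (kappa g N) (t (- a) l)) else 0)
    = (if l = - j then \<Sum>a\<in>indices N. theta g a j *\<^sub>C (pascal_shift (kappa g N) (t k (- a)) * t i a) else 0)"
    (is "?L = ?R")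
proof (rule fps_ext)
  fix r
  let ?J = "indices N" and ?W = "pascal_shift (kappa g N)"
  have inner: "(\<Sum>n\<le>Suc d. Polynomial.coeff (R_entry g N i a k b (Suc d)) n *\<^sub>C F n)
      = Q_entry g i a k b *\<^sub>C (\<Sum>n\<le>d. (of_nat (d choose n) * kappa g N ^ (d - n)) *\<^sub>C F n)
        - P_entry i a k b *\<^sub>C F d" for i a k b d and F :: "nat \<Rightarrow> 'a"
  proof -
    have "(\<Sum>n\<le>Suc d. Polynomial.coeff (R_entry g N i a k b (Suc d)) n *\<^sub>C F n)
        = (\<Sum>n\<le>Suc d. (Q_entry g i a k b * (of_nat (d choose n) * kappa g N ^ (d - n))) *\<^sub>C F n)
          - (\<Sum>n\<le>Suc d. (P_entry i a k b * (if n = d then 1 else 0)) *\<^sub>C F n)"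
      by (simp add: R_entry_coeff_Suc scaleC_diff_left sum_subtractf del: sum.atMost_Suc)
    also have "(\<Sum>n\<le>Suc d. (P_entry i a k b * (if n = d then 1 else 0)) *\<^sub>C F n)
        = (\<Sum>n\<le>Suc d. if n = d then P_entry i a k b *\<^sub>C F n else 0)"
      by (intro sum.cong) auto
    also have "\<dots> = P_entry i a k b *\<^sub>C F d"
      by (simp del: sum.atMost_Suc)
    finally show ?thesis
      by (simp add: scaleC_sum_right scaleC_scaleC binomial_eq_0)
  qed
  have block: "(\<Sum>d\<le>Suc r. \<Sum>n\<le>d. Polynomial.coeff (R_entry g N i a k b d) n *\<^sub>C F d n)
      = (if i = a \<and> k = b then F 0 0 else 0)
        + (\<Sum>d\<le>r. Q_entry g i a k b *\<^sub>C (\<Sum>n\<le>d. (of_nat (d choose n) * kappa g N ^ (d - n)) *\<^sub>C F (Suc d) n)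
            - P_entry i a k b *\<^sub>C F (Suc d) d)" for i a k b and F :: "nat \<Rightarrow> nat \<Rightarrow> 'a"
    by (subst sum.atMost_Suc_shift) (simp add: R_entry_coeff_0 inner del: sum.atMost_Suc)
  have left: "(\<Sum>d\<le>Suc r. \<Sum>n\<le>d. Polynomial.coeff (R_entry g N i a k b d) n *\<^sub>C (t a j $ (Suc r - d) * t b l $ n))
      = (if i = a \<and> k = b then t a j $ Suc r * t b l $ 0 else 0)
        + (Q_entry g i a k b *\<^sub>C (t a j * ?W (t b l)) $ r - P_entry i a k b *\<^sub>C (t a j * t b l) $ r)" for a b
    by (subst block) (simp add: sum_subtractf scaleC_sum_right scaleC_scaleC fps_mult_nth_rev
        pascal_shift_def sum_distrib_left scaleC_mult_right)
  have right: "(\<Sum>d\<le>Suc r. \<Sum>n\<le>d. Polynomial.coeff (R_entry g N a j b l d) n *\<^sub>C (t k b $ n * t i a $ (Suc r - d)))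
      = (if a = j \<and> b = l then t k b $ 0 * t i a $ Suc r else 0)
        + (Q_entry g a j b l *\<^sub>C (?W (t k b) * t i a) $ r - P_entry a j b l *\<^sub>C (t k b * t i a) $ r)" for a b
    by (subst block) (simp add: sum_subtractf scaleC_sum_right scaleC_scaleC fps_mult_nth atLeast0AtMost
        pascal_shift_def sum_distrib_right scaleC_mult_left)
  have delta: "(\<Sum>a\<in>?J. \<Sum>b\<in>?J. if i = a \<and> k = b then F a b else 0) = F i k"
     "(\<Sum>a\<in>?J. \<Sum>b\<in>?J. if a = j \<and> b = l then F a b else 0) = F j l" for F :: "int \<Rightarrow> int \<Rightarrow> 'a"
  proof -
    have "(\<Sum>a\<in>?J. \<Sum>b\<in>?J. if i = a \<and> k = b then F a b else 0) = (\<Sum>a\<in>?J. \<Sum>b\<in>?J. if b = k then (if a = i then F a b else 0) else 0)"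
      by (intro sum.cong refl) auto
    then show "(\<Sum>a\<in>?J. \<Sum>b\<in>?J. if i = a \<and> k = b then F a b else 0) = F i k"
      using ijkl by simp
    have "(\<Sum>a\<in>?J. \<Sum>b\<in>?J. if a = j \<and> b = l then F a b else 0) = (\<Sum>a\<in>?J. \<Sum>b\<in>?J. if b = l then (if a = j then F a b else 0) else 0)"
      by (intro sum.cong refl) auto
    then show "(\<Sum>a\<in>?J. \<Sum>b\<in>?J. if a = j \<and> b = l then F a b else 0) = F j l"
      using ijkl by simp
  qed
  have "0 = RTT_expr g N t i j k l (Suc r) 0"
    using RTT ijkl by simp
  also have "\<dots> = (\<Sum>a\<in>?J. \<Sum>b\<in>?J.
      (\<Sum>d\<le>Suc r. \<Sum>n\<le>d. Polynomial.coeff (R_entry g N i a k b d) n *\<^sub>C (t a j $ (Suc r - d) * t b l $ n))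
      - (\<Sum>d\<le>Suc r. \<Sum>n\<le>d. Polynomial.coeff (R_entry g N a j b l d) n *\<^sub>C (t k b $ n * t i a $ (Suc r - d))))"
    unfolding RTT_expr_def by (simp add: sum_subtractf atMost_def del: sum.atMost_Suc)
  also have "\<dots> = (t i j $ Suc r * t k l $ 0 - t k l $ 0 * t i j $ Suc r)
      + (?L $ r - ?R $ r) - ((t k j * t i l) $ r - (t k j * t i l) $ r)"
    unfolding left right
    by (simp add: sum_subtractf sum.distrib delta sum_P_entry[of i N k] sum_P_entry'[of j N l]
        sum_Q_entry sum_Q_entry' ijkl fps_sum_nth)
  also have "t i j $ Suc r * t k l $ 0 = t k l $ 0 * t i j $ Suc r"
    using ijkl by (simp add: constant_term corner_unit[OF entries])
  finally show "?L $ r = ?R $ r"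
    by simp
qed

text \<open>The identity \<open>Q T1(u + \<kappa>) T2(u) = T2(u) T1(u + \<kappa>) Q\<close> in matrix entries.  For \<open>\<kappa> \<noteq> 0\<close> it is the residue
  of the RTT relation at the pole \<open>\<kappa>\<close> of \<open>R\<close>.  Obtaining it from a single coefficient in \<open>v\<close> covers the
  case \<open>\<kappa> = 0\<close> as well, in which the two poles of \<open>R\<close> coincide.\<close>
lemma Q_relation:
  assumes ijkl: "i \<in> indices N" "j \<in> indices N" "k \<in> indices N" "l \<in> indices N"
  shows "(if k = - i then \<Sum>a\<in>indices N. theta g i a *\<^sub>C (\<K> (t a j) * t (- a) l) else 0)
    = (if l = - j then \<Sum>a\<in>indices N. theta g a j *\<^sub>C (t k (- a) * \<K> (t i a)) else 0)"
proof -
  let ?J = "indices N" and ?W = "pascal_shift (kappa g N)" and ?S = "shift_series (- kappa g N)"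
  interpret S: complex_ring_hom "\<K> :: 'a fps \<Rightarrow> 'a fps"
    by (rule substitute_hom) simp
  \<comment> \<open>multiplication by \<open>1 - \<kappa> / u\<close>, which turns \<open>pascal_shift\<close> into a substitution\<close>
  define E where "E f = f - kappa g N *\<^sub>C monomial_shift f" for f :: "'a fps"
  have E_mult: "E (f * h) = f * E h" "E (f * h) = E f * h" for f h
    unfolding E_def by (simp_all add: monomial_shift_mult(1) algebra_simps scaleC_mult_right)
      (simp add: monomial_shift_mult(2) scaleC_mult_left flip: monomial_shift_mult(1))
  have E_hom: "E 0 = 0" "E (f + h) = E f + E h" "E (c *\<^sub>C f) = c *\<^sub>C E f" for f h c
    by (auto simp: E_def fps_eq_iff monomial_shift_def scaleC_add_right scaleC_diff_right scaleC_scaleC mult.commute)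
  have E_sum: "E (\<Sum>a\<in>A. F a) = (\<Sum>a\<in>A. E (F a))" for F and A :: "int set"
    by (induction A rule: infinite_finite_induct) (auto simp: E_hom)
  have EW: "E (?W f) = ?S f" for f
    unfolding E_def by (rule pascal_shift_eq_substitute)
  have "(if k = - i then \<Sum>a\<in>?J. theta g i a *\<^sub>C (t a j * ?S (t (- a) l)) else 0)
    = (if l = - j then \<Sum>a\<in>?J. theta g a j *\<^sub>C (?S (t k (- a)) * t i a) else 0)"
    using arg_cong[OF Q_relation_pascal[OF ijkl], of E]
    by (simp add: if_distrib[of E] E_sum E_hom E_mult(1)[of "t _ _" "?W _", unfolded EW] E_mult(2)[of "?W _", unfolded EW] cong: if_cong)
  \<comment> \<open>replace \<open>u\<close> by \<open>u + \<kappa>\<close>, so that the other factor is the shifted one\<close>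
  from arg_cong[OF this, of "\<K>"] show ?thesis
    by (simp add: if_distrib[of "shift_series _"] S.sum S.scaleC S.mult substitute_opposite_shifts cong: if_cong)
qed

lemma theta_mult:
  assumes "a \<in> indices N"
  shows "theta g i a * theta g a j = theta g i j" "theta g a a = 1"
proof -
  have "a \<noteq> 0" if "g = Symplectic"
    using valid that assms by (auto simp: valid_lie_type_def indices_def)
  then have "sgn a * sgn a = 1" if "g = Symplectic"
    using that by (simp add: sgn_mult_self_eq)
  then show "theta g i a * theta g a j = theta g i j" "theta g a a = 1"
    by (auto simp: theta_def split: lie_type.split simp flip: of_int_mult)
qed

text \<open>The entries of \<open>Q_relation\<close> are, up to sign, entries of \<open>T^t(u + \<kappa>) T(u)\<close> on the left and of
  \<open>T(u) T^t(u + \<kappa>)\<close> on the right.  Each side is multiplied by a Kronecker delta in different indices.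
  Hence both products vanish off the diagonal, and every diagonal entry of the first equals every
  diagonal entry of the second.\<close>
theorem transpose_times_family:
  obtains z where
    "\<And>i j. i \<in> indices N \<Longrightarrow> j \<in> indices N \<Longrightarrow>
      (\<Sum>k\<in>indices N. \<K> (transpose_family g t i k) * t k j) = (if i = j then z else 0)"
    "\<And>i j. i \<in> indices N \<Longrightarrow> j \<in> indices N \<Longrightarrow>
      (\<Sum>k\<in>indices N. t i k * \<K> (transpose_family g t k j)) = (if i = j then z else 0)"
proof -
  let ?J = "indices N" and ?S = "\<K>"
  have left: "(\<Sum>k\<in>?J. ?S (transpose_family g t i k) * t k j)
      = (\<Sum>a\<in>?J. theta g a (- i) *\<^sub>C (?S (t a (- i)) * t (- a) j))" for i j
    by (subst sum_indices_uminus[symmetric]) (simp add: transpose_family_def substitute_scaleC scaleC_mult_left)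
  have right: "(\<Sum>k\<in>?J. t i k * ?S (transpose_family g t k j))
      = (\<Sum>a\<in>?J. theta g (- j) a *\<^sub>C (t i (- a) * ?S (t (- j) a)))" for i j
    by (subst sum_indices_uminus[symmetric]) (simp add: transpose_family_def substitute_scaleC scaleC_mult_right)
  have L: "(\<Sum>k\<in>?J. ?S (transpose_family g t p k) * t k l)
      = (if l = p then \<Sum>k\<in>?J. t q k * ?S (transpose_family g t k q) else 0)"
    if pl: "p \<in> ?J" "l \<in> ?J" "q \<in> ?J" for p l q
  proof -
    have 1: "theta g (- q) (- p) * theta g (- q) a = theta g a (- p)"
      "theta g (- q) (- p) * theta g a (- p) = theta g (- q) a" if "a \<in> ?J" for a
      using theta_mult(1)[of "- q" a "- p"] theta_mult(1)[of "- p" "- q" a] that pl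
      by (auto simp: theta_def mult_ac split: lie_type.splits)
    have "(\<Sum>k\<in>?J. ?S (transpose_family g t p k) * t k l)
      = theta g (- q) (- p) *\<^sub>C (\<Sum>a\<in>?J. theta g (- q) a *\<^sub>C (?S (t a (- p)) * t (- a) l))"
      unfolding left scaleC_sum_right scaleC_scaleC by (intro sum.cong refl) (simp add: 1)
    also have "\<dots> = theta g (- q) (- p) *\<^sub>C (if l = p then \<Sum>a\<in>?J. theta g a (- p) *\<^sub>C (t q (- a) * ?S (t (- q) a)) else 0)"
      using Q_relation[of "- q" "- p" q l] pl by simp
    also have "\<dots> = (if l = p then \<Sum>k\<in>?J. t q k * ?S (transpose_family g t k q) else 0)"
      unfolding right by (auto simp: scaleC_sum_right scaleC_scaleC 1 intro!: sum.cong)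
    finally show ?thesis .
  qed
  have R: "(\<Sum>k\<in>?J. t i k * ?S (transpose_family g t k j)) = 0" if ij: "i \<in> ?J" "j \<in> ?J" "i \<noteq> j" for i j
  proof -
    have 1: "theta g (- j) i * theta g a i = theta g (- j) a" if "a \<in> ?J" for a
      using theta_mult(1)[of i "- j" a] that ij by (auto simp: theta_def mult_ac split: lie_type.splits)
    have "(\<Sum>a\<in>?J. theta g a i *\<^sub>C (t i (- a) * ?S (t (- j) a))) = 0"
      using Q_relation[of "- j" i i "- i"] ij by auto
    then have "theta g (- j) i *\<^sub>C (\<Sum>a\<in>?J. theta g a i *\<^sub>C (t i (- a) * ?S (t (- j) a))) = 0"
      by simp
    then show ?thesis
      unfolding right scaleC_sum_right scaleC_scaleC by (simp add: 1 cong: sum.cong)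
  qed
  have 1: "1 \<in> ?J"
    using valid by (auto simp: valid_lie_type_def indices_def)
  show thesis
  proof (rule that[of "\<Sum>k\<in>?J. t 1 k * ?S (transpose_family g t k 1)"])
    fix i j assume ij: "i \<in> ?J" "j \<in> ?J"
    show "(\<Sum>k\<in>?J. ?S (transpose_family g t i k) * t k j)
        = (if i = j then \<Sum>k\<in>?J. t 1 k * ?S (transpose_family g t k 1) else 0)"
      using L[of i j 1] ij 1 by auto
    show "(\<Sum>k\<in>?J. t i k * ?S (transpose_family g t k j))
        = (if i = j then \<Sum>k\<in>?J. t 1 k * ?S (transpose_family g t k 1) else 0)"
      using L[of 1 1 i] L[of 1 1 1] R[of i j] ij 1 by auto
  qed
qed

end

section \<open>Products of commuting RTT families\<close>

text \<open>The expansion of \<open>R(u - v)\<close> involves positive powers of \<open>v\<close>, but the coefficient of \<open>u^(-d)\<close> has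
  degree at most \<open>d\<close> in \<open>v\<close>.  In the variables \<open>w = v / u\<close> and \<open>y = 1 / v\<close> it is therefore a power
  series, and the RTT relation becomes an identity of matrices over power series in \<open>w\<close> whose
  coefficients are power series in \<open>y\<close>.  A series in \<open>1 / u = w y\<close> is homogenised by \<open>homogenize\<close>, a
  series in \<open>1 / v\<close> is constant in \<open>w\<close>.\<close>

definition homogenize :: "'a::complex_ring fps \<Rightarrow> 'a fps fps" where
  "homogenize f = Abs_fps (\<lambda>m. Abs_fps (\<lambda>n. if n = m then f $ m else 0))"

text \<open>As matrices over pairs of indices, \<open>(i, k)\<close> and \<open>(j, l)\<close> being the row and the column of
  the tensor product of the matrix units \<open>E i j\<close> and \<open>E k l\<close>.\<close>
definition R_series :: "lie_type \<Rightarrow> nat \<Rightarrow> 'a::complex_ring \<Rightarrow> int \<times> int \<Rightarrow> int \<times> int \<Rightarrow> 'a fps fps" where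
  "R_series g N e = (\<lambda>(i, k) (j, l). Abs_fps (\<lambda>d. Abs_fps (\<lambda>n.
     if n \<le> d then Polynomial.coeff (R_entry g N i j k l d) (d - n) *\<^sub>C e else 0)))"

lemma homogenize_add: "homogenize (f + h) = homogenize f + homogenize h"
  by (auto simp: fps_eq_iff homogenize_def)

lemma homogenize_sum: "homogenize (\<Sum>i\<in>I. F i) = (\<Sum>i\<in>I. homogenize (F i))"
proof -
  have "homogenize 0 = (0 :: 'a::complex_ring fps fps)"
    by (auto simp: fps_eq_iff homogenize_def)
  then show ?thesis
    by (induction I rule: infinite_finite_induct) (auto simp: homogenize_add)
qed

lemma homogenize_nth_mult_nth:
  "(homogenize f $ k * h) $ n = (if n < k then 0 else f $ k * h $ (n - k))"
  by (simp add: homogenize_def fps_mult_nth mult_delta_left)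

lemma mult_homogenize_nth_nth:
  "(h * homogenize f $ k) $ n = (if n < k then 0 else h $ (n - k) * f $ k)"
  by (simp add: homogenize_def fps_mult_nth_rev mult_delta_right)

lemma fps_const_sum: "fps_const (\<Sum>i\<in>I. F i) = (\<Sum>i\<in>I. fps_const (F i))"
  by (auto simp: fps_eq_iff fps_sum_nth)

lemma homogenize_mult: "homogenize (f * h) = homogenize f * homogenize h"
proof (intro fps_ext)
  fix m n
  have "(homogenize f * homogenize h) $ m $ n
      = (\<Sum>i = 0..m. (homogenize f $ i * homogenize h $ (m - i)) $ n)"
    by (simp add: fps_mult_nth[of "homogenize f" "homogenize h" m] fps_sum_nth)
  also have "\<dots> = (\<Sum>i = 0..m. if n = m then f $ i * h $ (m - i) else 0)"
    unfolding homogenize_nth_mult_nth by (intro sum.cong refl) (auto simp: homogenize_def)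
  also have "\<dots> = homogenize (f * h) $ m $ n"
    by (simp add: homogenize_def fps_mult_nth)
  finally show "homogenize (f * h) $ m $ n = (homogenize f * homogenize h) $ m $ n" ..
qed

lemma R_series_mult_nth:
  assumes F: "\<And>k n. F $ k $ n = (if n < k then 0 else H k (n - k))" and H: "\<And>k n. e * H k n = H k n"
  shows "(R_series g N e (i, k) (j, l) * F) $ m $ n
    = (\<Sum>d\<le>m. \<Sum>p\<in>{p. p \<le> d \<and> 0 \<le> int n - int m + int p}.
        Polynomial.coeff (R_entry g N i j k l d) p *\<^sub>C H (m - d) (nat (int n - int m + int p)))"
proof -
  let ?c = "\<lambda>d. Polynomial.coeff (R_entry g N i j k l d)"
  let ?lhs = "\<lambda>d. \<Sum>q\<le>n. R_series g N e (i, k) (j, l) $ d $ q * F $ (m - d) $ (n - q)"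
  let ?rhs = "\<lambda>d. \<Sum>p\<in>{p. p \<le> d \<and> 0 \<le> int n - int m + int p}.
        ?c d p *\<^sub>C H (m - d) (nat (int n - int m + int p))"
  have "(R_series g N e (i, k) (j, l) * F) $ m $ n = (\<Sum>d\<le>m. ?lhs d)"
    by (simp add: fps_mult_nth fps_sum_nth atLeast0AtMost)
  also have "\<dots> = (\<Sum>d\<le>m. ?rhs d)"
  proof (rule sum.cong[OF refl])
    fix d assume d: "d \<in> {..m}"
    have "?lhs d
        = (\<Sum>q\<in>{q. q \<le> n \<and> q \<le> d \<and> m - d \<le> n - q}. ?c d (d - q) *\<^sub>C H (m - d) (n - q - (m - d)))"
      by (rule sum.mono_neutral_cong_right)
        (auto simp: R_series_def F scaleC_mult_left H)
    also have "\<dots> = ?rhs d"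
      by (rule sum.reindex_bij_witness[of _ "\<lambda>p. d - p" "\<lambda>q. d - q"])
        (use d in \<open>auto simp: nat_diff_distrib' intro!: arg_cong2[where f=scaleC] arg_cong2[where f=H]\<close>)
    finally show "?lhs d = ?rhs d" .
  qed
  finally show ?thesis .
qed

definition T1_T2 :: "(int \<Rightarrow> int \<Rightarrow> 'a::complex_ring fps) \<Rightarrow> int \<times> int \<Rightarrow> int \<times> int \<Rightarrow> 'a fps fps" where
  "T1_T2 t = (\<lambda>(i, k) (j, l). homogenize (t i j) * fps_const (t k l))"

definition T2_T1 :: "(int \<Rightarrow> int \<Rightarrow> 'a::complex_ring fps) \<Rightarrow> int \<times> int \<Rightarrow> int \<times> int \<Rightarrow> 'a fps fps" where
  "T2_T1 t = (\<lambda>(i, k) (j, l). fps_const (t k l) * homogenize (t i j))"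

lemma RTT_expr_eq_nth:
  assumes t: "\<And>i j r. i \<in> indices N \<Longrightarrow> j \<in> indices N \<Longrightarrow> t i j $ r \<in> corner e"
    and ijkl: "i \<in> indices N" "j \<in> indices N" "k \<in> indices N" "l \<in> indices N"
  shows "RTT_expr g N t i j k l m (int n - int m)
    = ((\<Sum>q\<in>indices N \<times> indices N. R_series g N e (i, k) q * T1_T2 t q (j, l))
      - (\<Sum>q\<in>indices N \<times> indices N. R_series g N e q (j, l) * T2_T1 t (i, k) q)) $ m $ n"
proof -
  have 1: "(R_series g N e (i, k) (a, b) * T1_T2 t (a, b) (j, l)) $ m $ n
    = (\<Sum>d\<le>m. \<Sum>p\<in>{p. p \<le> d \<and> 0 \<le> int n - int m + int p}.
        Polynomial.coeff (R_entry g N i a k b d) p *\<^sub>C (t a j $ (m - d) * t b l $ (nat (int n - int m + int p))))"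
    if "a \<in> indices N" "b \<in> indices N" for a b
    by (rule R_series_mult_nth)
      (use t that ijkl in \<open>auto simp: T1_T2_def homogenize_nth_mult_nth corner_unit simp flip: mult.assoc\<close>)
  have 2: "(R_series g N e (a, b) (j, l) * T2_T1 t (i, k) (a, b)) $ m $ n
    = (\<Sum>d\<le>m. \<Sum>p\<in>{p. p \<le> d \<and> 0 \<le> int n - int m + int p}.
        Polynomial.coeff (R_entry g N a j b l d) p *\<^sub>C (t k b $ (nat (int n - int m + int p)) * t i a $ (m - d)))"
    if "a \<in> indices N" "b \<in> indices N" for a b
    by (rule R_series_mult_nth)
      (use t that ijkl in \<open>auto simp: T2_T1_def mult_homogenize_nth_nth corner_unit simp flip: mult.assoc\<close>)
  show ?thesis
    by (simp add: RTT_expr_def fps_sum_nth sum_subtractf 1 2 flip: sum.cartesian_product cong: sum.cong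
      add: sum.cartesian_product')
qed

text \<open>The coefficient of \<open>w^m y^n\<close> is that of \<open>u^(-m) v^(m - n)\<close>.  The exponents of \<open>v\<close> greater than \<open>m\<close>, which
  are not of this form, do not occur in the RTT relation.\<close>
lemma RTT_expr_eq_0_iff:
  assumes t: "\<And>i j r. i \<in> indices N \<Longrightarrow> j \<in> indices N \<Longrightarrow> t i j $ r \<in> corner e"
    and ijkl: "i \<in> indices N" "j \<in> indices N" "k \<in> indices N" "l \<in> indices N"
  shows "(\<forall>m s. RTT_expr g N t i j k l m s = 0) \<longleftrightarrow>
    (\<Sum>q\<in>indices N \<times> indices N. R_series g N e (i, k) q * T1_T2 t q (j, l))
      = (\<Sum>q\<in>indices N \<times> indices N. R_series g N e q (j, l) * T2_T1 t (i, k) q)" (is "?A \<longleftrightarrow> ?L = ?R")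
proof
  assume A: ?A
  have "(?L - ?R) $ m $ n = 0" for m n
    using A RTT_expr_eq_nth[where t=t and g=g, OF t ijkl, where m=m and n=n] by simp
  then show "?L = ?R"
    by (auto simp: fps_eq_iff)
next
  assume eq: "?L = ?R"
  show ?A
  proof (intro allI)
    fix m :: nat and s :: int
    show "RTT_expr g N t i j k l m s = 0"
    proof (cases "s + int m \<ge> 0")
      case True
      then show ?thesis
        using RTT_expr_eq_nth[where t=t and g=g, OF t ijkl, where m=m and n="nat (s + int m)"] eq by simp
    next
      case False
      then show ?thesis
        unfolding RTT_expr_def by (intro sum.neutral ballI) auto
    qed
  qed
qed

text \<open>If \<open>R A = B R\<close> and \<open>R A' = B' R\<close> then \<open>R A A' = B R A' = B B' R\<close>.  The intertwining relations are
  stated with the entries of \<open>R\<close> in front, as they commute with those of \<open>B\<close>.\<close>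
lemma intertwining_product:
  fixes R A A' B B' :: "'i \<Rightarrow> 'i \<Rightarrow> 'a::ring"
  assumes "\<And>p s. p \<in> M \<Longrightarrow> s \<in> M \<Longrightarrow> (\<Sum>q\<in>M. R p q * A q s) = (\<Sum>q\<in>M. R q s * B p q)"
    and "\<And>p s. p \<in> M \<Longrightarrow> s \<in> M \<Longrightarrow> (\<Sum>q\<in>M. R p q * A' q s) = (\<Sum>q\<in>M. R q s * B' p q)"
    and comm: "\<And>p q p' q'. p \<in> M \<Longrightarrow> q \<in> M \<Longrightarrow> p' \<in> M \<Longrightarrow> q' \<in> M \<Longrightarrow> R p q * B p' q' = B p' q' * R p q"
    and "p \<in> M" "s \<in> M"
  shows "(\<Sum>q\<in>M. R p q * (\<Sum>r\<in>M. A q r * A' r s)) = (\<Sum>q\<in>M. R q s * (\<Sum>r\<in>M. B p r * B' r q))"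
proof -
  have "(\<Sum>q\<in>M. R p q * (\<Sum>r\<in>M. A q r * A' r s)) = (\<Sum>r\<in>M. (\<Sum>q\<in>M. R p q * A q r) * A' r s)"
    by (simp add: sum_distrib_left sum_distrib_right mult.assoc) (rule sum.swap)
  also have "\<dots> = (\<Sum>r\<in>M. (\<Sum>q\<in>M. B p q * R q r) * A' r s)"
    using assms by simp
  also have "\<dots> = (\<Sum>q\<in>M. B p q * (\<Sum>r\<in>M. R q r * A' r s))"
    by (simp add: sum_distrib_left sum_distrib_right mult.assoc) (rule sum.swap)
  also have "\<dots> = (\<Sum>q\<in>M. B p q * (\<Sum>r\<in>M. R r s * B' q r))"
    using assms by simp
  also have "\<dots> = (\<Sum>q\<in>M. \<Sum>r\<in>M. (R r s * B p q) * B' q r)"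
    using assms(4,5) by (simp add: sum_distrib_left comm mult.assoc)
  also have "\<dots> = (\<Sum>r\<in>M. R r s * (\<Sum>q\<in>M. B p q * B' q r))"
    by (simp add: sum_distrib_left mult.assoc) (rule sum.swap)
  finally show ?thesis .
qed

text \<open>For commuting families, \<open>T1 T'1 T2 T'2 = (T1 T2) (T'1 T'2)\<close> and likewise in the opposite order.\<close>
theorem RTT_family_product:
  assumes "RTT_family g N e t" "RTT_family g N e t'"
    and comm: "\<And>i j k l r s. i \<in> indices N \<Longrightarrow> j \<in> indices N \<Longrightarrow> k \<in> indices N \<Longrightarrow> l \<in> indices N
      \<Longrightarrow> t i j $ r * t' k l $ s = t' k l $ s * t i j $ r"
  shows "RTT_family g N e (\<lambda>i j. \<Sum>k\<in>indices N. t i k * t' k j)"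
proof -
  interpret t: RTT_family g N e t by fact
  interpret t': RTT_family g N e t' by fact
  let ?J = "indices N" and ?M = "indices N \<times> indices N" and ?tt = "\<lambda>i j. \<Sum>k\<in>indices N. t i k * t' k j"
  have entries: "?tt i j $ r \<in> corner e" if "i \<in> ?J" "j \<in> ?J" for i j r
    unfolding fps_sum_nth using that by (intro corner_sum corner_fps_mult t.entries t'.entries)
  have hom_const: "homogenize (t' c j) * fps_const (t b f) = fps_const (t b f) * homogenize (t' c j)"
    "homogenize (t c j) * fps_const (t' b f) = fps_const (t' b f) * homogenize (t c j)"
    if "c \<in> ?J" "j \<in> ?J" "b \<in> ?J" "f \<in> ?J" for b c f j
    using that by (auto simp: fps_eq_iff homogenize_nth_mult_nth mult_homogenize_nth_nth comm)
  have T1T2: "T1_T2 ?tt q s = (\<Sum>r\<in>?M. T1_T2 t q r * T1_T2 t' r s)" if "q \<in> ?M" "s \<in> ?M" for q s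
  proof -
    obtain a b j l where [simp]: "q = (a, b)" "s = (j, l)" by (cases q, cases s) auto
    have "T1_T2 ?tt q s = (\<Sum>c\<in>?J. \<Sum>f\<in>?J. (homogenize (t a c) * homogenize (t' c j)) * (fps_const (t b f) * fps_const (t' f l)))"
      by (simp add: T1_T2_def homogenize_sum homogenize_mult sum_product fps_const_sum flip: fps_const_mult)
    also have "\<dots> = (\<Sum>c\<in>?J. \<Sum>f\<in>?J. (homogenize (t a c) * fps_const (t b f)) * (homogenize (t' c j) * fps_const (t' f l)))"
    proof (intro sum.cong refl)
      fix c f assume "c \<in> ?J" "f \<in> ?J"
      then have "homogenize (t' c j) * fps_const (t b f) = fps_const (t b f) * homogenize (t' c j)"
        using that by (intro hom_const) auto
      then show "(homogenize (t a c) * homogenize (t' c j)) * (fps_const (t b f) * fps_const (t' f l))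
          = (homogenize (t a c) * fps_const (t b f)) * (homogenize (t' c j) * fps_const (t' f l))"
        by (metis mult.assoc)
    qed
    finally show ?thesis
      by (simp add: T1_T2_def sum.cartesian_product')
  qed
  have T2T1: "T2_T1 ?tt q s = (\<Sum>r\<in>?M. T2_T1 t q r * T2_T1 t' r s)" if "q \<in> ?M" "s \<in> ?M" for q s
  proof -
    obtain a b j l where [simp]: "q = (a, b)" "s = (j, l)" by (cases q, cases s) auto
    have "T2_T1 ?tt q s = (\<Sum>f\<in>?J. \<Sum>c\<in>?J. (fps_const (t b f) * fps_const (t' f l)) * (homogenize (t a c) * homogenize (t' c j)))"
      by (simp add: T2_T1_def homogenize_sum homogenize_mult sum_product fps_const_sum flip: fps_const_mult)
    also have "\<dots> = (\<Sum>f\<in>?J. \<Sum>c\<in>?J. (fps_const (t b f) * homogenize (t a c)) * (fps_const (t' f l) * homogenize (t' c j)))"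
    proof (intro sum.cong refl)
      fix c f assume "c \<in> ?J" "f \<in> ?J"
      then have "homogenize (t a c) * fps_const (t' f l) = fps_const (t' f l) * homogenize (t a c)"
        using that by (intro hom_const) auto
      then show "(fps_const (t b f) * fps_const (t' f l)) * (homogenize (t a c) * homogenize (t' c j))
          = (fps_const (t b f) * homogenize (t a c)) * (fps_const (t' f l) * homogenize (t' c j))"
        by (metis mult.assoc)
    qed
    also have "\<dots> = (\<Sum>c\<in>?J. \<Sum>f\<in>?J. (fps_const (t b f) * homogenize (t a c)) * (fps_const (t' f l) * homogenize (t' c j)))"
      by (rule sum.swap)
    finally show ?thesis
      by (simp add: T2_T1_def sum.cartesian_product')
  qed
  have R_comm: "R_series g N e p q * T2_T1 t p' q' = T2_T1 t p' q' * R_series g N e p q"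
    if "p' \<in> ?M" "q' \<in> ?M" for p q p' q'
  proof -
    obtain a b j l i' k' j' l' where [simp]: "p' = (a, b)" "q' = (j, l)" "p = (i', k')" "q = (j', l')"
      by (cases p', cases q', cases p, cases q) auto
    show ?thesis
      using that by (intro fps_mult_commute_coeffs)
        (auto simp: R_series_def T2_T1_def mult_homogenize_nth_nth scaleC_mult_left scaleC_mult_right
          corner_unit corner_closed t.entries)
  qed
  have RTT_matrix: "(\<Sum>q\<in>?M. R_series g N e p q * T1_T2 T q s) = (\<Sum>q\<in>?M. R_series g N e q s * T2_T1 T p q)"
    if "RTT_family g N e T" "p \<in> ?M" "s \<in> ?M" for T p s
  proof -
    interpret T: RTT_family g N e T by fact
    obtain i k j l where [simp]: "p = (i, k)" "s = (j, l)" by (cases p, cases s) auto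
    show ?thesis
      using that RTT_expr_eq_0_iff[where t=T and e=e and g=g, OF T.entries, where N=N and i=i and j=j and k=k and l=l] T.RTT by simp
  qed
  have "RTT_expr g N ?tt i j k l m s = 0" if ijkl: "i \<in> ?J" "j \<in> ?J" "k \<in> ?J" "l \<in> ?J" for i j k l m s
  proof -
    have "(\<Sum>q\<in>?M. R_series g N e (i, k) q * T1_T2 ?tt q (j, l))
        = (\<Sum>q\<in>?M. R_series g N e (i, k) q * (\<Sum>r\<in>?M. T1_T2 t q r * T1_T2 t' r (j, l)))"
      using ijkl by (intro sum.cong refl) (simp add: T1T2)
    also have "\<dots> = (\<Sum>q\<in>?M. R_series g N e q (j, l) * (\<Sum>r\<in>?M. T2_T1 t (i, k) r * T2_T1 t' r q))"
      by (rule intertwining_product[OF RTT_matrix[OF assms(1)] RTT_matrix[OF assms(2)] R_comm])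
        (use ijkl in auto)
    also have "\<dots> = (\<Sum>q\<in>?M. R_series g N e q (j, l) * T2_T1 ?tt (i, k) q)"
      using ijkl by (intro sum.cong refl) (simp add: T2T1)
    finally show ?thesis
      using RTT_expr_eq_0_iff[where t="?tt" and e=e and g=g, OF entries, where N=N and i=i and j=j and k=k and l=l] ijkl by blast
  qed
  moreover have "?tt i j $ 0 = (if i = j then e else 0)" if "i \<in> ?J" "j \<in> ?J" for i j
  proof -
    have "?tt i j $ 0 = (\<Sum>k\<in>?J. if k = i then (if i = j then e else 0) else 0)"
      unfolding fps_sum_nth using that
      by (intro sum.cong refl) (auto simp: t.constant_term t'.constant_term corner_unit[OF t.unit])
    then show ?thesis using that by simp
  qed
  ultimately show ?thesis
    by unfold_locales (use t.valid t.unit entries in auto)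
qed

section \<open>Group-like series and the coproduct of matrices\<close>

lemma (in complex_ring_hom) corner: "x \<in> corner e \<Longrightarrow> h x \<in> corner (h e)"
  by (simp add: corner_def flip: mult)

lemma (in complex_ring_hom) RTT_family_image:
  assumes "RTT_family g N e t"
  shows "RTT_family g N (h e) (\<lambda>i j. map_series h (t i j))"
proof -
  interpret t: RTT_family g N e t by fact
  have "RTT_expr g N (\<lambda>i j. map_series h (t i j)) i j k l m s = h (RTT_expr g N t i j k l m s)" for i j k l m s
    by (simp add: RTT_expr_def sum diff scaleC mult)
  then show ?thesis
    by unfold_locales (auto simp: t.valid t.RTT zero t.constant_term intro!: corner t.unit t.entries)
qed

text \<open>The tensor product of an algebra with itself enters only through the commuting homomorphisms
  \<open>L a = a \<otimes> 1\<close> and \<open>R a = 1 \<otimes> a\<close>; \<open>D\<close> is the coproduct.\<close>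
locale matrix_comultiplication =
  L: complex_ring_hom L + R: complex_ring_hom R + D: complex_ring_hom D + RTT_family g N e t
  for L R D :: "'a::complex_ring \<Rightarrow> 'b::complex_ring" and g N e t +
  assumes commute: "L x * R y = R y * L x"
    and same_unit: "L e = D e" "R e = D e"
    and D_entries: "i \<in> indices N \<Longrightarrow> j \<in> indices N \<Longrightarrow>
      map_series D (t i j) = (\<Sum>k\<in>indices N. map_series L (t i k) * map_series R (t k j))"
begin

sublocale Ls: complex_ring_hom "map_series L" by (rule L.map_series_hom)
sublocale Rs: complex_ring_hom "map_series R" by (rule R.map_series_hom)
sublocale Ds: complex_ring_hom "map_series D" by (rule D.map_series_hom)

abbreviation "\<L> \<equiv> map_series L"
abbreviation "\<R> \<equiv> map_series R"
abbreviation "\<D> \<equiv> map_series D"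

lemma commute_series: "\<L> f * \<R> h = \<R> h * \<L> f"
  by (rule fps_mult_commute_coeffs) (simp add: commute)

lemma regroup:
  "(\<L> f * \<R> h) * (\<L> f' * \<R> h')
    = \<L> (f * f') * \<R> (h * h')"
proof -
  have "(\<L> f * \<R> h) * (\<L> f' * \<R> h')
      = \<L> f * (\<R> h * \<L> f') * \<R> h'"
    by (simp only: mult.assoc)
  also have "\<dots> = \<L> (f * f') * \<R> (h * h')"
    unfolding commute_series[symmetric] by (simp only: Ls.mult Rs.mult mult.assoc)
  finally show ?thesis .
qed

definition group_like :: "'a fps \<Rightarrow> bool" where
  "group_like f \<longleftrightarrow> \<D> f = \<L> f * \<R> f"

definition matrix_coproduct :: "(int \<Rightarrow> int \<Rightarrow> 'a fps) \<Rightarrow> bool" where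
  "matrix_coproduct x \<longleftrightarrow> (\<forall>i\<in>indices N. \<forall>j\<in>indices N.
     \<D> (x i j) = (\<Sum>k\<in>indices N. \<L> (x i k) * \<R> (x k j)))"

lemma matrix_coproduct_substitute:
  assumes "matrix_coproduct x" "\<phi> $ 0 = 0" "i \<in> indices N" "j \<in> indices N"
  shows "\<D> (substitute \<phi> (x i j))
    = (\<Sum>k\<in>indices N. \<L> (substitute \<phi> (x i k)) * \<R> (substitute \<phi> (x k j)))"
proof -
  interpret S: complex_ring_hom "substitute \<phi> :: 'b fps \<Rightarrow> 'b fps"
    using assms(2) by (rule substitute_hom)
  show ?thesis
    using assms by (simp add: matrix_coproduct_def D.map_series_substitute L.map_series_substitute
        R.map_series_substitute S.sum S.mult)
qed

text \<open>Transposition reverses the order of the two tensor factors.\<close>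
lemma matrix_coproduct_transpose:
  assumes "matrix_coproduct x" "i \<in> indices N" "j \<in> indices N"
  shows "\<D> (transpose_family g x i j)
    = (\<Sum>k\<in>indices N. \<L> (transpose_family g x k j) * \<R> (transpose_family g x i k))"
proof -
  have "\<D> (transpose_family g x i j)
      = theta g (- j) (- i) *\<^sub>C (\<Sum>k\<in>indices N. \<L> (x (- j) (- k)) * \<R> (x (- k) (- i)))"
    using assms by (simp add: transpose_family_def Ds.scaleC matrix_coproduct_def
        sum_indices_uminus[of "\<lambda>k. \<L> (x (- j) k) * \<R> (x k (- i))"])
  also have "\<dots> = (\<Sum>k\<in>indices N. \<L> (transpose_family g x k j) * \<R> (transpose_family g x i k))"
    unfolding scaleC_sum_right using assms(2,3)
    by (intro sum.cong refl) (simp add: transpose_family_def Ls.scaleC Rs.scaleC scaleC_mult_left scaleC_mult_right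
        scaleC_scaleC theta_mult(1)[THEN trans[OF mult.commute]])
  finally show ?thesis .
qed

lemma matrix_coproduct_transpose_substitute:
  assumes "matrix_coproduct x" "\<phi> $ 0 = 0" "i \<in> indices N" "j \<in> indices N"
  shows "\<D> (substitute \<phi> (transpose_family g x i j))
    = (\<Sum>k\<in>indices N. \<L> (substitute \<phi> (transpose_family g x k j))
        * \<R> (substitute \<phi> (transpose_family g x i k)))"
proof -
  interpret S: complex_ring_hom "substitute \<phi> :: 'b fps \<Rightarrow> 'b fps"
    using assms(2) by (rule substitute_hom)
  show ?thesis
    using assms by (simp add: matrix_coproduct_transpose D.map_series_substitute L.map_series_substitute
        R.map_series_substitute S.sum S.mult)
qed

lemma matrix_coproduct_t: "matrix_coproduct t"
  by (simp add: matrix_coproduct_def D_entries)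

text \<open>In the coproduct of the diagonal entry \<open>(1, 1)\<close> of \<open>T^t(u + \<kappa>) T(u)\<close>, the first tensor factors sum up to
  the entries of \<open>T^t(u + \<kappa>) T(u) = z(u) I\<close>; the second factors that survive again form a diagonal entry.\<close>
lemma group_like_z:
  assumes z: "\<And>i j. i \<in> indices N \<Longrightarrow> j \<in> indices N \<Longrightarrow>
      (\<Sum>k\<in>indices N. \<K> (transpose_family g t i k) * t k j) = (if i = j then z else 0)"
  shows "group_like z"
proof -
  let ?J = "indices N" and ?S = "\<K>" and ?tt = "transpose_family g t"
  have 1: "1 \<in> ?J"
    using valid by (auto simp: valid_lie_type_def indices_def)
  have "\<D> z = (\<Sum>k\<in>?J. \<D> (?S (?tt 1 k)) * \<D> (t k 1))"
    using arg_cong[OF z[OF 1 1], of "\<D>"] by (simp add: Ds.sum Ds.mult)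
  also have "\<dots> = (\<Sum>k\<in>?J. (\<Sum>b\<in>?J. \<L> (?S (?tt b k)) * \<R> (?S (?tt 1 b)))
      * (\<Sum>c\<in>?J. \<L> (t k c) * \<R> (t c 1)))"
    using 1 by (intro sum.cong refl) (simp add: matrix_coproduct_transpose_substitute matrix_coproduct_t D_entries)
  also have "\<dots> = (\<Sum>k\<in>?J. \<Sum>b\<in>?J. \<Sum>c\<in>?J.
      \<L> (?S (?tt b k) * t k c) * \<R> (?S (?tt 1 b) * t c 1))"
    by (simp add: sum_product regroup)
  also have "\<dots> = (\<Sum>b\<in>?J. \<Sum>k\<in>?J. \<Sum>c\<in>?J.
      \<L> (?S (?tt b k) * t k c) * \<R> (?S (?tt 1 b) * t c 1))"
    by (rule sum.swap)
  also have "\<dots> = (\<Sum>b\<in>?J. \<Sum>c\<in>?J. \<Sum>k\<in>?J.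
      \<L> (?S (?tt b k) * t k c) * \<R> (?S (?tt 1 b) * t c 1))"
    by (rule sum.cong[OF refl], rule sum.swap)
  also have "\<dots> = (\<Sum>b\<in>?J. \<Sum>c\<in>?J. \<L> (\<Sum>k\<in>?J. ?S (?tt b k) * t k c) * \<R> (?S (?tt 1 b) * t c 1))"
    by (simp add: Ls.sum sum_distrib_right)
  also have "\<dots> = (\<Sum>b\<in>?J. \<Sum>c\<in>?J. if c = b then \<L> z * \<R> (?S (?tt 1 b) * t c 1) else 0)"
    by (intro sum.cong refl) (auto simp: z Ls.zero)
  also have "\<dots> = (\<Sum>b\<in>?J. \<L> z * \<R> (?S (?tt 1 b) * t b 1))"
    by simp
  also have "\<dots> = \<L> z * \<R> (\<Sum>b\<in>?J. ?S (?tt 1 b) * t b 1)"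
    by (simp add: Rs.sum sum_distrib_left)
  also have "\<dots> = \<L> z * \<R> z"
    using z[OF 1 1] by simp
  finally show ?thesis
    unfolding group_like_def .
qed

lemma series_corner:
  assumes "\<And>n. f $ n \<in> corner e"
  shows "\<L> f $ n \<in> corner (D e)" "\<R> f $ n \<in> corner (D e)" "\<D> f $ n \<in> corner (D e)"
  using assms L.corner[of "f $ n" e] R.corner[of "f $ n" e] D.corner[of "f $ n" e] by (simp_all add: same_unit)

text \<open>Both \<open>D y\<close> and \<open>y \<otimes> y\<close> solve \<open>Y(u) Y(u + c) = D z\<close> with unit constant term, so they agree.\<close>
lemma group_like_y:
  assumes "group_like z" and y: "\<And>n. y $ n \<in> corner e" "y $ 0 = e"
    and z: "z = y * shift_series c y"
  shows "group_like y"
  unfolding group_like_def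
proof (rule substitute_square_root_unique)
  interpret S: complex_ring_hom "shift_series c :: 'b fps \<Rightarrow> 'b fps"
    by (rule substitute_hom) simp
  show De: "D e \<in> corner (D e)"
    by (rule D.corner[OF unit])
  show "\<D> y $ n \<in> corner (D e)" "\<D> y $ 0 = D e" for n
    using series_corner(3)[of y n] by (simp_all add: y)
  show "(\<L> y * \<R> y) $ n \<in> corner (D e)" for n
    by (intro corner_fps_mult series_corner y)
  show "(\<L> y * \<R> y) $ 0 = D e"
    using De by (simp add: y same_unit corner_unit)
  show "\<D> y * shift_series c (\<D> y)
      = (\<L> y * \<R> y) * shift_series c (\<L> y * \<R> y)"
    using \<open>group_like z\<close> unfolding group_like_def z S.mult
    by (simp add: Ds.mult D.map_series_substitute regroup
        flip: L.map_series_substitute R.map_series_substitute)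
qed (rule inverse_linear_power_nth_diag)

text \<open>\<open>D v\<close> and \<open>v \<otimes> v\<close> are both inverse to \<open>D y = y \<otimes> y\<close>.\<close>
lemma group_like_inverse:
  assumes "group_like y" and v: "\<And>n. v $ n \<in> corner e" "y * v = fps_const e" "v * y = fps_const e"
  shows "group_like v"
proof -
  have const: "\<L> (fps_const e) = fps_const (D e)" "\<R> (fps_const e) = fps_const (D e)"
    "\<D> (fps_const e) = fps_const (D e)"
    by (auto simp: fps_eq_iff same_unit L.zero R.zero D.zero)
  have De: "D e \<in> corner (D e)"
    by (rule D.corner[OF unit])
  have "\<D> v = \<D> v * fps_const (D e)"
    by (intro corner_fps_const_mult(2)[symmetric] series_corner v)
  also have "fps_const (D e) = \<L> (y * v) * \<R> (y * v)"
    using De by (simp add: v const corner_unit)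
  also have "\<dots> = \<D> y * (\<L> v * \<R> v)"
    using assms(1) by (simp add: group_like_def regroup)
  also have "\<D> v * \<dots> = \<D> (v * y) * (\<L> v * \<R> v)"
    by (simp add: Ds.mult mult.assoc)
  also have "\<dots> = \<L> v * \<R> v"
    unfolding v(3) const by (intro corner_fps_const_mult(1) corner_fps_mult series_corner v)
  finally show ?thesis
    unfolding group_like_def .
qed

lemma matrix_coproduct_group_like_mult:
  assumes "group_like v" "matrix_coproduct x"
  shows "matrix_coproduct (\<lambda>i j. v * x i j)"
  using assms by (auto simp: matrix_coproduct_def group_like_def Ds.mult sum_distrib_left regroup)

text \<open>Expanding \<open>x\<close> and its transpose in \<open>x(\<phi>) G x^t(\<psi>)\<close> moves the outer
  indices \<open>i\<close> and \<open>j\<close> into the first tensor factor, since transposition swaps the factors.  The second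
  factor keeps the sums over \<open>a\<close> and \<open>b\<close> next to \<open>G\<close>, so it is an entry of \<open>\<sigma>\<close> again.\<close>
lemma twisted_coproduct:
  assumes x: "matrix_coproduct x" and \<phi>: "\<phi> $ 0 = 0" and \<psi>: "\<psi> $ 0 = 0"
    and G: "\<And>a b. a \<in> indices N \<Longrightarrow> b \<in> indices N \<Longrightarrow> \<D> (G a b) = \<R> (G a b)"
    and ij: "i \<in> indices N" "j \<in> indices N"
  defines "\<sigma> \<equiv> \<lambda>i j. \<Sum>b\<in>indices N. (\<Sum>a\<in>indices N. substitute \<phi> (x i a) * G a b) * substitute \<psi> (transpose_family g x b j)"
  shows "\<D> (\<sigma> i j) = (\<Sum>k\<in>indices N. \<Sum>l\<in>indices N.
    \<L> (substitute \<phi> (x i k) * substitute \<psi> (transpose_family g x l j)) * \<R> (\<sigma> k l))"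
proof -
  let ?J = "indices N" and ?x = "\<lambda>i j. substitute \<phi> (x i j)" and ?xt = "\<lambda>i j. substitute \<psi> (transpose_family g x i j)"
  have "\<D> (\<sigma> i j) = (\<Sum>b\<in>?J. \<Sum>a\<in>?J. \<D> (?x i a) * \<D> (G a b) * \<D> (?xt b j))"
    by (simp add: \<sigma>_def Ds.sum Ds.mult sum_distrib_right)
  also have "\<dots> = (\<Sum>b\<in>?J. \<Sum>a\<in>?J. \<Sum>k\<in>?J. \<Sum>l\<in>?J.
      \<L> (?x i k * ?xt l j) * \<R> (?x k a * G a b * ?xt b l))"
  proof (intro sum.cong refl)
    fix a b assume ab: "b \<in> ?J" "a \<in> ?J"
    have "\<D> (?x i a) * \<D> (G a b) * \<D> (?xt b j)
        = (\<Sum>k\<in>?J. \<L> (?x i k) * \<R> (?x k a)) * \<D> (G a b)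
          * (\<Sum>l\<in>?J. \<L> (?xt l j) * \<R> (?xt b l))"
      using ab ij by (simp add: matrix_coproduct_transpose_substitute[OF x \<psi>] matrix_coproduct_substitute[OF x \<phi>])
    also have "\<dots> = (\<Sum>k\<in>?J. \<Sum>l\<in>?J. (\<L> (?x i k) * \<R> (?x k a))
          * (\<D> (G a b) * \<L> (?xt l j)) * \<R> (?xt b l))"
      by (subst sum_distrib_right, subst sum_product, simp only: mult.assoc)
    also have "\<dots> = (\<Sum>k\<in>?J. \<Sum>l\<in>?J. (\<L> (?x i k) * \<R> (?x k a))
          * (\<L> (?xt l j) * \<R> (G a b * ?xt b l)))"
      using ab by (simp add: G commute_series[symmetric] Rs.mult mult.assoc)
    also have "\<dots> = (\<Sum>k\<in>?J. \<Sum>l\<in>?J. \<L> (?x i k * ?xt l j) * \<R> (?x k a * G a b * ?xt b l))"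
      by (simp only: regroup) (simp only: mult.assoc)
    finally show "\<D> (?x i a) * \<D> (G a b) * \<D> (?xt b j)
        = (\<Sum>k\<in>?J. \<Sum>l\<in>?J. \<L> (?x i k * ?xt l j) * \<R> (?x k a * G a b * ?xt b l))" .
  qed
  also have "\<dots> = (\<Sum>k\<in>?J. \<Sum>l\<in>?J. \<Sum>b\<in>?J. \<Sum>a\<in>?J.
      \<L> (?x i k * ?xt l j) * \<R> (?x k a * G a b * ?xt b l))"
    (is "(\<Sum>b\<in>?J. \<Sum>a\<in>?J. \<Sum>k\<in>?J. \<Sum>l\<in>?J. ?f b a k l) = _")
  proof -
    have "(\<Sum>b\<in>?J. \<Sum>a\<in>?J. \<Sum>k\<in>?J. \<Sum>l\<in>?J. ?f b a k l) = (\<Sum>q\<in>?J \<times> ?J. \<Sum>r\<in>?J \<times> ?J. ?f (fst q) (snd q) (fst r) (snd r))"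
      by (simp add: sum.cartesian_product')
    also have "\<dots> = (\<Sum>r\<in>?J \<times> ?J. \<Sum>q\<in>?J \<times> ?J. ?f (fst q) (snd q) (fst r) (snd r))"
      by (rule sum.swap)
    finally show ?thesis
      by (simp add: sum.cartesian_product')
  qed
  also have "\<dots> = (\<Sum>k\<in>?J. \<Sum>l\<in>?J. \<L> (?x i k * ?xt l j) * \<R> (\<sigma> k l))"
    by (simp add: \<sigma>_def Rs.sum sum_distrib_left sum_distrib_right)
  finally show ?thesis .
qed

end

section \<open>Complex algebras with a carrier\<close>

locale complex_algebra = ring A for A :: "'a complex_algebra" (structure) +
  assumes smult_closed [simp, intro]: "x \<in> carrier A \<Longrightarrow> c \<odot> x \<in> carrier A"
    and smult_l_distr: "x \<in> carrier A \<Longrightarrow> (c + d) \<odot> x = c \<odot> x \<oplus> d \<odot> x"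
    and smult_r_distr: "x \<in> carrier A \<Longrightarrow> y \<in> carrier A \<Longrightarrow> c \<odot> (x \<oplus> y) = c \<odot> x \<oplus> c \<odot> y"
    and smult_assoc: "x \<in> carrier A \<Longrightarrow> (c * d) \<odot> x = c \<odot> (d \<odot> x)"
    and smult_one [simp]: "x \<in> carrier A \<Longrightarrow> 1 \<odot> x = x"
    and smult_mult_left: "x \<in> carrier A \<Longrightarrow> y \<in> carrier A \<Longrightarrow> (c \<odot> x) \<otimes> y = c \<odot> (x \<otimes> y)"
    and smult_mult_right: "x \<in> carrier A \<Longrightarrow> y \<in> carrier A \<Longrightarrow> x \<otimes> (c \<odot> y) = c \<odot> (x \<otimes> y)"
begin

lemma smult_zero_left [simp]: "x \<in> carrier A \<Longrightarrow> 0 \<odot> x = \<zero>"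
  using smult_l_distr[of x 0 0] by (simp add: add.r_cancel_one')

lemma smult_minus_one: "x \<in> carrier A \<Longrightarrow> (- 1) \<odot> x = \<ominus> x"
  using smult_l_distr[of x "-1" 1] by (simp add: minus_equality)

lemma smult_zero_right [simp]: "c \<odot> \<zero> = \<zero>"
  using smult_assoc[of \<zero> c 0] smult_zero_left[of \<zero>] by simp

lemma is_subspaceI:
  assumes "U \<subseteq> carrier A" "\<zero> \<in> U" "\<And>x y. x \<in> U \<Longrightarrow> y \<in> U \<Longrightarrow> x \<oplus> y \<in> U"
    "\<And>c x. x \<in> U \<Longrightarrow> c \<odot> x \<in> U"
  shows "is_subspace U A"
  unfolding is_subspace_def
proof (intro submodule.intro subgroup.intro submodule_axioms.intro)
  show "inv\<^bsub>add_monoid A\<^esub> x \<in> U" if "x \<in> U" for x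
    using assms(4)[OF that, of "-1"] smult_minus_one[of x] that assms(1) by (auto simp: a_inv_def)
qed (use assms in auto)

lemma is_subalgebraI:
  assumes "is_subspace B A" "\<one> \<in> B" "\<And>x y. x \<in> B \<Longrightarrow> y \<in> B \<Longrightarrow> x \<otimes> y \<in> B"
  shows "is_subalgebra B A"
proof -
  interpret submodule B "ring_of_type_algebra :: complex ring" A
    using assms(1) by (simp add: is_subspace_def)
  show ?thesis
    unfolding is_subalgebra_def subring_def
    using assms subset by (auto intro: subgroup_axioms submonoid.intro)
qed

end

lemma is_subspaceD:
  assumes "is_subspace U A"
  shows "U \<subseteq> carrier A" (is ?carrier) and "\<zero>\<^bsub>A\<^esub> \<in> U" (is ?zero)
    and "x \<in> U \<Longrightarrow> y \<in> U \<Longrightarrow> x \<oplus>\<^bsub>A\<^esub> y \<in> U" (is "PROP ?add")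
    and "x \<in> U \<Longrightarrow> c \<odot>\<^bsub>A\<^esub> x \<in> U" (is "PROP ?smult")
proof -
  interpret submodule U "ring_of_type_algebra :: complex ring" A
    using assms by (simp add: is_subspace_def)
  show ?carrier ?zero "PROP ?add" "PROP ?smult"
    using subset one_closed m_closed smult_closed by (auto simp: ring_of_type_algebra_def)
qed

lemma is_subalgebraD:
  assumes "is_subalgebra B A"
  shows "is_subspace B A" "\<one>\<^bsub>A\<^esub> \<in> B" "x \<in> B \<Longrightarrow> y \<in> B \<Longrightarrow> x \<otimes>\<^bsub>A\<^esub> y \<in> B"
  using assms by (auto simp: is_subalgebra_def subring_def submonoid_def)

context complex_algebra
begin

lemma generated_subalgebra_is_subalgebra:
  assumes "S \<subseteq> carrier A"
  shows "is_subalgebra (generated_subalgebra A S) A" "S \<subseteq> generated_subalgebra A S"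
proof -
  have "is_subalgebra (carrier A) A"
    by (intro is_subalgebraI is_subspaceI) auto
  then have sub: "generated_subalgebra A S \<subseteq> carrier A"
    using assms by (auto simp: generated_subalgebra_def)
  show "is_subalgebra (generated_subalgebra A S) A"
    by (intro is_subalgebraI is_subspaceI sub)
      (auto simp: generated_subalgebra_def dest: is_subalgebraD is_subspaceD[OF is_subalgebraD(1)])
  show "S \<subseteq> generated_subalgebra A S"
    by (auto simp: generated_subalgebra_def)
qed

lemma spanned_subspace_is_subspace:
  assumes "S \<subseteq> carrier A"
  shows "is_subspace (spanned_subspace A S) A" "S \<subseteq> spanned_subspace A S"
proof -
  have "is_subspace (carrier A) A"
    by (intro is_subspaceI) auto
  then have sub: "spanned_subspace A S \<subseteq> carrier A"
    using assms by (auto simp: spanned_subspace_def)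
  show "is_subspace (spanned_subspace A S) A"
    by (intro is_subspaceI sub) (auto simp: spanned_subspace_def dest: is_subspaceD)
  show "S \<subseteq> spanned_subspace A S"
    by (auto simp: spanned_subspace_def)
qed

end

lemma generated_subalgebra_minimal:
  "is_subalgebra B A \<Longrightarrow> S \<subseteq> B \<Longrightarrow> generated_subalgebra A S \<subseteq> B"
  by (auto simp: generated_subalgebra_def)

lemma spanned_subspace_minimal:
  "is_subspace U A \<Longrightarrow> S \<subseteq> U \<Longrightarrow> spanned_subspace A S \<subseteq> U"
  by (auto simp: spanned_subspace_def)

text \<open>Multiplication by a fixed element is linear, so closure extends from the spanning set to the span
  first in the right and then in the left factor.\<close>
lemma (in complex_algebra) spanned_subspace_mult_closed:
  assumes S: "S \<subseteq> carrier A" and mult: "\<And>s s'. s \<in> S \<Longrightarrow> s' \<in> S \<Longrightarrow> s \<otimes> s' \<in> S"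
    and x: "x \<in> spanned_subspace A S" and y: "y \<in> spanned_subspace A S"
  shows "x \<otimes> y \<in> spanned_subspace A S"
proof -
  let ?U = "spanned_subspace A S"
  note U = spanned_subspace_is_subspace[OF S]
  have "is_subspace {x \<in> carrier A. s \<otimes> x \<in> ?U} A" if "s \<in> S" for s
    by (intro is_subspaceI) (use that S is_subspaceD[OF U(1)] in \<open>auto simp: r_distr smult_mult_right\<close>)
  moreover have "S \<subseteq> {x \<in> carrier A. s \<otimes> x \<in> ?U}" if "s \<in> S" for s
    using that S U(2) mult by auto
  ultimately have left: "s \<otimes> y' \<in> ?U" if "s \<in> S" "y' \<in> ?U" for s y'
    using spanned_subspace_minimal that by blast
  have "is_subspace {x \<in> carrier A. x \<otimes> y \<in> ?U} A"
    by (intro is_subspaceI) (use y S is_subspaceD[OF U(1)] in \<open>auto simp: l_distr smult_mult_left\<close>)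
  moreover have "S \<subseteq> {x \<in> carrier A. x \<otimes> y \<in> ?U}"
    using S y left by auto
  ultimately show ?thesis
    using spanned_subspace_minimal x by blast
qed

text \<open>The axioms are equations, apart from the existence of opposites, so they pass to images.\<close>

lemma complex_algebra_image:
  fixes A :: "'a complex_algebra" and B :: "'b complex_algebra"
  assumes "complex_algebra A" and surj: "h ` carrier A = carrier B"
    and add: "\<And>x y. x \<in> carrier A \<Longrightarrow> y \<in> carrier A \<Longrightarrow> h (x \<oplus>\<^bsub>A\<^esub> y) = h x \<oplus>\<^bsub>B\<^esub> h y"
    and mult: "\<And>x y. x \<in> carrier A \<Longrightarrow> y \<in> carrier A \<Longrightarrow> h (x \<otimes>\<^bsub>A\<^esub> y) = h x \<otimes>\<^bsub>B\<^esub> h y"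
    and smult: "\<And>c x. x \<in> carrier A \<Longrightarrow> h (c \<odot>\<^bsub>A\<^esub> x) = c \<odot>\<^bsub>B\<^esub> h x"
    and zero: "h \<zero>\<^bsub>A\<^esub> = \<zero>\<^bsub>B\<^esub>" and one: "h \<one>\<^bsub>A\<^esub> = \<one>\<^bsub>B\<^esub>"
  shows "complex_algebra B"
proof -
  interpret A: complex_algebra A by fact
  have B: "carrier B = h ` carrier A" using surj ..
  note hom = add[symmetric] mult[symmetric] smult[symmetric] zero[symmetric] one[symmetric]
  show ?thesis
  proof (intro complex_algebra.intro complex_algebra_axioms.intro ringI abelian_groupI Group.monoidI)
    fix x assume "x \<in> carrier B"
    then obtain a where "a \<in> carrier A" "x = h a" by (auto simp: B)
    then show "\<exists>y\<in>carrier B. y \<oplus>\<^bsub>B\<^esub> x = \<zero>\<^bsub>B\<^esub>"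
      by (auto simp: B hom A.l_neg intro!: bexI[of _ "\<ominus>\<^bsub>A\<^esub> a"])
  qed (auto simp: B hom A.a_ac A.m_assoc A.l_distr A.r_distr A.smult_l_distr A.smult_r_distr
      A.smult_assoc A.smult_mult_left A.smult_mult_right)
qed

section \<open>Monoid algebras\<close>

abbreviation "support \<equiv> Poly_Mapping.keys"
abbreviation "coefficient \<equiv> Poly_Mapping.lookup"
abbreviation "single \<equiv> Poly_Mapping.single"

lemma poly_mapping_single_induct [consumes 1, case_names zero add]:
  fixes p :: "'m \<Rightarrow>\<^sub>0 'c::comm_monoid_add"
  assumes "support p \<subseteq> S" and zero: "P 0"
    and step: "\<And>q x c. support q \<subseteq> S \<Longrightarrow> P q \<Longrightarrow> x \<in> S \<Longrightarrow> P (q + single x c)"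
  shows "P p"
proof -
  have p: "p = (\<Sum>x\<in>support p. single x (coefficient p x))"
    by (rule poly_mapping_eqI)
      (simp add: lookup_sum lookup_single when_def in_keys_iff)
  have keys: "support (\<Sum>x\<in>K. single x (coefficient p x)) \<subseteq> K" if "finite K" for K
    using keys_sum[of "\<lambda>x. single x (coefficient p x)" K] by (auto split: if_splits)
  have "P (\<Sum>x\<in>K. single x (coefficient p x))" if "finite K" "K \<subseteq> S" for K
    using that
  proof (induction K rule: finite_induct)
    case (insert x K)
    then have "P ((\<Sum>x\<in>K. single x (coefficient p x)) + single x (coefficient p x))"
      using keys[of K] by (intro step) auto
    then show ?case using insert by (simp add: add.commute)
  qed (simp add: zero)
  then show ?thesis
    using p assms(1) finite_keys[of p] by metis
qed

context
  fixes M :: "('m, 'b) monoid_scheme" (structure)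
begin

definition convolution :: "('m \<Rightarrow>\<^sub>0 complex) \<Rightarrow> ('m \<Rightarrow>\<^sub>0 complex) \<Rightarrow> ('m \<Rightarrow>\<^sub>0 complex)" where
  "convolution p q = (\<Sum>x\<in>support p. \<Sum>y\<in>support q.
        single (x \<otimes> y) (coefficient p x * coefficient q y))"

lemma convolution_extend:
  assumes "finite S" "finite T" "support p \<subseteq> S" "support q \<subseteq> T"
  shows "convolution p q = (\<Sum>x\<in>S. \<Sum>y\<in>T. single (x \<otimes> y) (coefficient p x * coefficient q y))"
proof -
  have "convolution p q = (\<Sum>x\<in>S. \<Sum>y\<in>support q. single (x \<otimes> y) (coefficient p x * coefficient q y))"
    unfolding convolution_def by (rule sum.mono_neutral_left) (use assms in \<open>auto simp: in_keys_iff\<close>)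
  also have "\<dots> = (\<Sum>x\<in>S. \<Sum>y\<in>T. single (x \<otimes> y) (coefficient p x * coefficient q y))"
    by (rule sum.cong[OF refl], rule sum.mono_neutral_left) (use assms in \<open>auto simp: in_keys_iff\<close>)
  finally show ?thesis .
qed

lemma convolution_add_left: "convolution (p + p') q = convolution p q + convolution p' q"
proof -
  let ?S = "support p \<union> support p'" and ?T = "support q"
  have "convolution r q = (\<Sum>x\<in>?S. \<Sum>y\<in>?T. single (x \<otimes> y) (coefficient r x * coefficient q y))"
    if "support r \<subseteq> ?S" for r
    using that by (intro convolution_extend) auto
  then show ?thesis
    using keys_add[of p p'] by (simp add: lookup_add distrib_right single_add sum.distrib)
qed

lemma convolution_add_right: "convolution p (q + q') = convolution p q + convolution p q'"
proof -
  let ?S = "support p" and ?T = "support q \<union> support q'"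
  have "convolution p r = (\<Sum>x\<in>?S. \<Sum>y\<in>?T. single (x \<otimes> y) (coefficient p x * coefficient r y))"
    if "support r \<subseteq> ?T" for r
    using that by (intro convolution_extend) auto
  then show ?thesis
    using keys_add[of q q'] by (simp add: lookup_add distrib_left single_add sum.distrib)
qed

lemma convolution_zero [simp]: "convolution 0 q = 0" "convolution p 0 = 0"
  by (simp_all add: convolution_def)

lemma convolution_single [simp]:
  "convolution (single x a) (single y b) = single (x \<otimes> y) (a * b)"
  by (subst convolution_extend[of "{x}" "{y}"]) auto

end

definition scale_mapping :: "complex \<Rightarrow> ('m \<Rightarrow>\<^sub>0 complex) \<Rightarrow> ('m \<Rightarrow>\<^sub>0 complex)" where
  "scale_mapping c = Poly_Mapping.map ((*) c)"

lemma lookup_scale_mapping: "coefficient (scale_mapping c p) x = c * coefficient p x"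
  by (simp add: scale_mapping_def Poly_Mapping.map.rep_eq when_def)

lemma scale_mapping_simps:
  "scale_mapping c 0 = 0"
  "scale_mapping c (p + q) = scale_mapping c p + scale_mapping c q"
  "scale_mapping c (single x a) = single x (c * a)"
  by (rule poly_mapping_eqI; simp add: lookup_scale_mapping lookup_add distrib_left lookup_single when_def)+

lemma monoid_algebra_simps:
  "carrier (monoid_algebra M) = {p. support p \<subseteq> carrier M}"
  "p \<otimes>\<^bsub>monoid_algebra M\<^esub> q = convolution M p q"
  "\<one>\<^bsub>monoid_algebra M\<^esub> = single \<one>\<^bsub>M\<^esub> 1"
  "\<zero>\<^bsub>monoid_algebra M\<^esub> = 0"
  "p \<oplus>\<^bsub>monoid_algebra M\<^esub> q = p + q"
  "c \<odot>\<^bsub>monoid_algebra M\<^esub> p = scale_mapping c p"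
  by (simp_all add: monoid_algebra_def convolution_def scale_mapping_def)

lemma monoid_algebra_complex_algebra:
  fixes M :: "('m, 'b) monoid_scheme" (structure)
  assumes "Group.monoid M"
  shows "complex_algebra (monoid_algebra M)"
proof -
  interpret monoid M by fact
  have plus: "support (p + q) \<subseteq> carrier M"
    if "support p \<subseteq> carrier M" "support q \<subseteq> carrier M" for p q :: "'m \<Rightarrow>\<^sub>0 complex"
    using that keys_add[of p q] by blast
  have uminus: "support (- p) \<subseteq> carrier M" if "support p \<subseteq> carrier M" for p :: "'m \<Rightarrow>\<^sub>0 complex"
    using that by simp
  have mult: "support (convolution M p q) \<subseteq> carrier M"
    if p: "support p \<subseteq> carrier M" and q: "support q \<subseteq> carrier M" for p q
    using p
  proof (induction p rule: poly_mapping_single_induct)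
    case (add p x a)
    have "support (convolution M (single x a) q) \<subseteq> carrier M"
      using q
    proof (induction q rule: poly_mapping_single_induct)
      case (add q y b)
      then show ?case using \<open>x \<in> carrier M\<close>
        by (simp add: convolution_add_right plus)
    qed simp
    then show ?case using add
      by (simp add: convolution_add_left plus)
  qed simp
  have scale: "support (scale_mapping c p) \<subseteq> carrier M" if "support p \<subseteq> carrier M" for c p
    using that by (auto simp: in_keys_iff lookup_scale_mapping)
  have assoc: "convolution M (convolution M p q) r = convolution M p (convolution M q r)"
    if p: "support p \<subseteq> carrier M" and q: "support q \<subseteq> carrier M" and r: "support r \<subseteq> carrier M" for p q r
    using p
  proof (induction p rule: poly_mapping_single_induct)
    case (add p x a)
    have "convolution M (convolution M (single x a) q) r = convolution M (single x a) (convolution M q r)"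
      using q
    proof (induction q rule: poly_mapping_single_induct)
      case (add q y b)
      have "convolution M (convolution M (single x a) (single y b)) r
          = convolution M (single x a) (convolution M (single y b) r)"
        using r
        by (induction r rule: poly_mapping_single_induct)
          (use \<open>x \<in> carrier M\<close> \<open>y \<in> carrier M\<close> in \<open>simp_all add: convolution_add_right m_assoc mult.assoc\<close>)
      then show ?case using add by (simp add: convolution_add_right convolution_add_left)
    qed simp
    then show ?case using add by (simp add: convolution_add_left)
  qed simp
  have one: "convolution M (single \<one> 1) p = p" "convolution M p (single \<one> 1) = p"
    if "support p \<subseteq> carrier M" for p
    using that by (induction p rule: poly_mapping_single_induct) (simp_all add: convolution_add_left convolution_add_right)
  have scale_left: "convolution M (scale_mapping c p) q = scale_mapping c (convolution M p q)"
    and scale_right: "convolution M p (scale_mapping c q) = scale_mapping c (convolution M p q)" for c p q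
  proof -
    have p: "support p \<subseteq> UNIV" and q: "support q \<subseteq> UNIV" by auto
    have "convolution M (scale_mapping c (single x a)) q = scale_mapping c (convolution M (single x a) q)
       \<and> convolution M (single x a) (scale_mapping c q) = scale_mapping c (convolution M (single x a) q)" for x a
      using q by (induction q rule: poly_mapping_single_induct) (simp_all add: scale_mapping_simps convolution_add_right mult_ac)
    note single = this
    have "convolution M (scale_mapping c p) q = scale_mapping c (convolution M p q)
       \<and> convolution M p (scale_mapping c q) = scale_mapping c (convolution M p q)"
      using p by (induction p rule: poly_mapping_single_induct) (simp_all add: single[unfolded scale_mapping_simps(3)] scale_mapping_simps convolution_add_left)
    then show "convolution M (scale_mapping c p) q = scale_mapping c (convolution M p q)"
      "convolution M p (scale_mapping c q) = scale_mapping c (convolution M p q)" by auto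
  qed
  show ?thesis
  proof (intro complex_algebra.intro complex_algebra_axioms.intro ringI abelian_groupI Group.monoidI)
    fix p assume "p \<in> carrier (monoid_algebra M)"
    then show "\<exists>q\<in>carrier (monoid_algebra M). q \<oplus>\<^bsub>monoid_algebra M\<^esub> p = \<zero>\<^bsub>monoid_algebra M\<^esub>"
      using uminus[of p] by (intro bexI[of _ "- p"]) (auto simp: monoid_algebra_simps)
  next
    show "(c + d) \<odot>\<^bsub>monoid_algebra M\<^esub> p = c \<odot>\<^bsub>monoid_algebra M\<^esub> p \<oplus>\<^bsub>monoid_algebra M\<^esub> d \<odot>\<^bsub>monoid_algebra M\<^esub> p"
      "(c * d) \<odot>\<^bsub>monoid_algebra M\<^esub> p = c \<odot>\<^bsub>monoid_algebra M\<^esub> (d \<odot>\<^bsub>monoid_algebra M\<^esub> p)"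
      "1 \<odot>\<^bsub>monoid_algebra M\<^esub> p = p" for c d p
      by (rule poly_mapping_eqI; simp add: monoid_algebra_simps lookup_scale_mapping lookup_add algebra_simps)+
  qed (simp_all add: monoid_algebra_simps plus mult scale assoc one convolution_add_left convolution_add_right
      scale_left scale_right scale_mapping_simps add_ac)
qed

section \<open>The ambient ring\<close>

text \<open>The product of all complex algebras whose elements are of type \<open>'a\<close>, i.e. of all such structures
  on all carriers.  It is a ring with complex scalars at the level of types, and every one of these
  algebras embeds into it as a factor.  The value \<open>undefined\<close> at records that are not algebras makes
  equality componentwise.\<close>

typedef 'a ambient = "{f :: 'a complex_algebra \<Rightarrow> 'a.
    \<forall>A. if complex_algebra A then f A \<in> carrier A else f A = undefined}"
proof
  show "(\<lambda>A. if complex_algebra A then \<zero>\<^bsub>A\<^esub> else undefined)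
      \<in> {f :: 'a complex_algebra \<Rightarrow> 'a. \<forall>A. if complex_algebra A then f A \<in> carrier A else f A = undefined}"
    by (auto simp: complex_algebra_def intro!: abelian_monoid.zero_closed ring.is_abelian_group abelian_group.axioms(1))
qed

definition component :: "'a complex_algebra \<Rightarrow> 'a ambient \<Rightarrow> 'a" where
  "component A x = Rep_ambient x A"

definition pointwise :: "('a complex_algebra \<Rightarrow> 'a) \<Rightarrow> 'a ambient" where
  "pointwise f = Abs_ambient (\<lambda>A. if complex_algebra A then f A else undefined)"

lemma ambient_eqI:
  assumes "\<And>A. complex_algebra A \<Longrightarrow> component A x = component A y"
  shows "x = y"
proof -
  have "Rep_ambient x A = Rep_ambient y A" for A
    using assms[of A] Rep_ambient[of x] Rep_ambient[of y]
    by (cases "complex_algebra A") (auto simp: component_def split: if_splits)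
  then show ?thesis
    by (simp add: Rep_ambient_inject[symmetric] fun_eq_iff)
qed

lemma component_closed: "complex_algebra A \<Longrightarrow> component A x \<in> carrier A"
  using Rep_ambient[of x] by (auto simp: component_def split: if_splits)

lemma component_pointwise:
  assumes "\<And>A. complex_algebra A \<Longrightarrow> f A \<in> carrier A" "complex_algebra A"
  shows "component A (pointwise f) = f A"
  using assms by (simp add: component_def pointwise_def Abs_ambient_inverse)

instantiation ambient :: (type) complex_ring
begin

definition zero_ambient :: "'a ambient" where
  "zero_ambient = pointwise (\<lambda>A. \<zero>\<^bsub>A\<^esub>)"
definition plus_ambient :: "'a ambient \<Rightarrow> 'a ambient \<Rightarrow> 'a ambient" where
  "plus_ambient x y = pointwise (\<lambda>A. component A x \<oplus>\<^bsub>A\<^esub> component A y)"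
definition uminus_ambient :: "'a ambient \<Rightarrow> 'a ambient" where
  "uminus_ambient x = pointwise (\<lambda>A. \<ominus>\<^bsub>A\<^esub> component A x)"
definition minus_ambient :: "'a ambient \<Rightarrow> 'a ambient \<Rightarrow> 'a ambient" where
  "minus_ambient x y = x + (- y)"
definition times_ambient :: "'a ambient \<Rightarrow> 'a ambient \<Rightarrow> 'a ambient" where
  "times_ambient x y = pointwise (\<lambda>A. component A x \<otimes>\<^bsub>A\<^esub> component A y)"
definition scaleC_ambient :: "complex \<Rightarrow> 'a ambient \<Rightarrow> 'a ambient" where
  "scaleC_ambient c x = pointwise (\<lambda>A. c \<odot>\<^bsub>A\<^esub> component A x)"

lemma component_hom:
  assumes "complex_algebra A"
  shows "component A 0 = \<zero>\<^bsub>A\<^esub>" (is ?law_a)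
    and "component A (x + y) = component A x \<oplus>\<^bsub>A\<^esub> component A y" (is ?law_b)
    and "component A (- x) = \<ominus>\<^bsub>A\<^esub> component A x" (is ?law_c)
    and "component A (x * y) = component A x \<otimes>\<^bsub>A\<^esub> component A y" (is ?law_d)
    and "component A (c *\<^sub>C x) = c \<odot>\<^bsub>A\<^esub> component A x" (is ?law_e)
proof -
  have "ring A" if "complex_algebra A" for A :: "'a complex_algebra"
    using that by (simp add: complex_algebra_def)
  note closed = component_closed ring.ring_simprules(1,2,3,5)[OF this] complex_algebra.smult_closed
  show ?law_a ?law_b ?law_c ?law_d ?law_e
    unfolding zero_ambient_def plus_ambient_def uminus_ambient_def times_ambient_def scaleC_ambient_def
    by (rule component_pointwise[OF _ assms]; simp add: closed)+
qed

lemma ambient_laws: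
  fixes x y z :: "'a ambient"
  assumes "complex_algebra A"
  shows "component A (x + y + z) = component A (x + (y + z))" (is ?law_a) "component A (x + y) = component A (y + x)" (is ?law_b)
    "component A (0 + x) = component A x" (is ?law_c) "component A (- x + x) = component A 0" (is ?law_d)
    "component A (x - y) = component A (x + - y)" (is ?law_e)
    "component A (x * y * z) = component A (x * (y * z))" (is ?law_f)
    "component A ((x + y) * z) = component A (x * z + y * z)" (is ?law_g)
    "component A (x * (y + z)) = component A (x * y + x * z)" (is ?law_h)
    "component A (c *\<^sub>C (x + y)) = component A (c *\<^sub>C x + c *\<^sub>C y)" (is ?law_i)
    "component A ((c + d) *\<^sub>C x) = component A (c *\<^sub>C x + d *\<^sub>C x)" (is ?law_j)
    "component A (c *\<^sub>C d *\<^sub>C x) = component A ((c * d) *\<^sub>C x)" (is ?law_k)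
    "component A (1 *\<^sub>C x) = component A x" (is ?law_l)
    "component A ((c *\<^sub>C x) * y) = component A (c *\<^sub>C (x * y))" (is ?law_m)
    "component A (x * (c *\<^sub>C y)) = component A (c *\<^sub>C (x * y))" (is ?law_n)
proof -
  interpret complex_algebra A by fact
  note [simp] = component_hom[OF assms] component_closed[OF assms]
  show ?law_a ?law_b ?law_c ?law_d ?law_e ?law_f ?law_g ?law_h ?law_i ?law_j ?law_k ?law_l ?law_m ?law_n
    by (simp_all add: m_assoc l_distr r_distr smult_l_distr smult_r_distr smult_assoc
        smult_mult_left smult_mult_right l_neg r_neg minus_ambient_def a_ac)
qed

instance
  by (intro_classes; rule ambient_eqI; rule ambient_laws)

end

definition embed_elem :: "'a complex_algebra \<Rightarrow> 'a \<Rightarrow> 'a ambient" where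
  "embed_elem A a = pointwise (\<lambda>B. if B = A then a else \<zero>\<^bsub>B\<^esub>)"

definition embed_series :: "'a complex_algebra \<Rightarrow> (nat \<Rightarrow> 'a) \<Rightarrow> 'a ambient fps" where
  "embed_series A f = Abs_fps (\<lambda>n. embed_elem A (f n))"

lemma embed_series_nth [simp]: "embed_series A f $ n = embed_elem A (f n)"
  by (simp add: embed_series_def)

context complex_algebra
begin

lemma component_embed:
  assumes "a \<in> carrier A" "complex_algebra B"
  shows "component B (embed_elem A a) = (if B = A then a else \<zero>\<^bsub>B\<^esub>)"
  unfolding embed_elem_def
proof (rule component_pointwise[OF _ assms(2)])
  fix B :: "'a complex_algebra" assume "complex_algebra B"
  then interpret B: complex_algebra B .
  show "(if B = A then a else \<zero>\<^bsub>B\<^esub>) \<in> carrier B" using assms by simp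
qed

lemma component_embed_same [simp]: "a \<in> carrier A \<Longrightarrow> component A (embed_elem A a) = a"
  by (simp add: component_embed complex_algebra_axioms)

lemma embed_inject: "a \<in> carrier A \<Longrightarrow> b \<in> carrier A \<Longrightarrow> embed_elem A a = embed_elem A b \<longleftrightarrow> a = b"
  using component_embed_same by metis

lemma embed_hom:
  assumes "a \<in> carrier A" "b \<in> carrier A"
  shows "embed_elem A (a \<oplus> b) = embed_elem A a + embed_elem A b" (is "?s = ?s'")
    and "embed_elem A (a \<otimes> b) = embed_elem A a * embed_elem A b" (is "?p = ?p'")
proof -
  have "component B ?s = component B ?s' \<and> component B ?p = component B ?p'" if "complex_algebra B" for B
  proof -
    interpret B: complex_algebra B by fact
    show ?thesis using assms that by (simp add: component_hom component_embed)
  qed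
  then show "?s = ?s'" "?p = ?p'"
    by (auto intro: ambient_eqI)
qed

lemma embed_smult:
  assumes "a \<in> carrier A"
  shows "embed_elem A (c \<odot> a) = c *\<^sub>C embed_elem A a"
proof (rule ambient_eqI)
  fix B :: "'a complex_algebra" assume B: "complex_algebra B"
  then interpret B: complex_algebra B .
  show "component B (embed_elem A (c \<odot> a)) = component B (c *\<^sub>C embed_elem A a)"
    using assms B by (simp add: component_hom component_embed)
qed

lemma embed_zero: "embed_elem A \<zero> = 0"
  using embed_hom(1)[of \<zero> \<zero>] by simp

lemma embed_finsum:
  assumes "\<And>i. i \<in> I \<Longrightarrow> f i \<in> carrier A"
  shows "embed_elem A (finsum A f I) = (\<Sum>i\<in>I. embed_elem A (f i))"
  using assms
proof (induction I rule: infinite_finite_induct)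
  case (insert i I)
  then have "embed_elem A (f i \<oplus> finsum A f I) = embed_elem A (f i) + (\<Sum>i\<in>I. embed_elem A (f i))"
    by (subst embed_hom) (auto intro!: finsum_closed)
  then show ?case using insert by (simp add: finsum_insert Pi_iff)
qed (simp_all add: embed_zero finsum_infinite)

lemma embed_corner: "a \<in> carrier A \<Longrightarrow> embed_elem A a \<in> corner (embed_elem A \<one>)"
  by (simp add: corner_def flip: embed_hom(2))

text \<open>The corner of the idempotent \<open>embed_elem A \<one>\<close> is the factor \<open>A\<close>, because all other components of this
  idempotent vanish.  This is how solutions of equations found in the ambient ring are brought back.\<close>
lemma corner_embed:
  assumes "x \<in> corner (embed_elem A \<one>)"
  shows "embed_elem A (component A x) = x"
proof (rule ambient_eqI)
  fix B :: "'a complex_algebra" assume B: "complex_algebra B"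
  then interpret B: complex_algebra B .
  have "component B (embed_elem A \<one> * x) = component B x"
    using assms by (simp add: corner_def)
  then show "component B (embed_elem A (component A x)) = component B x"
    using B component_closed[OF complex_algebra_axioms, of x] component_closed[OF B, of x]
    by (auto simp: component_hom component_embed split: if_splits)
qed

abbreviation "\<S> \<equiv> series_algebra A"

lemma embed_series_inject:
  assumes "f \<in> carrier \<S>" "h \<in> carrier \<S>"
  shows "embed_series A f = embed_series A h \<longleftrightarrow> f = h"
  using assms by (auto simp: fps_eq_iff series_algebra_def embed_inject fun_eq_iff)

lemma corner_embed_series:
  assumes "\<And>n. f $ n \<in> corner (embed_elem A \<one>)"
  obtains h where "h \<in> carrier \<S>" "embed_series A h = f"
proof (rule that[of "\<lambda>n. component A (f $ n)"])
  show "(\<lambda>n. component A (f $ n)) \<in> carrier \<S>"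
    by (simp add: series_algebra_def component_closed complex_algebra_axioms)
  show "embed_series A (\<lambda>n. component A (f $ n)) = f"
    using assms by (simp add: fps_eq_iff corner_embed)
qed

lemma embed_series_corner: "f \<in> carrier \<S> \<Longrightarrow> embed_series A f $ n \<in> corner (embed_elem A \<one>)"
  by (simp add: series_algebra_def embed_corner)

lemma series_algebra_closed:
  "f \<in> carrier \<S> \<Longrightarrow> h \<in> carrier \<S>
    \<Longrightarrow> f \<otimes>\<^bsub>\<S>\<^esub> h \<in> carrier \<S>"
  "f \<in> carrier \<S> \<Longrightarrow> c \<odot>\<^bsub>\<S>\<^esub> f \<in> carrier \<S>"
  "f \<in> carrier \<S> \<Longrightarrow> series_subst A \<epsilon> a f \<in> carrier \<S>"
  "\<one>\<^bsub>\<S>\<^esub> \<in> carrier \<S>"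
  "\<zero>\<^bsub>\<S>\<^esub> \<in> carrier \<S>"
  by (auto simp: series_algebra_def series_subst_def intro!: finsum_closed)

lemma embed_series_hom:
  assumes "f \<in> carrier \<S>" "h \<in> carrier \<S>"
  shows "embed_series A (f \<oplus>\<^bsub>\<S>\<^esub> h) = embed_series A f + embed_series A h"
    and "embed_series A (f \<otimes>\<^bsub>\<S>\<^esub> h) = embed_series A f * embed_series A h"
  using assms by (auto simp: fps_eq_iff series_algebra_def embed_hom fps_mult_nth embed_finsum atLeast0AtMost)

lemma embed_series_smult:
  "f \<in> carrier \<S> \<Longrightarrow>
    embed_series A (c \<odot>\<^bsub>\<S>\<^esub> f) = c *\<^sub>C embed_series A f"
  by (auto simp: fps_eq_iff series_algebra_def embed_smult)

lemma embed_series_one: "embed_series A \<one>\<^bsub>\<S>\<^esub> = fps_const (embed_elem A \<one>)"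
  by (auto simp: fps_eq_iff series_algebra_def embed_zero)

lemma embed_series_zero: "embed_series A \<zero>\<^bsub>\<S>\<^esub> = 0"
  by (auto simp: fps_eq_iff series_algebra_def embed_zero)

lemma embed_series_subst:
  assumes "f \<in> carrier \<S>" "\<epsilon> \<noteq> 0"
  shows "embed_series A (series_subst A \<epsilon> a f) = substitute (inverse_linear \<epsilon> a) (embed_series A f)"
  using assms by (auto simp: fps_eq_iff series_algebra_def series_subst_def substitute_nth embed_finsum embed_smult
      fls_nth_inverse_linear_power)

lemma series_algebra_abelian_monoid: "abelian_monoid \<S>"
  by (rule abelian_monoidI) (auto simp: series_algebra_def a_ac)

lemma embed_series_finsum:
  assumes "\<And>i. i \<in> I \<Longrightarrow> f i \<in> carrier \<S>"
  shows "embed_series A (finsum \<S> f I) = (\<Sum>i\<in>I. embed_series A (f i))"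
    "finsum \<S> f I \<in> carrier \<S>"
proof -
  interpret S: abelian_monoid \<S> by (rule series_algebra_abelian_monoid)
  show closed: "finsum \<S> f I \<in> carrier \<S>"
    using assms by (intro S.finsum_closed) auto
  show "embed_series A (finsum \<S> f I) = (\<Sum>i\<in>I. embed_series A (f i))"
    using assms
  proof (induction I rule: infinite_finite_induct)
    case (insert i I)
    then have "embed_series A (f i \<oplus>\<^bsub>\<S>\<^esub> finsum \<S> f I) = embed_series A (f i) + (\<Sum>i\<in>I. embed_series A (f i))"
      by (subst embed_series_hom) (auto intro!: S.finsum_closed)
    then show ?case using insert by (simp add: S.finsum_insert Pi_iff)
  qed (simp_all add: embed_series_zero S.finsum_infinite)
qed

end

section \<open>Quotients, tensor products and free algebras\<close>

context complex_algebra
begin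

lemma coset_add_left:
  assumes "ideal I A" "i \<in> I" "x \<in> carrier A"
  shows "I +> (i \<oplus> x) = I +> x"
proof -
  interpret ideal I A by fact
  have "I +> (i \<oplus> x) = (I +> i) +> x"
    using assms a_subset by (intro a_coset_add_assoc[symmetric]) auto
  then show ?thesis
    using assms by (simp add: a_rcos_zero)
qed

lemma coset_eqI:
  assumes "ideal I A" "x \<in> carrier A" "y \<in> carrier A" "x \<ominus> y \<in> I"
  shows "I +> x = I +> y"
  using coset_add_left[OF assms(1,4,3)] assms by (simp add: minus_eq a_assoc l_neg)

lemma ideal_smult_closed:
  assumes "ideal I A" "i \<in> I"
  shows "c \<odot> i \<in> I"
proof -
  interpret ideal I A by fact
  have "(c \<odot> \<one>) \<otimes> i \<in> I"
    using assms by (intro I_l_closed) auto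
  then show ?thesis
    using assms by (simp add: smult_mult_left)
qed

lemma quotient_algebra_simps:
  assumes I: "ideal I A"
  shows "carrier (quotient_algebra A I) = (\<lambda>x. I +> x) ` carrier A"
    and "\<zero>\<^bsub>quotient_algebra A I\<^esub> = I +> \<zero>"
    and "\<one>\<^bsub>quotient_algebra A I\<^esub> = I +> \<one>"
    and "x \<in> carrier A \<Longrightarrow> y \<in> carrier A \<Longrightarrow> (I +> x) \<oplus>\<^bsub>quotient_algebra A I\<^esub> (I +> y) = I +> (x \<oplus> y)"
    and "x \<in> carrier A \<Longrightarrow> y \<in> carrier A \<Longrightarrow> (I +> x) \<otimes>\<^bsub>quotient_algebra A I\<^esub> (I +> y) = I +> (x \<otimes> y)"
    and "x \<in> carrier A \<Longrightarrow> c \<odot>\<^bsub>quotient_algebra A I\<^esub> (I +> x) = I +> (c \<odot> x)"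
proof -
  interpret ideal I A by fact
  show "carrier (quotient_algebra A I) = (\<lambda>x. I +> x) ` carrier A"
    by (auto simp: quotient_algebra_def FactRing_def A_RCOSETS_def')
  show "\<zero>\<^bsub>quotient_algebra A I\<^esub> = I +> \<zero>"
    using a_rcos_const[of "\<zero>"] by (simp add: quotient_algebra_def FactRing_def)
  show "\<one>\<^bsub>quotient_algebra A I\<^esub> = I +> \<one>"
    by (simp add: quotient_algebra_def FactRing_def)
  show "(I +> x) \<oplus>\<^bsub>quotient_algebra A I\<^esub> (I +> y) = I +> (x \<oplus> y)" if "x \<in> carrier A" "y \<in> carrier A"
    using that by (simp add: quotient_algebra_def FactRing_def a_rcos_sum)
  show "(I +> x) \<otimes>\<^bsub>quotient_algebra A I\<^esub> (I +> y) = I +> (x \<otimes> y)" if "x \<in> carrier A" "y \<in> carrier A"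
    using that by (simp add: quotient_algebra_def FactRing_def rcoset_mult_add)
  show "c \<odot>\<^bsub>quotient_algebra A I\<^esub> (I +> x) = I +> (c \<odot> x)" if x: "x \<in> carrier A"
  proof -
    have "I +> (c \<odot> b) = I +> (c \<odot> x)" if b: "b \<in> I +> x" for b
    proof -
      obtain i where i: "i \<in> I" "b = i \<oplus> x"
        using b by (auto simp: a_r_coset_def')
      then show ?thesis
        using x by (simp add: smult_r_distr coset_add_left I ideal_smult_closed)
    qed
    then have "(\<Union>b\<in>I +> x. I +> (c \<odot> b)) = (\<Union>b\<in>I +> x. I +> (c \<odot> x))"
      by (intro SUP_cong refl)
    also have "\<dots> = I +> (c \<odot> x)"
      using a_rcos_self[OF x] by blast
    finally show ?thesis
      by (simp only: quotient_algebra_def module.simps)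
  qed
qed

lemma quotient_algebra_complex_algebra:
  assumes "ideal I A"
  shows "complex_algebra (quotient_algebra A I)"
  by (rule complex_algebra_image[OF complex_algebra_axioms, where h="\<lambda>x. I +> x"])
    (simp_all add: quotient_algebra_simps[OF assms])

end

locale tensor_product = A: complex_algebra A + B: complex_algebra B for A :: "'a complex_algebra" and B :: "'b complex_algebra"
begin

abbreviation "\<P> \<equiv> pair_algebra A B"
abbreviation "\<T> \<equiv> tensor_algebra A B"

sublocale P: complex_algebra \<P>
  unfolding pair_algebra_def
  by (intro monoid_algebra_complex_algebra DirProd_monoid A.monoid_axioms B.monoid_axioms)

lemma single_in_pair_algebra [simp]:
  "a \<in> carrier A \<Longrightarrow> b \<in> carrier B \<Longrightarrow> single (a, b) c \<in> carrier \<P>"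
  by (simp add: pair_algebra_def monoid_algebra_simps)

lemma pair_algebra_minus:
  assumes "x \<in> carrier \<P>" "y \<in> carrier \<P>"
  shows "x \<ominus>\<^bsub>\<P>\<^esub> y = x - y"
proof -
  have "\<ominus>\<^bsub>\<P>\<^esub> y = - y"
    by (rule P.minus_equality) (use assms in \<open>simp_all add: pair_algebra_def monoid_algebra_simps\<close>)
  then show ?thesis
    by (simp add: a_minus_def pair_algebra_def monoid_algebra_simps)
qed

lemma bilinearity_relations_closed: "bilinearity_relations A B \<subseteq> carrier \<P>"
proof -
  have minus: "x - y \<in> carrier \<P>" if "x \<in> carrier \<P>" "y \<in> carrier \<P>" for x y
    using that pair_algebra_minus[OF that] P.minus_closed[OF that] by simp
  show ?thesis
    unfolding bilinearity_relations_def by (auto intro!: minus)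
qed

lemma bilinearity_ideal: "ideal (bilinearity_ideal A B) \<P>"
  unfolding bilinearity_ideal_def by (rule P.genideal_ideal[OF bilinearity_relations_closed])

sublocale T: complex_algebra \<T>
  unfolding tensor_algebra_def by (rule P.quotient_algebra_complex_algebra[OF bilinearity_ideal])

lemma pure_tensor_closed [simp, intro]:
  "a \<in> carrier A \<Longrightarrow> b \<in> carrier B \<Longrightarrow> pure_tensor A B a b \<in> carrier \<T>"
  by (simp add: tensor_algebra_def pure_tensor_def P.quotient_algebra_simps[OF bilinearity_ideal])

lemma tensor_coset_eqI:
  assumes "x - y \<in> bilinearity_relations A B" "x \<in> carrier \<P>" "y \<in> carrier \<P>"
  shows "bilinearity_ideal A B +>\<^bsub>\<P>\<^esub> x = bilinearity_ideal A B +>\<^bsub>\<P>\<^esub> y"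
proof (rule P.coset_eqI[OF bilinearity_ideal assms(2,3)])
  show "x \<ominus>\<^bsub>\<P>\<^esub> y \<in> bilinearity_ideal A B"
    unfolding pair_algebra_minus[OF assms(2,3)] bilinearity_ideal_def
    using assms(1) P.genideal_self[OF bilinearity_relations_closed] by blast
qed

lemma pure_tensor_add_left:
  assumes "a \<in> carrier A" "a' \<in> carrier A" "b \<in> carrier B"
  shows "pure_tensor A B (a \<oplus>\<^bsub>A\<^esub> a') b = pure_tensor A B a b \<oplus>\<^bsub>\<T>\<^esub> pure_tensor A B a' b"
proof -
  have "pure_tensor A B (a \<oplus>\<^bsub>A\<^esub> a') b = bilinearity_ideal A B +>\<^bsub>\<P>\<^esub>
      (single (a, b) 1 \<oplus>\<^bsub>\<P>\<^esub> single (a', b) 1)"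
    unfolding pure_tensor_def
  proof (rule tensor_coset_eqI)
    show "single (a \<oplus>\<^bsub>A\<^esub> a', b) 1 -
        (single (a, b) 1 \<oplus>\<^bsub>\<P>\<^esub> single (a', b) 1) \<in> bilinearity_relations A B"
      unfolding bilinearity_relations_def pair_algebra_def monoid_algebra_simps diff_diff_eq[symmetric]
      using assms by blast
  qed (use assms in auto)
  then show ?thesis
    using assms by (simp add: pure_tensor_def tensor_algebra_def P.quotient_algebra_simps[OF bilinearity_ideal])
qed

lemma pure_tensor_add_right:
  assumes "a \<in> carrier A" "b \<in> carrier B" "b' \<in> carrier B"
  shows "pure_tensor A B a (b \<oplus>\<^bsub>B\<^esub> b') = pure_tensor A B a b \<oplus>\<^bsub>\<T>\<^esub> pure_tensor A B a b'"
proof -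
  have "pure_tensor A B a (b \<oplus>\<^bsub>B\<^esub> b') = bilinearity_ideal A B +>\<^bsub>\<P>\<^esub>
      (single (a, b) 1 \<oplus>\<^bsub>\<P>\<^esub> single (a, b') 1)"
    unfolding pure_tensor_def
  proof (rule tensor_coset_eqI)
    show "single (a, b \<oplus>\<^bsub>B\<^esub> b') 1 -
        (single (a, b) 1 \<oplus>\<^bsub>\<P>\<^esub> single (a, b') 1) \<in> bilinearity_relations A B"
      unfolding bilinearity_relations_def pair_algebra_def monoid_algebra_simps diff_diff_eq[symmetric]
      using assms by blast
  qed (use assms in auto)
  then show ?thesis
    using assms by (simp add: pure_tensor_def tensor_algebra_def P.quotient_algebra_simps[OF bilinearity_ideal])
qed

lemma pure_tensor_smult:
  assumes "a \<in> carrier A" "b \<in> carrier B"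
  shows "pure_tensor A B (c \<odot>\<^bsub>A\<^esub> a) b = c \<odot>\<^bsub>\<T>\<^esub> pure_tensor A B a b" (is ?left)
    "pure_tensor A B a (c \<odot>\<^bsub>B\<^esub> b) = c \<odot>\<^bsub>\<T>\<^esub> pure_tensor A B a b" (is ?right)
proof -
  have "c \<odot>\<^bsub>\<T>\<^esub> pure_tensor A B a b
      = bilinearity_ideal A B +>\<^bsub>\<P>\<^esub> single (a, b) c"
    using assms by (simp add: pure_tensor_def tensor_algebra_def P.quotient_algebra_simps[OF bilinearity_ideal])
      (simp add: pair_algebra_def monoid_algebra_simps scale_mapping_simps)
  moreover have "pure_tensor A B (c \<odot>\<^bsub>A\<^esub> a) b = bilinearity_ideal A B +>\<^bsub>\<P>\<^esub> single (a, b) c"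
    unfolding pure_tensor_def
    by (rule tensor_coset_eqI) (use assms in \<open>auto simp: bilinearity_relations_def\<close>)
  moreover have "pure_tensor A B a (c \<odot>\<^bsub>B\<^esub> b) = bilinearity_ideal A B +>\<^bsub>\<P>\<^esub> single (a, b) c"
    unfolding pure_tensor_def
    by (rule tensor_coset_eqI) (use assms in \<open>auto simp: bilinearity_relations_def\<close>)
  ultimately show ?left ?right
    by simp_all
qed

lemma pure_tensor_mult:
  assumes "a \<in> carrier A" "a' \<in> carrier A" "b \<in> carrier B" "b' \<in> carrier B"
  shows "pure_tensor A B a b \<otimes>\<^bsub>\<T>\<^esub> pure_tensor A B a' b' = pure_tensor A B (a \<otimes>\<^bsub>A\<^esub> a') (b \<otimes>\<^bsub>B\<^esub> b')"
  using assms by (simp add: pure_tensor_def tensor_algebra_def P.quotient_algebra_simps[OF bilinearity_ideal])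
    (simp add: pair_algebra_def monoid_algebra_simps)

lemma tensor_one: "\<one>\<^bsub>\<T>\<^esub> = pure_tensor A B \<one>\<^bsub>A\<^esub> \<one>\<^bsub>B\<^esub>"
  by (simp add: tensor_algebra_def pure_tensor_def P.quotient_algebra_simps[OF bilinearity_ideal])
    (simp add: pair_algebra_def monoid_algebra_simps DirProd_def)

definition embed_left :: "'a ambient \<Rightarrow> ('a \<times> 'b \<Rightarrow>\<^sub>0 complex) set ambient" where
  "embed_left x = embed_elem \<T> (pure_tensor A B (component A x) \<one>\<^bsub>B\<^esub>)"

definition embed_right :: "'b ambient \<Rightarrow> ('a \<times> 'b \<Rightarrow>\<^sub>0 complex) set ambient" where
  "embed_right x = embed_elem \<T> (pure_tensor A B \<one>\<^bsub>A\<^esub> (component B x))"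

lemmas [simp] = component_closed[OF A.complex_algebra_axioms] component_closed[OF B.complex_algebra_axioms]

lemma embed_left_hom: "complex_ring_hom embed_left"
  by unfold_locales
    (simp_all add: embed_left_def component_hom A.complex_algebra_axioms pure_tensor_add_left pure_tensor_smult
      T.embed_smult flip: T.embed_hom, simp_all add: pure_tensor_mult)

lemma embed_right_hom: "complex_ring_hom embed_right"
  by unfold_locales
    (simp_all add: embed_right_def component_hom B.complex_algebra_axioms pure_tensor_add_right pure_tensor_smult
      T.embed_smult flip: T.embed_hom, simp_all add: pure_tensor_mult)

lemma embed_pure_tensor:
  "embed_left x * embed_right y = embed_elem \<T> (pure_tensor A B (component A x) (component B y))"
  "embed_right y * embed_left x = embed_elem \<T> (pure_tensor A B (component A x) (component B y))"
  by (simp_all add: embed_left_def embed_right_def pure_tensor_mult flip: T.embed_hom)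

lemma embed_left_right_one:
  "embed_left (embed_elem A \<one>\<^bsub>A\<^esub>) = embed_elem \<T> \<one>\<^bsub>\<T>\<^esub>"
  "embed_right (embed_elem B \<one>\<^bsub>B\<^esub>) = embed_elem \<T> \<one>\<^bsub>\<T>\<^esub>"
  by (simp_all add: embed_left_def embed_right_def tensor_one)

lemma tensor_subspace_is_subspace:
  assumes "U \<subseteq> carrier A" "V \<subseteq> carrier B"
  shows "is_subspace (tensor_subspace A B U V) \<T>"
    and "a \<in> U \<Longrightarrow> b \<in> V \<Longrightarrow> pure_tensor A B a b \<in> tensor_subspace A B U V"
proof -
  have S: "{pure_tensor A B a b | a b. a \<in> U \<and> b \<in> V} \<subseteq> carrier \<T>"
    using assms by auto
  show "is_subspace (tensor_subspace A B U V) \<T>"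
    unfolding tensor_subspace_def by (rule T.spanned_subspace_is_subspace[OF S])
  show "a \<in> U \<Longrightarrow> b \<in> V \<Longrightarrow> pure_tensor A B a b \<in> tensor_subspace A B U V"
    unfolding tensor_subspace_def using T.spanned_subspace_is_subspace(2)[OF S] by auto
qed

lemma tensor_subspace_mult_closed:
  assumes "is_subalgebra U A" "is_subalgebra V B"
    and x: "x \<in> tensor_subspace A B U V" "y \<in> tensor_subspace A B U V"
  shows "x \<otimes>\<^bsub>\<T>\<^esub> y \<in> tensor_subspace A B U V"
proof -
  have UV: "U \<subseteq> carrier A" "V \<subseteq> carrier B"
    using assms by (auto dest!: is_subalgebraD(1) is_subspaceD(1))
  show ?thesis
    using x unfolding tensor_subspace_def
  proof (rule T.spanned_subspace_mult_closed[rotated 2])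
    fix s s' assume "s \<in> {pure_tensor A B a b | a b. a \<in> U \<and> b \<in> V}" "s' \<in> {pure_tensor A B a b | a b. a \<in> U \<and> b \<in> V}"
    then obtain a b a' b' where s: "s = pure_tensor A B a b" "s' = pure_tensor A B a' b'"
      and mem: "a \<in> U" "b \<in> V" "a' \<in> U" "b' \<in> V"
      by blast
    have "s \<otimes>\<^bsub>\<T>\<^esub> s' = pure_tensor A B (a \<otimes>\<^bsub>A\<^esub> a') (b \<otimes>\<^bsub>B\<^esub> b')"
      unfolding s by (rule pure_tensor_mult) (use mem UV in blast)+
    moreover have "a \<otimes>\<^bsub>A\<^esub> a' \<in> U" "b \<otimes>\<^bsub>B\<^esub> b' \<in> V"
      using mem is_subalgebraD(3)[OF assms(1)] is_subalgebraD(3)[OF assms(2)] by simp_all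
    ultimately show "s \<otimes>\<^bsub>\<T>\<^esub> s' \<in> {pure_tensor A B a b | a b. a \<in> U \<and> b \<in> V}"
      by blast
  qed (use UV in auto)
qed

end

text \<open>The value of a noncommutative polynomial in a ring with complex scalars; \<open>e\<close> is the value of the
  empty word.\<close>

definition word_value :: "('g \<Rightarrow> 'a::complex_ring) \<Rightarrow> 'a \<Rightarrow> 'g list \<Rightarrow> 'a" where
  "word_value \<Phi> e w = foldr (\<lambda>g x. \<Phi> g * x) w e"

definition polynomial_value :: "('g \<Rightarrow> 'a::complex_ring) \<Rightarrow> 'a \<Rightarrow> ('g list \<Rightarrow>\<^sub>0 complex) \<Rightarrow> 'a" where
  "polynomial_value \<Phi> e p = (\<Sum>w\<in>support p. coefficient p w *\<^sub>C word_value \<Phi> e w)"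

lemma polynomial_value_add: "polynomial_value \<Phi> e (p + q) = polynomial_value \<Phi> e p + polynomial_value \<Phi> e q"
proof -
  let ?K = "support p \<union> support q"
  have "polynomial_value \<Phi> e r = (\<Sum>w\<in>?K. coefficient r w *\<^sub>C word_value \<Phi> e w)" if "support r \<subseteq> ?K" for r
    unfolding polynomial_value_def by (rule sum.mono_neutral_left) (use that in \<open>auto simp: in_keys_iff\<close>)
  then show ?thesis
    using keys_add[of p q] by (simp add: lookup_add scaleC_add_left sum.distrib)
qed

lemma polynomial_value_single: "polynomial_value \<Phi> e (single w c) = c *\<^sub>C word_value \<Phi> e w"
  by (simp add: polynomial_value_def)

lemma polynomial_value_zero: "polynomial_value \<Phi> e 0 = 0"
  by (simp add: polynomial_value_def)

lemma polynomial_value_diff: "polynomial_value \<Phi> e (p - q) = polynomial_value \<Phi> e p - polynomial_value \<Phi> e q"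
  using polynomial_value_add[of \<Phi> e "p - q" q] by simp

lemma polynomial_value_sum: "polynomial_value \<Phi> e (\<Sum>i\<in>I. F i) = (\<Sum>i\<in>I. polynomial_value \<Phi> e (F i))"
  by (induction I rule: infinite_finite_induct) (auto simp: polynomial_value_add polynomial_value_zero)

lemma polynomial_value_scale: "polynomial_value \<Phi> e (scale_mapping c p) = c *\<^sub>C polynomial_value \<Phi> e p"
proof -
  have "support p \<subseteq> UNIV" by simp
  then show ?thesis
    by (induction p rule: poly_mapping_single_induct)
      (simp_all add: scale_mapping_simps polynomial_value_add polynomial_value_zero polynomial_value_single
        scaleC_add_right scaleC_scaleC)
qed

lemma word_value_append:
  assumes "e \<in> corner e" "\<And>g. g \<in> G \<Longrightarrow> \<Phi> g \<in> corner e" "w \<in> lists G" "w' \<in> lists G"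
  shows "word_value \<Phi> e (w @ w') = word_value \<Phi> e w * word_value \<Phi> e w'" "word_value \<Phi> e w' \<in> corner e"
proof -
  show corner: "word_value \<Phi> e w' \<in> corner e"
    using assms(4) by (induction w') (auto simp: word_value_def assms corner_closed)
  show "word_value \<Phi> e (w @ w') = word_value \<Phi> e w * word_value \<Phi> e w'"
    using assms(3) corner by (induction w) (auto simp: word_value_def corner_unit mult.assoc)
qed

abbreviation word_monoid :: "'g set \<Rightarrow> 'g list monoid" where
  "word_monoid G \<equiv> \<lparr>carrier = lists G, monoid.mult = (@), one = []\<rparr>"

lemma polynomial_value_convolution:
  assumes e: "e \<in> corner e" "\<And>g. g \<in> G \<Longrightarrow> \<Phi> g \<in> corner e"
    and p: "support p \<subseteq> lists G" and q: "support q \<subseteq> lists G"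
  shows "polynomial_value \<Phi> e (convolution (word_monoid G) p q) = polynomial_value \<Phi> e p * polynomial_value \<Phi> e q"
  using p
proof (induction p rule: poly_mapping_single_induct)
  case (add p x a)
  have "polynomial_value \<Phi> e (convolution (word_monoid G) (single x a) q)
      = polynomial_value \<Phi> e (single x a) * polynomial_value \<Phi> e q"
    using q
    by (induction q rule: poly_mapping_single_induct)
      (simp_all add: convolution_add_right polynomial_value_add polynomial_value_zero polynomial_value_single
        word_value_append[OF e \<open>x \<in> lists G\<close>] scaleC_mult_left scaleC_mult_right scaleC_scaleC distrib_left mult.commute[of a])
  then show ?case
    using add by (simp add: convolution_add_left polynomial_value_add distrib_right)
qed (simp add: polynomial_value_zero)

lemma free_algebra_complex_algebra: "complex_algebra (free_algebra G)"
  unfolding free_algebra_def by (intro monoid_algebra_complex_algebra monoidI) auto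

context complex_algebra
begin

lemma free_eval_closed:
  assumes "\<And>g. g \<in> G \<Longrightarrow> \<phi> g \<in> carrier A" "p \<in> carrier (free_algebra G)"
  shows "free_eval A \<phi> p \<in> carrier A"
    and "embed_elem A (free_eval A \<phi> p) = polynomial_value (\<lambda>g. embed_elem A (\<phi> g)) (embed_elem A \<one>) p"
proof -
  have word: "foldr (\<lambda>g x. \<phi> g \<otimes> x) w \<one> \<in> carrier A
     \<and> embed_elem A (foldr (\<lambda>g x. \<phi> g \<otimes> x) w \<one>) = word_value (\<lambda>g. embed_elem A (\<phi> g)) (embed_elem A \<one>) w"
    if "w \<in> lists G" for w
    using that by (induction w) (auto simp: word_value_def assms(1) embed_hom)
  have keys: "w \<in> lists G" if "w \<in> support p" for w
    using assms(2) that by (auto simp: free_algebra_def monoid_algebra_simps)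
  show "free_eval A \<phi> p \<in> carrier A"
    unfolding free_eval_def using word keys by (intro finsum_closed) auto
  show "embed_elem A (free_eval A \<phi> p) = polynomial_value (\<lambda>g. embed_elem A (\<phi> g)) (embed_elem A \<one>) p"
    unfolding free_eval_def polynomial_value_def
    using word keys by (subst embed_finsum) (auto simp: embed_smult)
qed

text \<open>Evaluation is compared with elements of \<open>A\<close> inside the ambient ring.\<close>
lemma free_eval_eqI:
  assumes \<phi>: "\<And>g. g \<in> G \<Longrightarrow> \<phi> g \<in> carrier A"
    and "p \<in> carrier (free_algebra G)" "b \<in> carrier A"
    and "polynomial_value (\<lambda>g. embed_elem A (\<phi> g)) (embed_elem A \<one>) p = embed_elem A b"
  shows "free_eval A \<phi> p = b"
  using assms(4) embed_inject[OF free_eval_closed(1)[OF assms(1,2)] assms(3)]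
    free_eval_closed(2)[OF assms(1,2)] by simp

lemma free_eval_hom:
  assumes \<phi>: "\<And>g. g \<in> G \<Longrightarrow> \<phi> g \<in> carrier A"
    and p: "p \<in> carrier (free_algebra G)" and q: "q \<in> carrier (free_algebra G)"
  shows "free_eval A \<phi> (p \<oplus>\<^bsub>free_algebra G\<^esub> q) = free_eval A \<phi> p \<oplus> free_eval A \<phi> q"
    and "free_eval A \<phi> (p \<otimes>\<^bsub>free_algebra G\<^esub> q) = free_eval A \<phi> p \<otimes> free_eval A \<phi> q"
proof -
  interpret F: complex_algebra "free_algebra G" by (rule free_algebra_complex_algebra)
  have keys: "support p \<subseteq> lists G" "support q \<subseteq> lists G"
    using p q by (auto simp: free_algebra_def monoid_algebra_simps)
  note closed = free_eval_closed(1)[OF \<phi> p] free_eval_closed(1)[OF \<phi> q]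
    and eval = free_eval_closed(2)[OF \<phi> p] free_eval_closed(2)[OF \<phi> q]
  show "free_eval A \<phi> (p \<oplus>\<^bsub>free_algebra G\<^esub> q) = free_eval A \<phi> p \<oplus> free_eval A \<phi> q"
    by (rule free_eval_eqI[where G=G, OF \<phi>]) (use p q in \<open>simp_all add: closed eval embed_hom\<close>,
        simp add: free_algebra_def monoid_algebra_simps polynomial_value_add)
  show "free_eval A \<phi> (p \<otimes>\<^bsub>free_algebra G\<^esub> q) = free_eval A \<phi> p \<otimes> free_eval A \<phi> q"
    by (rule free_eval_eqI[where G=G, OF \<phi>]) (use p q in \<open>simp_all add: closed eval embed_hom\<close>,
        simp add: free_algebra_def monoid_algebra_simps polynomial_value_convolution[where G=G] embed_corner \<phi> keys)
qed

lemma free_eval_smult: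
  assumes \<phi>: "\<And>g. g \<in> G \<Longrightarrow> \<phi> g \<in> carrier A" and p: "p \<in> carrier (free_algebra G)"
  shows "free_eval A \<phi> (c \<odot>\<^bsub>free_algebra G\<^esub> p) = c \<odot> free_eval A \<phi> p"
proof -
  interpret F: complex_algebra "free_algebra G" by (rule free_algebra_complex_algebra)
  show ?thesis
    by (rule free_eval_eqI[where G=G, OF \<phi>])
      (use p in \<open>simp_all add: free_eval_closed(1)[OF \<phi> p] free_eval_closed(2)[OF \<phi> p] embed_smult\<close>,
        simp add: free_algebra_def monoid_algebra_simps polynomial_value_scale)
qed

lemma free_eval_one:
  assumes \<phi>: "\<And>g. g \<in> G \<Longrightarrow> \<phi> g \<in> carrier A"
  shows "free_eval A \<phi> \<one>\<^bsub>free_algebra G\<^esub> = \<one>"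
proof -
  interpret F: complex_algebra "free_algebra G" by (rule free_algebra_complex_algebra)
  show ?thesis
    by (rule free_eval_eqI[where G=G, OF \<phi>])
      (simp_all, simp add: free_algebra_def monoid_algebra_simps polynomial_value_single word_value_def)
qed

end

text \<open>A homomorphism that vanishes on the generators of an ideal is constant on cosets.\<close>

lemma the_elem_image_coset:
  assumes "ring A" "ring B" and hom: "h \<in> ring_hom A B" and S: "S \<subseteq> carrier A" "\<And>s. s \<in> S \<Longrightarrow> h s = \<zero>\<^bsub>B\<^esub>"
    and p: "p \<in> carrier A"
  shows "the_elem (h ` (Idl\<^bsub>A\<^esub> S +>\<^bsub>A\<^esub> p)) = h p"
proof -
  interpret h: ring_hom_ring A B h
    by (rule ring_hom_ringI2[OF assms(1,2) hom])
  have "S \<subseteq> a_kernel A B h"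
    using S unfolding a_kernel_def' by blast
  then have kernel: "Idl\<^bsub>A\<^esub> S \<subseteq> a_kernel A B h"
    by (rule h.R.genideal_minimal[OF h.kernel_is_ideal])
  have "h x = h p" if mem: "x \<in> Idl\<^bsub>A\<^esub> S +>\<^bsub>A\<^esub> p" for x
  proof -
    obtain i where "i \<in> Idl\<^bsub>A\<^esub> S" and x: "x = i \<oplus>\<^bsub>A\<^esub> p"
      using mem unfolding a_r_coset_def' by blast
    then have i: "i \<in> carrier A" "h i = \<zero>\<^bsub>B\<^esub>"
      using kernel unfolding a_kernel_def' by blast+
    then show ?thesis
      using p by (simp only: x h.hom_add) (simp add: h.hom_closed)
  qed
  moreover have "p \<in> Idl\<^bsub>A\<^esub> S +>\<^bsub>A\<^esub> p"
    using abelian_subgroup.a_rcos_self[OF _ p]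
      ideal.axioms(1)[OF h.R.genideal_ideal[OF S(1)]] h.R.is_abelian_group abelian_subgroupI3 by blast
  ultimately have "h ` (Idl\<^bsub>A\<^esub> S +>\<^bsub>A\<^esub> p) = {h p}"
    by blast
  then show ?thesis by simp
qed

lemma keys_subset_closed:
  fixes p q :: "'k \<Rightarrow>\<^sub>0 complex"
  shows "support p \<subseteq> S \<Longrightarrow> support q \<subseteq> S \<Longrightarrow> support (p + q) \<subseteq> S"
    and "support p \<subseteq> S \<Longrightarrow> support q \<subseteq> S \<Longrightarrow> support (p - q) \<subseteq> S"
    and "x \<in> S \<Longrightarrow> support (single x c) \<subseteq> S"
  using keys_add[of p q] keys_diff[of p q] by (blast, blast, simp)

lemma keys_sum_subset:
  fixes F :: "'i \<Rightarrow> 'k \<Rightarrow>\<^sub>0 complex"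
  shows "(\<And>i. i \<in> I \<Longrightarrow> support (F i) \<subseteq> S) \<Longrightarrow> support (\<Sum>i\<in>I. F i) \<subseteq> S"
  by (induction I rule: infinite_finite_induct) (simp_all add: keys_subset_closed)

text \<open>The projection to a quotient of the free algebra is evaluation at the classes of the generators, as
  both are homomorphisms.  In particular these classes satisfy the relations that were imposed.\<close>
lemma embed_free_quotient:
  assumes I: "ideal I (free_algebra G)" and p: "p \<in> carrier (free_algebra G)"
  defines "Q \<equiv> quotient_algebra (free_algebra G) I" and "\<pi> \<equiv> \<lambda>p. I +>\<^bsub>free_algebra G\<^esub> p"
  shows "embed_elem Q (\<pi> p) = polynomial_value (\<lambda>x. embed_elem Q (\<pi> (single [x] 1))) (embed_elem Q \<one>\<^bsub>Q\<^esub>) p"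
proof -
  interpret F: complex_algebra "free_algebra G" by (rule free_algebra_complex_algebra)
  interpret Q: complex_algebra Q
    unfolding Q_def by (rule F.quotient_algebra_complex_algebra[OF I])
  have carrier: "q \<in> carrier (free_algebra G) \<longleftrightarrow> support q \<subseteq> lists G" for q
    by (simp add: free_algebra_def monoid_algebra_simps)
  have closed: "\<pi> q \<in> carrier Q" if "q \<in> carrier (free_algebra G)" for q
    using that by (simp add: Q_def \<pi>_def F.quotient_algebra_simps[OF I])
  have embed_add: "embed_elem Q (\<pi> (q + q')) = embed_elem Q (\<pi> q) + embed_elem Q (\<pi> q')"
    if "q \<in> carrier (free_algebra G)" "q' \<in> carrier (free_algebra G)" for q q'
  proof -
    have "\<pi> (q \<oplus>\<^bsub>free_algebra G\<^esub> q') = \<pi> q \<oplus>\<^bsub>Q\<^esub> \<pi> q'"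
      using that by (simp add: Q_def \<pi>_def F.quotient_algebra_simps[OF I])
    then show ?thesis
      using that by (simp add: Q.embed_hom closed free_algebra_def monoid_algebra_simps)
  qed
  have word: "embed_elem Q (\<pi> (single w 1))
      = word_value (\<lambda>x. embed_elem Q (\<pi> (single [x] 1))) (embed_elem Q \<one>\<^bsub>Q\<^esub>) w" if "w \<in> lists G" for w
    using that
  proof (induction w)
    case Nil
    have "\<one>\<^bsub>Q\<^esub> = \<pi> (single [] 1)"
      unfolding Q_def \<pi>_def F.quotient_algebra_simps(3)[OF I] by (simp add: free_algebra_def monoid_algebra_simps)
    then show ?case by (simp add: word_value_def)
  next
    case (Cons x w)
    then have xw: "single [x] 1 \<in> carrier (free_algebra G)" "single w 1 \<in> carrier (free_algebra G)"
      by (auto simp: carrier)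
    have "\<pi> (single [x] 1 \<otimes>\<^bsub>free_algebra G\<^esub> single w 1)
        = \<pi> (single [x] 1) \<otimes>\<^bsub>Q\<^esub> \<pi> (single w 1)"
      using xw by (simp add: Q_def \<pi>_def F.quotient_algebra_simps[OF I])
    also have "single [x] 1 \<otimes>\<^bsub>free_algebra G\<^esub> single w 1 = single (x # w) 1"
      by (simp add: free_algebra_def monoid_algebra_simps)
    finally show ?case
      using Cons xw by (simp add: Q.embed_hom closed word_value_def)
  qed
  have single: "embed_elem Q (\<pi> (single w c)) = c *\<^sub>C embed_elem Q (\<pi> (single w 1))"
    if "w \<in> lists G" for w c
  proof -
    have w: "single w 1 \<in> carrier (free_algebra G)"
      using that by (simp add: carrier)
    have "\<pi> (c \<odot>\<^bsub>free_algebra G\<^esub> single w 1) = c \<odot>\<^bsub>Q\<^esub> \<pi> (single w 1)"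
      using w by (simp add: Q_def \<pi>_def F.quotient_algebra_simps[OF I])
    also have "c \<odot>\<^bsub>free_algebra G\<^esub> single w 1 = single w c"
      by (simp add: free_algebra_def monoid_algebra_simps scale_mapping_simps)
    finally show ?thesis
      using w by (simp add: Q.embed_smult closed)
  qed
  have "support p \<subseteq> lists G"
    using p by (simp add: carrier)
  then show ?thesis
  proof (induction p rule: poly_mapping_single_induct)
    case zero
    have "\<pi> \<zero>\<^bsub>free_algebra G\<^esub> = \<zero>\<^bsub>Q\<^esub>"
      by (simp add: Q_def \<pi>_def F.quotient_algebra_simps(2)[OF I])
    then have "\<pi> 0 = \<zero>\<^bsub>Q\<^esub>"
      by (simp add: free_algebra_def monoid_algebra_simps)
    then show ?case
      by (simp add: Q.embed_zero polynomial_value_zero)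
  next
    case (add q w c)
    have "embed_elem Q (\<pi> (q + single w c)) = embed_elem Q (\<pi> q) + embed_elem Q (\<pi> (single w c))"
      by (rule embed_add) (use add.hyps in \<open>simp_all add: carrier\<close>)
    also have "\<dots> = embed_elem Q (\<pi> q) + c *\<^sub>C word_value (\<lambda>x. embed_elem Q (\<pi> (single [x] 1))) (embed_elem Q \<one>\<^bsub>Q\<^esub>) w"
      unfolding single[OF add.hyps(2), of c] word[OF add.hyps(2)] ..
    finally show ?case
      unfolding add.IH polynomial_value_add polynomial_value_single .
  qed
qed

section \<open>The extended Yangian and its coproduct\<close>

lemma polynomial_value_RTT_relation:
  assumes "e \<in> corner e" "\<And>x. x \<in> generators N \<Longrightarrow> \<Phi> x \<in> corner e"
    and ijkl: "i \<in> indices N" "j \<in> indices N" "k \<in> indices N" "l \<in> indices N"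
  shows "polynomial_value \<Phi> e (RTT_relation g N i j k l m s) = RTT_expr g N (\<lambda>i j. Abs_fps (\<lambda>r. \<Phi> (i, j, r))) i j k l m s"
proof -
  have "\<Phi> (a, b, r) * e = \<Phi> (a, b, r)" if "a \<in> indices N" "b \<in> indices N" for a b r
    using assms(2)[of "(a, b, r)"] that by (simp add: generators_def corner_unit)
  then show ?thesis
    using ijkl by (simp add: RTT_relation_def RTT_expr_def polynomial_value_sum polynomial_value_diff
        polynomial_value_single word_value_def cong: sum.cong)
qed

lemma polynomial_value_unit_relation:
  assumes "\<Phi> (i, j, 0) \<in> corner e"
  shows "polynomial_value \<Phi> e (unit_relation i j) = \<Phi> (i, j, 0) - (if i = j then e else 0)"
  using assms by (simp add: unit_relation_def polynomial_value_diff polynomial_value_single word_value_def corner_unit)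

lemma unit_relation_defining:
  "i \<in> indices N \<Longrightarrow> j \<in> indices N \<Longrightarrow> unit_relation i j \<in> defining_relations g N"
  unfolding defining_relations_def by (intro UnI1 CollectI exI conjI) (rule refl | assumption)+

lemma RTT_relation_defining:
  "i \<in> indices N \<Longrightarrow> j \<in> indices N \<Longrightarrow> k \<in> indices N \<Longrightarrow> l \<in> indices N
    \<Longrightarrow> RTT_relation g N i j k l m s \<in> defining_relations g N"
  unfolding defining_relations_def by (intro UnI2 CollectI exI conjI) (rule refl | assumption)+

lemma defining_relations_cases [consumes 1, case_names unit RTT]:
  assumes "p \<in> defining_relations g N"
  obtains i j where "i \<in> indices N" "j \<in> indices N" "p = unit_relation i j"
  | i j k l m s where "i \<in> indices N" "j \<in> indices N" "k \<in> indices N" "l \<in> indices N"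
      "p = RTT_relation g N i j k l m s"
proof -
  have "p \<in> {unit_relation i j | i j. i \<in> indices N \<and> j \<in> indices N} \<union>
      {RTT_relation g N i j k l m s | i j k l m s.
        i \<in> indices N \<and> j \<in> indices N \<and> k \<in> indices N \<and> l \<in> indices N}"
    using assms by (simp only: defining_relations_def)
  then show thesis
  proof (elim UnE CollectE exE conjE)
    fix i j assume "p = unit_relation i j" "i \<in> indices N" "j \<in> indices N"
    then show thesis by (intro that(1))
  next
    fix i j k l m s
    assume "p = RTT_relation g N i j k l m s" "i \<in> indices N" "j \<in> indices N" "k \<in> indices N" "l \<in> indices N"
    then show thesis by (intro that(2))
  qed
qed

lemma defining_relations_closed: "defining_relations g N \<subseteq> carrier (free_algebra (generators N))"
proof
  have words: "[] \<in> lists (generators N)"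
    "i \<in> indices N \<Longrightarrow> j \<in> indices N \<Longrightarrow> [(i, j, r)] \<in> lists (generators N)"
    "i \<in> indices N \<Longrightarrow> j \<in> indices N \<Longrightarrow> k \<in> indices N \<Longrightarrow> l \<in> indices N
      \<Longrightarrow> [(i, j, r), (k, l, s)] \<in> lists (generators N)" for i j k l r s
    by (simp_all add: generators_def)
  fix p assume "p \<in> defining_relations g N"
  then have "support p \<subseteq> lists (generators N)"
  proof (cases rule: defining_relations_cases)
    case (unit i j)
    show ?thesis
      unfolding unit(3) unit_relation_def by (intro keys_subset_closed(2,3) words unit(1,2))
  next
    case (RTT i j k l m s)
    show ?thesis
      unfolding RTT(5) RTT_relation_def
      by (intro keys_sum_subset keys_subset_closed(2,3) words RTT(1-4)) assumption+
  qed
  then show "p \<in> carrier (free_algebra (generators N))"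
    by (simp add: free_algebra_def monoid_algebra_simps)
qed

locale extended_yangian_data =
  fixes g :: lie_type and N :: nat
  assumes valid: "valid_lie_type g N"
begin

abbreviation "\<F> \<equiv> free_algebra (generators N)"
abbreviation "\<X> \<equiv> extended_yangian g N"
abbreviation "\<J> \<equiv> indices N"

sublocale F: complex_algebra \<F>
  by (rule free_algebra_complex_algebra)

lemma yangian_ideal: "ideal (yangian_ideal g N) \<F>"
  unfolding yangian_ideal_def by (rule F.genideal_ideal[OF defining_relations_closed])

sublocale X: complex_algebra \<X>
  unfolding extended_yangian_def by (rule F.quotient_algebra_complex_algebra[OF yangian_ideal])

definition proj :: "(generator list \<Rightarrow>\<^sub>0 complex) \<Rightarrow> yangian_elem" where
  "proj p = yangian_ideal g N +>\<^bsub>\<F>\<^esub> p"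

lemma proj_simps:
  "carrier \<X> = proj ` carrier \<F>"
  "\<one>\<^bsub>\<X>\<^esub> = proj \<one>\<^bsub>\<F>\<^esub>"
  "\<zero>\<^bsub>\<X>\<^esub> = proj \<zero>\<^bsub>\<F>\<^esub>"
  "x \<in> carrier \<F> \<Longrightarrow> y \<in> carrier \<F> \<Longrightarrow> proj x \<oplus>\<^bsub>\<X>\<^esub> proj y = proj (x \<oplus>\<^bsub>\<F>\<^esub> y)"
  "x \<in> carrier \<F> \<Longrightarrow> y \<in> carrier \<F> \<Longrightarrow> proj x \<otimes>\<^bsub>\<X>\<^esub> proj y = proj (x \<otimes>\<^bsub>\<F>\<^esub> y)"
  "x \<in> carrier \<F> \<Longrightarrow> c \<odot>\<^bsub>\<X>\<^esub> proj x = proj (c \<odot>\<^bsub>\<F>\<^esub> x)"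
  by (simp_all only: extended_yangian_def proj_def[abs_def] F.quotient_algebra_simps[OF yangian_ideal])

lemma proj_relation: "p \<in> defining_relations g N \<Longrightarrow> proj p = \<zero>\<^bsub>\<X>\<^esub>"
proof -
  assume "p \<in> defining_relations g N"
  then have "p \<in> yangian_ideal g N"
    unfolding yangian_ideal_def using F.genideal_self[OF defining_relations_closed] by blast
  then show ?thesis
    by (simp add: proj_def F.a_rcos_zero[OF yangian_ideal] extended_yangian_def quotient_algebra_def FactRing_def)
qed

lemma T_matrix_proj: "T_matrix g N i j r = proj (single [(i, j, r)] 1)"
  by (simp add: T_matrix_def proj_def)

lemma generator_word_closed:
  "i \<in> \<J> \<Longrightarrow> j \<in> \<J> \<Longrightarrow> single [(i, j, r)] c \<in> carrier \<F>"
  by (simp add: free_algebra_def monoid_algebra_simps generators_def)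

lemma T_matrix_closed: "i \<in> \<J> \<Longrightarrow> j \<in> \<J> \<Longrightarrow> T_matrix g N i j r \<in> carrier \<X>"
  unfolding T_matrix_proj proj_simps(1) by (rule imageI[OF generator_word_closed])

lemma T_matrix_series_closed: "i \<in> \<J> \<Longrightarrow> j \<in> \<J> \<Longrightarrow> T_matrix g N i j \<in> carrier (series_algebra \<X>)"
  by (simp add: series_algebra_def T_matrix_closed)

abbreviation "\<e> \<equiv> embed_elem \<X> \<one>\<^bsub>\<X>\<^esub>"

definition t_family :: "int \<Rightarrow> int \<Rightarrow> yangian_elem ambient fps" where
  "t_family i j = embed_series \<X> (T_matrix g N i j)"

lemma unit_corner: "\<e> \<in> corner \<e>"
  by (rule X.embed_corner) simp

lemma RTT_family_t: "RTT_family g N \<e> t_family"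
proof -
  let ?\<Phi> = "\<lambda>x. embed_elem \<X> (proj (single [x] 1))"
  have t: "t_family = (\<lambda>i j. Abs_fps (\<lambda>r. ?\<Phi> (i, j, r)))"
    by (simp add: t_family_def fun_eq_iff embed_series_def T_matrix_proj)
  have \<Phi>: "?\<Phi> (i, j, r) \<in> corner \<e>" if "i \<in> \<J>" "j \<in> \<J>" for i j r
    using T_matrix_closed[OF that] by (intro X.embed_corner) (simp add: T_matrix_proj)
  have \<Phi>': "?\<Phi> x \<in> corner \<e>" if "x \<in> generators N" for x
    using that by (cases x) (simp add: generators_def \<Phi>)
  have zero: "polynomial_value ?\<Phi> \<e> p = 0" if p: "p \<in> defining_relations g N" for p
  proof -
    have "embed_elem \<X> (proj p) = polynomial_value ?\<Phi> \<e> p"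
      unfolding extended_yangian_def proj_def
      by (rule embed_free_quotient[OF yangian_ideal subsetD[OF defining_relations_closed p]])
    then show ?thesis
      using proj_relation[OF p] X.embed_zero by simp
  qed
  show ?thesis
    unfolding t
  proof unfold_locales
    show "Abs_fps (\<lambda>r. ?\<Phi> (i, j, r)) $ r \<in> corner \<e>" if "i \<in> \<J>" "j \<in> \<J>" for i j r
      using \<Phi>[OF that] by simp
    show "Abs_fps (\<lambda>r. ?\<Phi> (i, j, r)) $ 0 = (if i = j then \<e> else 0)" if "i \<in> \<J>" "j \<in> \<J>" for i j
    proof -
      have "unit_relation i j \<in> defining_relations g N"
        using that by (rule unit_relation_defining)
      from zero[OF this] show ?thesis
        unfolding polynomial_value_unit_relation[of ?\<Phi>, OF \<Phi>[OF that]] by simp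
    qed
    show "RTT_expr g N (\<lambda>i j. Abs_fps (\<lambda>r. ?\<Phi> (i, j, r))) i j k l m s = 0"
      if "i \<in> \<J>" "j \<in> \<J>" "k \<in> \<J>" "l \<in> \<J>" for i j k l m s
    proof -
      have "RTT_expr g N (\<lambda>i j. Abs_fps (\<lambda>r. ?\<Phi> (i, j, r))) i j k l m s
          = polynomial_value ?\<Phi> \<e> (RTT_relation g N i j k l m s)"
        by (rule polynomial_value_RTT_relation[symmetric, OF unit_corner \<Phi>' that])
      also have "\<dots> = 0"
        using that by (intro zero RTT_relation_defining)
      finally show ?thesis .
    qed
  qed (rule valid unit_corner)+
qed

sublocale XX: tensor_product \<X> \<X> ..

abbreviation "\<Delta> \<equiv> coproduct g N"
abbreviation "\<eta> \<equiv> embed_elem (XX g N)"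
abbreviation "\<e>\<e> \<equiv> \<eta> \<one>\<^bsub>XX g N\<^esub>"

definition coproduct_family :: "int \<Rightarrow> int \<Rightarrow> (yangian_elem \<times> yangian_elem \<Rightarrow>\<^sub>0 complex) set ambient fps" where
  "coproduct_family i j = (\<Sum>k\<in>\<J>. map_series XX.embed_left (t_family i k) * map_series XX.embed_right (t_family k j))"

lemma embed_left_right_commute: "XX.embed_left x * XX.embed_right y = XX.embed_right y * XX.embed_left x"
  by (simp only: XX.embed_pure_tensor)

text \<open>The images of the generators under the coproduct are the entries of the matrix product of
  \<open>T(u) \<otimes> 1\<close> and \<open>1 \<otimes> T(u)\<close>.\<close>
lemma RTT_family_coproduct: "RTT_family g N \<e>\<e> coproduct_family"
proof -
  interpret L: complex_ring_hom XX.embed_left by (rule XX.embed_left_hom)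
  interpret R: complex_ring_hom XX.embed_right by (rule XX.embed_right_hom)
  have "RTT_family g N \<e>\<e> (\<lambda>i j. map_series XX.embed_left (t_family i j))"
    "RTT_family g N \<e>\<e> (\<lambda>i j. map_series XX.embed_right (t_family i j))"
    using L.RTT_family_image[OF RTT_family_t] R.RTT_family_image[OF RTT_family_t] by (simp_all add: XX.embed_left_right_one)
  then have "RTT_family g N \<e>\<e> (\<lambda>i j. \<Sum>k\<in>\<J>. map_series XX.embed_left (t_family i k) * map_series XX.embed_right (t_family k j))"
    by (rule RTT_family_product) (simp only: map_series_nth embed_left_right_commute)
  then show ?thesis
    unfolding coproduct_family_def[abs_def] .
qed

lemma coproduct_generator_closed:
  assumes "x \<in> generators N"
  shows "coproduct_generator g N x \<in> carrier (XX g N)"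
proof -
  obtain i j r where x: "x = (i, j, r)" and ij: "i \<in> \<J>" "j \<in> \<J>"
    using assms by (auto simp: generators_def)
  show ?thesis
    unfolding x coproduct_generator_def prod.case
    by (intro XX.T.finsum_closed Pi_I XX.pure_tensor_closed T_matrix_closed ij)
qed

lemma embed_coproduct_generator:
  assumes "i \<in> \<J>" "j \<in> \<J>"
  shows "\<eta> (coproduct_generator g N (i, j, r)) = coproduct_family i j $ r"
proof -
  have "\<eta> (coproduct_generator g N (i, j, r))
      = (\<Sum>k\<in>\<J>. \<Sum>s\<le>r. \<eta> (pure_tensor \<X> \<X> (T_matrix g N i k s) (T_matrix g N k j (r - s))))"
    using assms by (simp add: coproduct_generator_def)
      (simp add: XX.T.embed_finsum T_matrix_closed XX.T.finsum_closed)
  also have "\<dots> = (\<Sum>k\<in>\<J>. \<Sum>s\<le>r. XX.embed_left (t_family i k $ s) * XX.embed_right (t_family k j $ (r - s)))"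
    using assms by (intro sum.cong refl) (simp add: XX.embed_pure_tensor t_family_def T_matrix_closed)
  also have "\<dots> = coproduct_family i j $ r"
    by (simp add: coproduct_family_def fps_sum_nth fps_mult_nth atLeast0AtMost)
  finally show ?thesis .
qed

lemma free_eval_relation:
  assumes "p \<in> defining_relations g N"
  shows "free_eval (XX g N) (coproduct_generator g N) p = \<zero>\<^bsub>XX g N\<^esub>"
proof -
  interpret C: RTT_family g N \<e>\<e> coproduct_family by (rule RTT_family_coproduct)
  let ?\<Phi> = "\<lambda>x. \<eta> (coproduct_generator g N x)"
  have p: "p \<in> carrier \<F>"
    using assms defining_relations_closed by blast
  have \<Phi>: "?\<Phi> x \<in> corner \<e>\<e>" if "x \<in> generators N" for x
    by (rule XX.T.embed_corner[OF coproduct_generator_closed[OF that]])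
  have "polynomial_value ?\<Phi> \<e>\<e> p = 0"
    using assms
  proof (cases rule: defining_relations_cases)
    case (unit i j)
    then show ?thesis
      using \<Phi>[of "(i, j, 0)"] C.constant_term[of i j]
      by (simp add: polynomial_value_unit_relation generators_def embed_coproduct_generator)
  next
    case (RTT i j k l m s)
    have "polynomial_value ?\<Phi> \<e>\<e> p = RTT_expr g N (\<lambda>i j. Abs_fps (\<lambda>r. ?\<Phi> (i, j, r))) i j k l m s"
      unfolding RTT(5) by (rule polynomial_value_RTT_relation) (use \<Phi> C.unit RTT in auto)
    also have "\<dots> = RTT_expr g N coproduct_family i j k l m s"
      unfolding RTT_expr_def using RTT
      by (intro sum.cong refl) (simp add: embed_coproduct_generator)
    finally show ?thesis
      using C.RTT RTT by simp
  qed
  then have "\<eta> (free_eval (XX g N) (coproduct_generator g N) p) = \<eta> \<zero>\<^bsub>XX g N\<^esub>"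
    using XX.T.free_eval_closed(2)[OF coproduct_generator_closed p] XX.T.embed_zero by simp
  then show ?thesis
    using XX.T.embed_inject[OF XX.T.free_eval_closed(1)[OF coproduct_generator_closed p]] by simp
qed

lemma coproduct_proj:
  assumes "p \<in> carrier \<F>"
  shows "\<Delta> (proj p) = free_eval (XX g N) (coproduct_generator g N) p"
  unfolding coproduct_def proj_def yangian_ideal_def
proof (rule the_elem_image_coset[OF F.ring_axioms XX.T.ring_axioms _ defining_relations_closed free_eval_relation assms])
  show "free_eval (XX g N) (coproduct_generator g N) \<in> ring_hom \<F> (XX g N)"
    by (intro ring_hom_memI XX.T.free_eval_closed(1) XX.T.free_eval_hom XX.T.free_eval_one
        coproduct_generator_closed)
qed

lemma coproduct_closed: "x \<in> carrier \<X> \<Longrightarrow> \<Delta> x \<in> carrier (XX g N)"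
  by (auto simp: proj_simps(1) coproduct_proj intro!: XX.T.free_eval_closed(1) coproduct_generator_closed)

lemma coproduct_hom:
  assumes "x \<in> carrier \<X>" "y \<in> carrier \<X>"
  shows "\<Delta> (x \<oplus>\<^bsub>\<X>\<^esub> y) = \<Delta> x \<oplus>\<^bsub>XX g N\<^esub> \<Delta> y"
    and "\<Delta> (x \<otimes>\<^bsub>\<X>\<^esub> y) = \<Delta> x \<otimes>\<^bsub>XX g N\<^esub> \<Delta> y"
proof -
  obtain p q where pq: "p \<in> carrier \<F>" "q \<in> carrier \<F>" "x = proj p" "y = proj q"
    using assms by (auto simp: proj_simps(1))
  note hom = XX.T.free_eval_hom[OF coproduct_generator_closed pq(1,2)]
  show "\<Delta> (x \<oplus>\<^bsub>\<X>\<^esub> y) = \<Delta> x \<oplus>\<^bsub>XX g N\<^esub> \<Delta> y"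
    using pq by (simp add: proj_simps coproduct_proj hom)
  show "\<Delta> (x \<otimes>\<^bsub>\<X>\<^esub> y) = \<Delta> x \<otimes>\<^bsub>XX g N\<^esub> \<Delta> y"
    using pq by (simp add: proj_simps coproduct_proj hom)
qed

lemma coproduct_smult:
  assumes "x \<in> carrier \<X>"
  shows "\<Delta> (c \<odot>\<^bsub>\<X>\<^esub> x) = c \<odot>\<^bsub>XX g N\<^esub> \<Delta> x"
proof -
  obtain p where p: "p \<in> carrier \<F>" "x = proj p"
    using assms by (auto simp: proj_simps(1))
  show ?thesis
    using p XX.T.free_eval_smult[OF coproduct_generator_closed p(1)] by (simp add: proj_simps coproduct_proj)
qed

lemma coproduct_one: "\<Delta> \<one>\<^bsub>\<X>\<^esub> = \<one>\<^bsub>XX g N\<^esub>"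
  using XX.T.free_eval_one[where G="generators N", OF coproduct_generator_closed] by (simp add: proj_simps coproduct_proj)

definition coproduct_ambient :: "yangian_elem ambient \<Rightarrow> (yangian_elem \<times> yangian_elem \<Rightarrow>\<^sub>0 complex) set ambient" where
  "coproduct_ambient x = \<eta> (\<Delta> (component \<X> x))"

lemma coproduct_ambient_hom: "complex_ring_hom coproduct_ambient"
  by unfold_locales
    (simp_all add: coproduct_ambient_def component_hom X.complex_algebra_axioms coproduct_hom coproduct_smult coproduct_closed
      XX.T.embed_hom XX.T.embed_smult)

lemma coproduct_ambient_t:
  assumes "i \<in> \<J>" "j \<in> \<J>"
  shows "map_series coproduct_ambient (t_family i j) = coproduct_family i j"
proof (rule fps_ext)
  fix r
  have "free_eval (XX g N) (coproduct_generator g N) (single [(i, j, r)] 1) = coproduct_generator g N (i, j, r)"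
    using coproduct_generator_closed[of "(i, j, r)"] assms by (simp add: free_eval_def generators_def)
  then have "\<Delta> (T_matrix g N i j r) = coproduct_generator g N (i, j, r)"
    unfolding T_matrix_proj coproduct_proj[OF generator_word_closed[OF assms]] .
  then show "map_series coproduct_ambient (t_family i j) $ r = coproduct_family i j $ r"
    using assms by (simp add: coproduct_ambient_def t_family_def T_matrix_closed embed_coproduct_generator)
qed

sublocale matrix_comultiplication XX.embed_left XX.embed_right coproduct_ambient g N \<e> t_family
proof (intro matrix_comultiplication.intro matrix_comultiplication_axioms.intro)
  show "XX.embed_left \<e> = coproduct_ambient \<e>" "XX.embed_right \<e> = coproduct_ambient \<e>"
    by (simp_all add: XX.embed_left_right_one coproduct_ambient_def coproduct_one)
qed (simp_all add: XX.embed_left_hom XX.embed_right_hom coproduct_ambient_hom RTT_family_t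
    embed_left_right_commute coproduct_ambient_t coproduct_family_def)

end

section \<open>The normalised T-matrix and the left coideal property\<close>

lemma (in complex_algebra) subspace_finsum:
  assumes "is_subspace U A" "\<And>i. i \<in> I \<Longrightarrow> f i \<in> U"
  shows "finsum A f I \<in> U"
  using assms(2)
proof (induction I rule: infinite_finite_induct)
  case (insert i I)
  then show ?case
    using is_subspaceD(1,3)[OF assms(1)] by (subst finsum_insert) auto
qed (simp_all add: is_subspaceD(2)[OF assms(1)] finsum_infinite)

text \<open>Series with coefficients in a subalgebra are closed under all operations of which the matrix
  \<open>Sigma_matrix\<close> is composed.\<close>

lemma (in complex_algebra) series_coefficients_in_subalgebra:
  assumes B: "is_subalgebra B A" and f: "\<And>r. f r \<in> B" and h: "\<And>r. h r \<in> B"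
  shows "(f \<otimes>\<^bsub>\<S>\<^esub> h) r \<in> B" "(c \<odot>\<^bsub>\<S>\<^esub> f) r \<in> B" "series_subst A \<epsilon> a f r \<in> B"
  using f h is_subalgebraD(3)[OF B] is_subspaceD(4)[OF is_subalgebraD(1)[OF B]]
  by (auto simp: series_algebra_def series_subst_def intro!: subspace_finsum[OF is_subalgebraD(1)[OF B]])

lemma (in complex_algebra) finsum_coefficients_in_subalgebra:
  assumes B: "is_subalgebra B A" and f: "\<And>i r. i \<in> I \<Longrightarrow> f i r \<in> B"
  shows "finsum \<S> f I r \<in> B"
proof -
  interpret S: abelian_monoid \<S> by (rule series_algebra_abelian_monoid)
  note sub = is_subalgebraD(1)[OF B]
  have carrier: "f i \<in> carrier \<S>" if "i \<in> I" for i
    using is_subspaceD(1)[OF sub] f[OF that] by (auto simp: series_algebra_def)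
  show ?thesis
    using f carrier
  proof (induction I arbitrary: r rule: infinite_finite_induct)
    case (insert i I)
    have "finsum \<S> f (insert i I) r = (f i \<oplus>\<^bsub>\<S>\<^esub> finsum \<S> f I) r"
      using insert.hyps insert.prems by (subst S.finsum_insert) auto
    also have "\<dots> = f i r \<oplus> finsum \<S> f I r"
      by (simp add: series_algebra_def)
    also have "\<dots> \<in> B"
      using insert by (intro is_subspaceD(3)[OF sub]) auto
    finally show ?case .
  qed (simp_all add: S.finsum_infinite, simp_all add: series_algebra_def is_subspaceD(2)[OF sub])
qed

context extended_yangian_data
begin

abbreviation "\<iota> \<equiv> embed_series \<X>"

lemma matrix_mult_embed:
  assumes "\<And>k. k \<in> \<J> \<Longrightarrow> M i k \<in> carrier X.\<S>" "\<And>k. k \<in> \<J> \<Longrightarrow> M' k j \<in> carrier X.\<S>"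
  shows "matrix_mult \<X> \<J> M M' i j \<in> carrier X.\<S>"
    and "\<iota> (matrix_mult \<X> \<J> M M' i j) = (\<Sum>k\<in>\<J>. \<iota> (M i k) * \<iota> (M' k j))"
  using assms unfolding matrix_mult_def
  by (simp_all add: X.embed_series_finsum X.series_algebra_closed X.embed_series_hom)

lemma transposition_embed:
  assumes "M (- j) (- i) \<in> carrier X.\<S>"
  shows "transposition \<X> g M i j \<in> carrier X.\<S>"
    and "\<iota> (transposition \<X> g M i j) = transpose_family g (\<lambda>i j. \<iota> (M i j)) i j"
  using assms unfolding transposition_def transpose_family_def
  by (simp_all add: X.series_algebra_closed X.embed_series_smult)

lemma one_index: "1 \<in> \<J>"
  using valid by (auto simp: valid_lie_type_def indices_def)

lemma is_z_series_iff:
  assumes f: "f \<in> carrier X.\<S>"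
  shows "is_z_series g N f \<longleftrightarrow> (\<forall>i\<in>\<J>. \<forall>j\<in>\<J>.
      (\<Sum>k\<in>\<J>. \<K> (transpose_family g t_family i k) * t_family k j) = (if i = j then \<iota> f else 0) \<and>
      (\<Sum>k\<in>\<J>. t_family i k * \<K> (transpose_family g t_family k j)) = (if i = j then \<iota> f else 0))"
proof -
  define Tt where "Tt = matrix_subst \<X> 1 (kappa g N) (transposition \<X> g (T_matrix g N))"
  have Tt: "Tt i j \<in> carrier X.\<S>" "\<iota> (Tt i j) = \<K> (transpose_family g t_family i j)"
    if "i \<in> \<J>" "j \<in> \<J>" for i j
    using that unfolding Tt_def matrix_subst_def t_family_def[abs_def]
    by (simp_all add: X.series_algebra_closed X.embed_series_subst transposition_embed T_matrix_series_closed)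
  have scalar: "scalar_matrix \<X> f i j \<in> carrier X.\<S>"
    "\<iota> (scalar_matrix \<X> f i j) = (if i = j then \<iota> f else 0)" for i j
    using f by (simp_all add: scalar_matrix_def X.series_algebra_closed X.embed_series_zero)
  have 1: "matrix_mult \<X> \<J> Tt (T_matrix g N) i j = scalar_matrix \<X> f i j \<longleftrightarrow>
      (\<Sum>k\<in>\<J>. \<K> (transpose_family g t_family i k) * t_family k j) = (if i = j then \<iota> f else 0)" (is ?left)
    and 2: "matrix_mult \<X> \<J> (T_matrix g N) Tt i j = scalar_matrix \<X> f i j \<longleftrightarrow>
      (\<Sum>k\<in>\<J>. t_family i k * \<K> (transpose_family g t_family k j)) = (if i = j then \<iota> f else 0)" (is ?right)
    if ij: "i \<in> \<J>" "j \<in> \<J>" for i j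
  proof -
    have Tt_T: "matrix_mult \<X> \<J> Tt (T_matrix g N) i j \<in> carrier X.\<S>"
      "\<iota> (matrix_mult \<X> \<J> Tt (T_matrix g N) i j)
        = (\<Sum>k\<in>\<J>. \<iota> (Tt i k) * \<iota> (T_matrix g N k j))"
      by (rule matrix_mult_embed; intro Tt(1) T_matrix_series_closed ij; assumption)+
    have T_Tt: "matrix_mult \<X> \<J> (T_matrix g N) Tt i j \<in> carrier X.\<S>"
      "\<iota> (matrix_mult \<X> \<J> (T_matrix g N) Tt i j)
        = (\<Sum>k\<in>\<J>. \<iota> (T_matrix g N i k) * \<iota> (Tt k j))"
      by (rule matrix_mult_embed; intro Tt(1) T_matrix_series_closed ij; assumption)+
    show ?left
      unfolding X.embed_series_inject[OF Tt_T(1) scalar(1), symmetric] Tt_T(2) scalar(2)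
      using ij by (simp add: Tt(2) t_family_def cong: sum.cong)
    show ?right
      unfolding X.embed_series_inject[OF T_Tt(1) scalar(1), symmetric] T_Tt(2) scalar(2)
      using ij by (simp add: Tt(2) t_family_def cong: sum.cong)
  qed
  show ?thesis
    using f by (simp add: is_z_series_def Let_def Tt_def[symmetric] 1 2)
qed

lemma z_series:
  shows "z_series g N \<in> carrier X.\<S>" "\<iota> (z_series g N) $ 0 = \<e>"
    and "group_like (\<iota> (z_series g N))"
proof -
  let ?S = "\<K>" and ?tt = "transpose_family g t_family"
  obtain z where z: "\<And>i j. i \<in> \<J> \<Longrightarrow> j \<in> \<J> \<Longrightarrow> (\<Sum>k\<in>\<J>. ?S (?tt i k) * t_family k j) = (if i = j then z else 0)"
      "\<And>i j. i \<in> \<J> \<Longrightarrow> j \<in> \<J> \<Longrightarrow> (\<Sum>k\<in>\<J>. t_family i k * ?S (?tt k j)) = (if i = j then z else 0)"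
    using transpose_times_family by blast
  have z1: "z = (\<Sum>k\<in>\<J>. ?S (?tt 1 k) * t_family k 1)"
    using z(1)[OF one_index one_index] by simp
  have tt: "?tt i j $ n \<in> corner \<e>" if "i \<in> \<J>" "j \<in> \<J>" for i j n
    using that by (simp add: transpose_family_def corner_closed entries)
  have corner: "z $ n \<in> corner \<e>" for n
    unfolding z1 fps_sum_nth using one_index by (intro corner_sum corner_fps_mult corner_substitute tt entries)
  have "z $ 0 = (\<Sum>k\<in>\<J>. if k = 1 then \<e> else 0)"
    unfolding z1 fps_sum_nth
    by (intro sum.cong refl)
      (use one_index theta_mult(2)[of "-1"] in \<open>auto simp: transpose_family_def constant_term scaleC_mult_left corner_unit[OF unit]\<close>)
  then have z0: "z $ 0 = \<e>"
    using one_index by simp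
  obtain h where h: "h \<in> carrier X.\<S>" "\<iota> h = z"
    using X.corner_embed_series corner by blast
  have "z_series g N = h"
    unfolding z_series_def
  proof (rule the_equality)
    show "is_z_series g N h"
      unfolding is_z_series_iff[OF h(1)] h(2) using z by simp
    fix f assume f: "is_z_series g N f"
    then have fc: "f \<in> carrier X.\<S>"
      by (simp add: is_z_series_def Let_def)
    have "\<iota> f = z"
      using f one_index unfolding is_z_series_iff[OF fc] z1 by simp
    then show "f = h"
      using X.embed_series_inject[OF fc h(1)] h(2) by simp
  qed
  then show "z_series g N \<in> carrier X.\<S>" "\<iota> (z_series g N) $ 0 = \<e>"
      "group_like (\<iota> (z_series g N))"
    using h z0 group_like_z[OF z(1)] by (simp_all del: embed_series_nth)
qed

lemma y_series:
  shows "y_series g N \<in> carrier X.\<S>" "\<iota> (y_series g N) $ 0 = \<e>"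
    and "group_like (\<iota> (y_series g N))"
proof -
  let ?S = "\<K>"
  note z = z_series
  obtain y where y: "\<And>n. y $ n \<in> corner \<e>" "y $ 0 = \<e>" "\<iota> (z_series g N) = y * ?S y"
    using substitute_square_root[OF unit X.embed_series_corner[OF z(1)] z(2) inverse_linear_power_nth_diag] by blast
  obtain h where h: "h \<in> carrier X.\<S>" "\<iota> h = y"
    using X.corner_embed_series y(1) by blast
  have iff: "z_series g N = f \<otimes>\<^bsub>X.\<S>\<^esub> series_subst \<X> 1 (kappa g N) f \<longleftrightarrow> y * ?S y = \<iota> f * ?S (\<iota> f)"
    if "f \<in> carrier X.\<S>" for f
    using that z(1) y(3) X.embed_series_inject[of "z_series g N" "f \<otimes>\<^bsub>X.\<S>\<^esub> series_subst \<X> 1 (kappa g N) f"]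
    by (simp add: X.series_algebra_closed X.embed_series_hom X.embed_series_subst)
  have const: "f 0 = \<one>\<^bsub>\<X>\<^esub> \<longleftrightarrow> \<iota> f $ 0 = \<e>" if "f \<in> carrier X.\<S>" for f
    using that X.embed_inject[of "f 0" "\<one>\<^bsub>\<X>\<^esub>"] by (simp add: series_algebra_def)
  have "y_series g N = h"
    unfolding y_series_def Let_def
  proof (rule the_equality)
    show "h \<in> carrier X.\<S> \<and> h 0 = \<one>\<^bsub>\<X>\<^esub> \<and> z_series g N = h \<otimes>\<^bsub>X.\<S>\<^esub> series_subst \<X> 1 (kappa g N) h"
      using h(1) y(2) unfolding iff[OF h(1)] const[OF h(1)] h(2) by simp
    fix f assume f: "f \<in> carrier X.\<S> \<and> f 0 = \<one>\<^bsub>\<X>\<^esub> \<and> z_series g N = f \<otimes>\<^bsub>X.\<S>\<^esub> series_subst \<X> 1 (kappa g N) f"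
    then have fc: "f \<in> carrier X.\<S>" by simp
    have "\<iota> f = y"
      using f unfolding iff[OF fc] const[OF fc]
      by (intro substitute_square_root_unique[where \<phi>="inverse_linear 1 (kappa g N)", OF unit X.embed_series_corner[OF fc] _ y(1,2) inverse_linear_power_nth_diag]) auto
    then show "f = h"
      using X.embed_series_inject[OF fc h(1)] h(2) by simp
  qed
  then show "y_series g N \<in> carrier X.\<S>" "\<iota> (y_series g N) $ 0 = \<e>"
      "group_like (\<iota> (y_series g N))"
    using h y group_like_y[OF z(3) y(1,2,3)] by (simp_all del: embed_series_nth)
qed

lemma y_series_inverse:
  shows "m_inv X.\<S> (y_series g N) \<in> carrier X.\<S>"
    and "group_like (\<iota> (m_inv X.\<S> (y_series g N)))"
proof -
  obtain v where v: "\<And>n. v $ n \<in> corner \<e>" "\<iota> (y_series g N) * v = fps_const \<e>"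
      "v * \<iota> (y_series g N) = fps_const \<e>"
    using corner_inverse[OF unit X.embed_series_corner[OF y_series(1)] y_series(2)] by blast
  obtain h where h: "h \<in> carrier X.\<S>" "\<iota> h = v"
    using X.corner_embed_series v(1) by blast
  have iff: "y_series g N \<otimes>\<^bsub>X.\<S>\<^esub> f = \<one>\<^bsub>X.\<S>\<^esub> \<longleftrightarrow> \<iota> (y_series g N) * \<iota> f = fps_const \<e>"
    "f \<otimes>\<^bsub>X.\<S>\<^esub> y_series g N = \<one>\<^bsub>X.\<S>\<^esub> \<longleftrightarrow> \<iota> f * \<iota> (y_series g N) = fps_const \<e>"
    if "f \<in> carrier X.\<S>" for f
    using that y_series(1) X.embed_series_inject[of "y_series g N \<otimes>\<^bsub>X.\<S>\<^esub> f" "\<one>\<^bsub>X.\<S>\<^esub>"]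
      X.embed_series_inject[of "f \<otimes>\<^bsub>X.\<S>\<^esub> y_series g N" "\<one>\<^bsub>X.\<S>\<^esub>"]
    by (simp_all add: X.series_algebra_closed X.embed_series_hom X.embed_series_one)
  have "m_inv X.\<S> (y_series g N) = h"
    unfolding m_inv_def
  proof (rule the_equality)
    show "h \<in> carrier X.\<S> \<and> y_series g N \<otimes>\<^bsub>X.\<S>\<^esub> h = \<one>\<^bsub>X.\<S>\<^esub> \<and> h \<otimes>\<^bsub>X.\<S>\<^esub> y_series g N = \<one>\<^bsub>X.\<S>\<^esub>"
      using h(1) v unfolding iff[OF h(1)] h(2) by simp
    fix f assume f: "f \<in> carrier X.\<S> \<and> y_series g N \<otimes>\<^bsub>X.\<S>\<^esub> f = \<one>\<^bsub>X.\<S>\<^esub> \<and> f \<otimes>\<^bsub>X.\<S>\<^esub> y_series g N = \<one>\<^bsub>X.\<S>\<^esub>"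
    then have fc: "f \<in> carrier X.\<S>" by simp
    have "\<iota> f = \<iota> f * (\<iota> (y_series g N) * v)"
      unfolding v(2) by (rule corner_fps_const_mult(2)[symmetric, OF X.embed_series_corner[OF fc]])
    also have "\<dots> = fps_const \<e> * v"
      using f unfolding iff[OF fc] by (simp flip: mult.assoc)
    also have "\<dots> = v"
      by (rule corner_fps_const_mult(1)[OF v(1)])
    finally show "f = h"
      using X.embed_series_inject[OF fc h(1)] h(2) by simp
  qed
  then show "m_inv X.\<S> (y_series g N) \<in> carrier X.\<S>" "group_like (\<iota> (m_inv X.\<S> (y_series g N)))"
    using h group_like_inverse[OF y_series(3) v] by simp_all
qed

lemma calT_closed: "i \<in> \<J> \<Longrightarrow> j \<in> \<J> \<Longrightarrow> calT g N i j \<in> carrier X.\<S>"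
  by (simp add: calT_def X.series_algebra_closed y_series_inverse T_matrix_series_closed)

definition calT_family :: "int \<Rightarrow> int \<Rightarrow> yangian_elem ambient fps" where
  "calT_family i j = \<iota> (calT g N i j)"

lemma matrix_coproduct_calT: "matrix_coproduct calT_family"
proof -
  have "calT_family i j = \<iota> (m_inv X.\<S> (y_series g N)) * t_family i j" if "i \<in> \<J>" "j \<in> \<J>" for i j
    using that by (simp add: calT_family_def calT_def t_family_def X.embed_series_hom y_series_inverse T_matrix_series_closed)
  then show ?thesis
    using matrix_coproduct_group_like_mult[OF y_series_inverse(2) matrix_coproduct_t]
    by (simp add: matrix_coproduct_def cong: sum.cong)
qed

lemma yangian_subalgebra:
  shows "is_subalgebra (yangian g N) \<X>" and "i \<in> \<J> \<Longrightarrow> j \<in> \<J> \<Longrightarrow> calT g N i j r \<in> yangian g N"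
proof -
  have S: "{calT g N i j r | i j r. i \<in> \<J> \<and> j \<in> \<J>} \<subseteq> carrier \<X>"
    using calT_closed by (auto simp: series_algebra_def)
  show "is_subalgebra (yangian g N) \<X>"
    unfolding yangian_def by (rule X.generated_subalgebra_is_subalgebra(1)[OF S])
  show "i \<in> \<J> \<Longrightarrow> j \<in> \<J> \<Longrightarrow> calT g N i j r \<in> yangian g N"
    unfolding yangian_def using X.generated_subalgebra_is_subalgebra(2)[OF S] by blast
qed

definition calT_left :: "int \<Rightarrow> int \<Rightarrow> nat \<Rightarrow> yangian_elem" where
  "calT_left i j = series_subst \<X> 1 (- kappa g N / 2) (calT g N i j)"

definition calT_right :: "int \<Rightarrow> int \<Rightarrow> nat \<Rightarrow> yangian_elem" where
  "calT_right i j = series_subst \<X> (- 1) (kappa g N / 2) (transposition \<X> g (calT g N) i j)"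

lemma calT_left_right_closed:
  assumes "i \<in> \<J>" "j \<in> \<J>"
  shows "calT_left i j \<in> carrier X.\<S>" "calT_right i j \<in> carrier X.\<S>"
    and "\<iota> (calT_left i j) = substitute (inverse_linear 1 (- kappa g N / 2)) (calT_family i j)"
    and "\<iota> (calT_right i j) = substitute (inverse_linear (- 1) (kappa g N / 2)) (transpose_family g calT_family i j)"
  using assms unfolding calT_family_def[abs_def] calT_left_def calT_right_def
  by (simp_all add: X.series_algebra_closed X.embed_series_subst transposition_embed calT_closed)

lemma calT_left_right_in_yangian:
  assumes "i \<in> \<J>" "j \<in> \<J>"
  shows "calT_left i j r \<in> yangian g N" "calT_right i j r \<in> yangian g N"
  using assms unfolding calT_left_def calT_right_def transposition_def
  by (auto intro!: X.series_coefficients_in_subalgebra(2,3)[OF yangian_subalgebra(1)] yangian_subalgebra(2))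

lemma G_matrix_closed: "G_matrix \<X> N \<tau> i j \<in> carrier X.\<S>"
  by (simp add: series_algebra_def G_matrix_def)

lemma Sigma_matrix_eq:
  "Sigma_matrix g N \<tau> i j = matrix_mult \<X> \<J> (matrix_mult \<X> \<J> calT_left (G_matrix \<X> N \<tau>)) calT_right i j"
  by (simp add: Sigma_matrix_def Let_def matrix_subst_def calT_left_def[abs_def] calT_right_def[abs_def])

lemma Sigma_matrix_embed:
  assumes "i \<in> \<J>" "j \<in> \<J>"
  shows "Sigma_matrix g N \<tau> i j \<in> carrier X.\<S>"
    and "\<iota> (Sigma_matrix g N \<tau> i j) = (\<Sum>b\<in>\<J>. (\<Sum>a\<in>\<J>.
      substitute (inverse_linear 1 (- kappa g N / 2)) (calT_family i a) * \<iota> (G_matrix \<X> N \<tau> a b))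
      * substitute (inverse_linear (- 1) (kappa g N / 2)) (transpose_family g calT_family b j))" (is ?formula)
proof -
  have inner: "matrix_mult \<X> \<J> calT_left (G_matrix \<X> N \<tau>) i b \<in> carrier X.\<S>"
    "\<iota> (matrix_mult \<X> \<J> calT_left (G_matrix \<X> N \<tau>) i b)
      = (\<Sum>a\<in>\<J>. \<iota> (calT_left i a) * \<iota> (G_matrix \<X> N \<tau> a b))" for b
    by (rule matrix_mult_embed; intro calT_left_right_closed(1) G_matrix_closed assms; assumption)+
  have outer: "matrix_mult \<X> \<J> (matrix_mult \<X> \<J> calT_left (G_matrix \<X> N \<tau>)) calT_right i j \<in> carrier X.\<S>"
    "\<iota> (matrix_mult \<X> \<J> (matrix_mult \<X> \<J> calT_left (G_matrix \<X> N \<tau>)) calT_right i j)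
      = (\<Sum>b\<in>\<J>. \<iota> (matrix_mult \<X> \<J> calT_left (G_matrix \<X> N \<tau>) i b) * \<iota> (calT_right b j))"
    by (rule matrix_mult_embed; intro inner(1) calT_left_right_closed(2) assms; assumption)+
  show "Sigma_matrix g N \<tau> i j \<in> carrier X.\<S>"
    unfolding Sigma_matrix_eq by (rule outer(1))
  show ?formula
    unfolding Sigma_matrix_eq outer(2) inner(2)
    using assms by (simp add: calT_left_right_closed(3,4) cong: sum.cong)
qed

lemma Sigma_in_yangian:
  assumes "i \<in> \<J>" "j \<in> \<J>"
  shows "Sigma_matrix g N \<tau> i j r \<in> yangian g N"
proof -
  note sub = yangian_subalgebra(1)
  have G: "G_matrix \<X> N \<tau> a b r \<in> yangian g N" for a b r
    unfolding G_matrix_def by (intro is_subspaceD(4)[OF is_subalgebraD(1)[OF sub]] is_subalgebraD(2)[OF sub])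
  show ?thesis
    unfolding Sigma_matrix_eq matrix_mult_def
    by (intro X.finsum_coefficients_in_subalgebra[OF sub] X.series_coefficients_in_subalgebra(1)[OF sub]
        calT_left_right_in_yangian G assms)
qed

lemma twisted_yangian_subalgebra:
  shows "is_subalgebra (twisted_yangian g N \<tau>) \<X>" and "twisted_yangian g N \<tau> \<subseteq> yangian g N"
    and "i \<in> \<J> \<Longrightarrow> j \<in> \<J> \<Longrightarrow> Sigma_matrix g N \<tau> i j r \<in> twisted_yangian g N \<tau>"
proof -
  have H: "{Sigma_matrix g N \<tau> i j r | i j r. i \<in> \<J> \<and> j \<in> \<J>} \<subseteq> yangian g N"
    using Sigma_in_yangian by blast
  also have "\<dots> \<subseteq> carrier \<X>"
    by (rule is_subspaceD(1)[OF is_subalgebraD(1)[OF yangian_subalgebra(1)]])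
  finally have S: "{Sigma_matrix g N \<tau> i j r | i j r. i \<in> \<J> \<and> j \<in> \<J>} \<subseteq> carrier \<X>" .
  show "is_subalgebra (twisted_yangian g N \<tau>) \<X>"
    unfolding twisted_yangian_def by (rule X.generated_subalgebra_is_subalgebra(1)[OF S])
  show "twisted_yangian g N \<tau> \<subseteq> yangian g N"
    unfolding twisted_yangian_def by (rule generated_subalgebra_minimal[OF yangian_subalgebra(1) H])
  show "i \<in> \<J> \<Longrightarrow> j \<in> \<J> \<Longrightarrow> Sigma_matrix g N \<tau> i j r \<in> twisted_yangian g N \<tau>"
    unfolding twisted_yangian_def using X.generated_subalgebra_is_subalgebra(2)[OF S] by blast
qed

text \<open>\<open>twisted_coproduct\<close>, read off in the coefficient of \<open>u^(-r)\<close> and brought back from the ambient ring.\<close>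
lemma coproduct_Sigma:
  assumes ij: "i \<in> \<J>" "j \<in> \<J>"
  shows "\<Delta> (Sigma_matrix g N \<tau> i j r)
    \<in> tensor_subspace \<X> \<X> (yangian g N) (twisted_yangian g N \<tau>)" (is "_ \<in> ?TS")
proof -
  let ?f = "\<lambda>k l. calT_left i k \<otimes>\<^bsub>X.\<S>\<^esub> calT_right l j" and ?\<sigma> = "Sigma_matrix g N \<tau>"
  have carriers: "yangian g N \<subseteq> carrier \<X>" "twisted_yangian g N \<tau> \<subseteq> carrier \<X>"
    using is_subspaceD(1)[OF is_subalgebraD(1)] yangian_subalgebra(1) twisted_yangian_subalgebra(1) by blast+
  note TS = XX.tensor_subspace_is_subspace[OF carriers]
  have f: "?f k l s \<in> yangian g N" if "k \<in> \<J>" "l \<in> \<J>" for k l s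
    using that ij by (intro X.series_coefficients_in_subalgebra(1)[OF yangian_subalgebra(1)] calT_left_right_in_yangian)
  have G: "\<D> (\<iota> (G_matrix \<X> N \<tau> a b)) = \<R> (\<iota> (G_matrix \<X> N \<tau> a b))" for a b
    by (simp add: fps_eq_iff G_matrix_def X.embed_smult D.scaleC R.scaleC same_unit)
  have "\<D> (\<iota> (?\<sigma> i j))
      = (\<Sum>k\<in>\<J>. \<Sum>l\<in>\<J>. \<L> (\<iota> (?f k l)) * \<R> (\<iota> (?\<sigma> k l)))"
    using twisted_coproduct[OF matrix_coproduct_calT, where \<phi>="inverse_linear 1 (- kappa g N / 2)"
        and \<psi>="inverse_linear (- 1) (kappa g N / 2)" and G="\<lambda>a b. \<iota> (G_matrix \<X> N \<tau> a b)",
        OF inverse_linear_nth_0 inverse_linear_nth_0 G ij] ij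
    by (simp add: Sigma_matrix_embed X.embed_series_hom calT_left_right_closed cong: sum.cong)
  from arg_cong[OF this, of "\<lambda>f. f $ r"]
  have "\<eta> (\<Delta> (?\<sigma> i j r))
      = (\<Sum>k\<in>\<J>. \<Sum>l\<in>\<J>. \<Sum>s\<le>r. \<eta> (pure_tensor \<X> \<X> (?f k l s) (?\<sigma> k l (r - s))))"
    using f Sigma_in_yangian carriers ij
    by (simp add: coproduct_ambient_def fps_sum_nth fps_mult_nth XX.embed_pure_tensor subset_iff atLeast0AtMost cong: sum.cong)
  also have "\<dots> = \<eta> (\<Oplus>\<^bsub>XX g N\<^esub>k\<in>\<J>. \<Oplus>\<^bsub>XX g N\<^esub>l\<in>\<J>. \<Oplus>\<^bsub>XX g N\<^esub>s\<in>{..r}.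
      pure_tensor \<X> \<X> (?f k l s) (?\<sigma> k l (r - s)))" (is "_ = \<eta> ?sum")
    using f Sigma_in_yangian carriers ij
    by (simp add: XX.T.embed_finsum XX.T.finsum_closed subset_iff cong: sum.cong)
  finally have eq: "\<eta> (\<Delta> (?\<sigma> i j r)) = \<eta> ?sum" .
  have sum: "?sum \<in> ?TS"
    by (intro XX.T.subspace_finsum[OF TS(1)] TS(2) f twisted_yangian_subalgebra(3))
  have "?\<sigma> i j r \<in> carrier \<X>"
    using Sigma_in_yangian[OF ij] carriers(1) by blast
  then have "\<Delta> (?\<sigma> i j r) = ?sum"
    using eq XX.T.embed_inject[OF coproduct_closed subsetD[OF is_subspaceD(1)[OF TS(1)] sum]] by blast
  then show ?thesis
    using sum by simp
qed

theorem twisted_yangian_left_coideal: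
  "left_coideal_subalgebra \<X> \<Delta> (yangian g N) (twisted_yangian g N \<tau>)"
proof -
  let ?TS = "tensor_subspace \<X> \<X> (yangian g N) (twisted_yangian g N \<tau>)"
  have carriers: "yangian g N \<subseteq> carrier \<X>" "twisted_yangian g N \<tau> \<subseteq> carrier \<X>"
    using is_subspaceD(1)[OF is_subalgebraD(1)] yangian_subalgebra(1) twisted_yangian_subalgebra(1) by blast+
  note TS = XX.tensor_subspace_is_subspace[OF carriers]
  \<comment> \<open>a subalgebra containing the generators of the twisted Yangian\<close>
  define B where "B = {x \<in> carrier \<X>. \<Delta> x \<in> ?TS}"
  have zero: "\<Delta> \<zero>\<^bsub>\<X>\<^esub> = \<zero>\<^bsub>XX g N\<^esub>"
    using coproduct_smult[of "\<one>\<^bsub>\<X>\<^esub>" 0] coproduct_closed[of "\<one>\<^bsub>\<X>\<^esub>"] by simp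
  have one: "\<one>\<^bsub>XX g N\<^esub> \<in> ?TS"
    unfolding XX.tensor_one
    by (intro TS(2) is_subalgebraD(2)[OF yangian_subalgebra(1)] is_subalgebraD(2)[OF twisted_yangian_subalgebra(1)])
  have "is_subalgebra B \<X>"
    unfolding B_def
    by (intro X.is_subalgebraI X.is_subspaceI)
      (auto simp: zero one coproduct_one coproduct_hom coproduct_smult is_subspaceD[OF TS(1)]
        XX.tensor_subspace_mult_closed[OF yangian_subalgebra(1) twisted_yangian_subalgebra(1)])
  moreover have "{Sigma_matrix g N \<tau> i j r | i j r. i \<in> \<J> \<and> j \<in> \<J>} \<subseteq> B"
    using coproduct_Sigma Sigma_in_yangian carriers(1) unfolding B_def by blast
  ultimately have "twisted_yangian g N \<tau> \<subseteq> B"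
    unfolding twisted_yangian_def by (rule generated_subalgebra_minimal)
  then show ?thesis
    using yangian_subalgebra(1) twisted_yangian_subalgebra
    by (auto simp: left_coideal_subalgebra_def B_def)
qed

end

theorem corollary3p2:
  fixes g :: lie_type and N :: nat and \<tau> :: pair_type
  assumes "valid_pair_type g N \<tau>"
  shows "left_coideal_subalgebra (extended_yangian g N) (coproduct g N)
           (yangian g N) (twisted_yangian g N \<tau>)"
proof -
  interpret extended_yangian_data g N
    using assms by unfold_locales (simp add: valid_pair_type_def)
  show ?thesis
    by (rule twisted_yangian_left_coideal)
qed

end
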